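(* Let $n\ge 2$ and let $M$ be a smooth compact convex hypersurface in $\mathbb R^{n+1}$ (connected, embedded, without boundary, bounding a convex set $G$). Assume: (Main Assumption) for any two points $(X',X_{n+1}),(X',\widehat X_{n+1})\in M$ with $X_{n+1}\ge \widehat X_{n+1}$ such that the segment $\{(X',\theta X_{n+1}+(1-\theta)\widehat X_{n+1}) : 0\le\theta\le 1\}$ lies in $\overline G$, one has $H(X',X_{n+1})\le H(X',\widehat X_{n+1})$; (Condition T) for every $\bar X\in T$ there is an integer $k\ge 2$ such that $\partial_t^k v(0,0)\ne 0$, where $v=v_{\bar X}$ is the local graph function of $M$ at $\bar X$. Then $M$ is symmetric with respect to some hyperplane $\{X_{n+1}=\text{constant}\}$.
   Context: Points of $\mathbb R^{n+1}$ are written $X=(X',X_{n+1})$ with $X'=(X_1,\dots,X_n)$. $G$ denotes the bounded open set bounded by $M$. $\nu(X)=(\nu_1(X),\dots,\nu_{n+1}(X))$ is the inner unit normal to $M$ at $X$ (pointing into $G$). $H(X)=\frac1n[k_1(X)+\cdots+k_n(X)]$ is the mean curvature, where $k_1(X),\dots,k_n(X)$ are the principal curvatures of $M$ at $X$ with respect to the inner normal (so round spheres have positive curvatures). $T:=\{X\in M : \nu_{n+1}(X)=0\}$. For $\bar X\in T$, the local graph function $v=v_{\bar X}$ is defined as follows. Take Cartesian coordinates $(y_1,\dots,y_{n-1},t,y_{n+1})$ centered at $\bar X$, with orthogonal axes, the $y_{n+1}$-axis pointing in the direction $\nu(\bar X)$, the $t$-axis pointing in the direction opposite to the $X_{n+1}$-axis,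 so that the $(y_1,\dots,y_{n-1},t)$-plane is the tangent plane of $M$ at $\bar X$. Near the origin $M$ is the graph $y_{n+1}=v(t,y)$, $y=(y_1,\dots,y_{n-1})$, of a smooth function $v$ with $v(0,0)=0$, $\nabla v(0,0)=0$. *)

theory Defs
  imports "HOL-Analysis.Analysis"
begin

text \<open>A point \<open>X = (X', X\<^sub>n\<^sub>+\<^sub>1)\<close> of \<open>(n+1)\<close>-space is a pair in \<open>real ^ 'n \<times> real\<close> with
  \<open>n = CARD('n)\<close>; inner product and norm of the product type are the Euclidean ones.\<close>

type_synonym 'n point = "(real ^ 'n) \<times> real"

primrec Ck_on :: "nat \<Rightarrow> ('a::real_normed_vector \<Rightarrow> 'b::real_normed_vector) \<Rightarrow> 'a set \<Rightarrow> bool" where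
  "Ck_on 0 f S \<longleftrightarrow> continuous_on S f"
| "Ck_on (Suc k) f S \<longleftrightarrow> (\<forall>x\<in>S. f differentiable (at x)) \<and>
     (\<forall>h. Ck_on k (\<lambda>x. frechet_derivative f (at x) h) S)"

definition smooth_on :: "('a::real_normed_vector \<Rightarrow> 'b::real_normed_vector) \<Rightarrow> 'a set \<Rightarrow> bool" where
  "smooth_on f S \<longleftrightarrow> (\<forall>k. Ck_on k f S)"

definition orthonormal_family :: "('i \<Rightarrow> 'a::real_inner) \<Rightarrow> bool" where
  "orthonormal_family e \<longleftrightarrow> (\<forall>i j. e i \<bullet> e j = (if i = j then 1 else 0))"

text \<open>\<open>local_graph M X e N v\<close>: in the Cartesian coordinates centered at \<open>X\<close> with orthonormal axes
  \<open>e\<^sub>i\<close> (\<open>i :: 'n\<close>) and \<open>N\<close>, near the origin \<open>M\<close> is the graph in direction \<open>N\<close> of the smooth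
  function \<open>v\<close> of the remaining \<open>n\<close> coordinates, with \<open>v\<close> and its gradient vanishing at \<open>0\<close>.
  Only the germ of \<open>v\<close> at \<open>0\<close> matters, and it is determined by \<open>M\<close>, \<open>X\<close>, \<open>e\<close>, \<open>N\<close>.\<close>

definition local_graph ::
  "'n::finite point set \<Rightarrow> 'n point \<Rightarrow> ('n \<Rightarrow> 'n point) \<Rightarrow> 'n point \<Rightarrow> (real ^ 'n \<Rightarrow> real) \<Rightarrow> bool" where
  "local_graph M X e N v \<longleftrightarrow>
     orthonormal_family e \<and> norm N = 1 \<and> (\<forall>i. e i \<bullet> N = 0) \<and>
     v 0 = 0 \<and> (v has_derivative (\<lambda>_. 0)) (at 0) \<and>
     (\<exists>B U. open B \<and> 0 \<in> B \<and> smooth_on v B \<and> open U \<and> X \<in> U \<and>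
        M \<inter> U = (\<lambda>z. X + (\<Sum>i\<in>UNIV. (z $ i) *\<^sub>R e i) + v z *\<^sub>R N) ` B)"

text \<open>Embedded smooth hypersurface without boundary: near each of its points, the set is a
  smooth graph over its tangent plane there.\<close>

definition smooth_hypersurface :: "'n::finite point set \<Rightarrow> bool" where
  "smooth_hypersurface M \<longleftrightarrow> (\<forall>X\<in>M. \<exists>e N v. local_graph M X e N v)"

definition tangent_space :: "'a::real_normed_vector set \<Rightarrow> 'a \<Rightarrow> 'a set" where
  "tangent_space M X = {w. \<exists>\<gamma> \<epsilon>. \<epsilon> > 0 \<and> \<gamma> ` {-\<epsilon><..<\<epsilon>} \<subseteq> M \<and> \<gamma> 0 = X \<and>
     (\<gamma> has_vector_derivative w) (at 0)}"

definition inner_normal :: "'n::finite point set \<Rightarrow> 'n point set \<Rightarrow> 'n point \<Rightarrow> 'n point" where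
  "inner_normal M G X = (THE N. norm N = 1 \<and> (\<forall>w\<in>tangent_space M X. N \<bullet> w = 0) \<and>
     (\<exists>\<epsilon>>0. \<forall>s\<in>{0<..<\<epsilon>}. X + s *\<^sub>R N \<in> G))"

text \<open>The principal curvatures are the eigenvalues, listed with multiplicity, of the shape operator
  \<open>- d\<nu>\<close> on the tangent space, where \<open>\<nu>\<close> is the inner normal; round spheres get positive values.
  The derivative within \<open>M\<close> is unique only on tangent vectors, and it is only used there.\<close>

definition principal_curvatures ::
  "'n::finite point set \<Rightarrow> 'n point set \<Rightarrow> 'n point \<Rightarrow> ('n \<Rightarrow> real) \<Rightarrow> bool" where
  "principal_curvatures M G X k \<longleftrightarrow>
     (\<exists>e D. orthonormal_family e \<and> (\<forall>i. e i \<in> tangent_space M X) \<and>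
        (inner_normal M G has_derivative D) (at X within M) \<and>
        (\<forall>i. - D (e i) = k i *\<^sub>R e i))"

definition mean_curvature :: "'n::finite point set \<Rightarrow> 'n point set \<Rightarrow> 'n point \<Rightarrow> real" where
  "mean_curvature M G X =
     (THE h. \<exists>k. principal_curvatures M G X k \<and> h = (\<Sum>i\<in>UNIV. k i) / real CARD('n))"

text \<open>Points where the last component of the inner normal vanishes.\<close>

definition horizontal_normal_set :: "'n::finite point set \<Rightarrow> 'n point set \<Rightarrow> 'n point set" where
  "horizontal_normal_set M G = {X \<in> M. snd (inner_normal M G X) = 0}"

text \<open>In the coordinates used here the axis with index \<open>i0\<close> is the \<open>t\<close>-axis, pointing opposite to the
  last coordinate axis; the remaining \<open>n - 1\<close> tangential axes are the \<open>y\<close>-axes, and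
  \<open>(deriv ^^ k) (\<lambda>t. v (axis i0 t)) 0\<close> is the \<open>k\<close>-th partial derivative of \<open>v\<close> in \<open>t\<close> at the origin.
  Its value does not depend on the choice of the \<open>y\<close>-axes.\<close>

definition condition_T :: "'n::finite point set \<Rightarrow> 'n point set \<Rightarrow> bool" where
  "condition_T M G \<longleftrightarrow>
     (\<forall>X\<in>horizontal_normal_set M G. \<forall>e i0 v.
        local_graph M X e (inner_normal M G X) v \<and> e i0 = (0, -1) \<longrightarrow>
        (\<exists>k\<ge>2. (deriv ^^ k) (\<lambda>t. v (axis i0 t)) 0 \<noteq> 0))"

definition main_assumption :: "'n::finite point set \<Rightarrow> 'n point set \<Rightarrow> bool" where
  "main_assumption M G \<longleftrightarrow>
     (\<forall>x a b. (x, a) \<in> M \<and> (x, b) \<in> M \<and> a \<ge> b \<and>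
        {(x, \<theta> * a + (1 - \<theta>) * b) | \<theta>. 0 \<le> \<theta> \<and> \<theta> \<le> 1} \<subseteq> closure G \<longrightarrow>
        mean_curvature M G (x, a) \<le> mean_curvature M G (x, b))"

end

theory Submission
  imports Defs
begin

text \<open>
  The proof is a first-variation form of Steiner symmetrisation.  Let \<open>\<Omega>\<close> be the shadow of \<open>G\<close> on the
  first \<open>n\<close> coordinates, so that \<open>G\<close> consists of the points \<open>(x, s)\<close> with \<open>x\<close> in \<open>\<Omega>\<close> and
  \<open>lower x < s < upper x\<close>.  It suffices to show that \<open>upper + lower\<close> is constant.  Let \<open>p\<close> and \<open>q\<close> be the
  horizontal parts of the inner normal at the upper and at the lower point over \<open>x\<close>, and let
  \<open>P = p - q\<close>.  Three facts about this vector field on \<open>\<Omega>\<close> carry the argument.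

  \<^item> The divergence of \<open>p\<close> is \<open>- n H\<close> at the upper point, and likewise for \<open>q\<close>
    (\<open>hnormal_has_derivative\<close>, a rewording of \<open>trace_dnormal_graph\<close>).  Hence the ordering of the mean
    curvatures says precisely that \<open>P\<close> has nonnegative divergence.

  \<^item> The gradient of a graph function is the horizontal part of its normal divided by minus the vertical
    part: it is \<open>S p\<close> for \<open>upper\<close> and \<open>- S q\<close> for \<open>lower\<close>, where \<open>S p = p / sqrt (1 - p \<bullet> p)\<close> is strictly monotone.
    So \<open>grad (upper + lower) \<bullet> P\<close> is nonnegative and vanishes only where the two normals are mirror images
    (\<open>normal_difference_identity\<close>).

  \<^item> \<open>P\<close> tends to zero at the boundary of \<open>\<Omega>\<close> (\<open>normals_close_near_boundary\<close>): a hyperplane supporting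
    \<open>\<Omega>\<close> at a boundary point lifts to a vertical hyperplane that supports \<open>G\<close> at every point of \<open>M\<close> above, and
    the supporting hyperplane at a point of \<open>M\<close> is unique.

  Choose \<open>C\<close> with \<open>\<phi> = upper + lower + C \<ge> 0\<close>.  Formally the divergence theorem for \<open>\<phi> P\<close> reads
  \<open>0 = \<integral> \<phi> div P + \<integral> grad \<phi> \<bullet> P\<close>, where both integrands are nonnegative.  So the second one vanishes, the
  gradient of \<open>upper + lower\<close> is zero, and the reflection exchanging the two graphs preserves \<open>M\<close>.
  Since the gradients blow up at the boundary of \<open>\<Omega>\<close>, the field is multiplied by a cutoff function;
  \<open>boundary_null_field_orthogonal\<close> shows that the error term tends to zero.

  The differential geometry is reduced to two points.  The inner normal of \<open>M\<close> is characterised as the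
  unit vector that supports \<open>G\<close> (\<open>inner_normal_eq\<close>), which gives its uniqueness, its continuity and its sign.
  In a local graph over a tangent plane, its differential at the centre is the Hessian of the graph
  function up to a sign (\<open>normal_has_derivative\<close>); the Hessian is symmetric, so principal curvatures exist and
  their sum is, with that sign, its trace (\<open>principal_curvatures_sum\<close>).
\<close>

section \<open>Lipschitz functions and the divergence theorem for compact support\<close>

text \<open>The balls are balls of the whole space, also when they leave \<open>S\<close>.\<close>

definition locally_lipschitz_on :: "'a::metric_space set \<Rightarrow> ('a \<Rightarrow> 'b::metric_space) \<Rightarrow> bool" where
  "locally_lipschitz_on S f \<longleftrightarrow> (\<forall>x\<in>S. \<exists>e>0. \<exists>L. L-lipschitz_on (ball x e) f)"

lemma locally_lipschitz_imp_isCont: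
  assumes "locally_lipschitz_on S f" "x \<in> S"
  shows "isCont f x"
proof -
  obtain e L where "e > 0" "L-lipschitz_on (ball x e) f"
    using assms unfolding locally_lipschitz_on_def by blast
  then show ?thesis
    using lipschitz_on_continuous_on continuous_on_eq_continuous_at centre_in_ball open_ball by blast
qed

lemma locally_lipschitz_on_Lipschitz:
  assumes "L-lipschitz_on UNIV f"
  shows "locally_lipschitz_on S f"
  unfolding locally_lipschitz_on_def
  using lipschitz_on_subset[OF assms subset_UNIV] zero_less_one by blast

lemma locally_lipschitz_on_diff:
  fixes f g :: "'a::metric_space \<Rightarrow> 'b::real_normed_vector"
  assumes "locally_lipschitz_on S f" "locally_lipschitz_on S g"
  shows "locally_lipschitz_on S (\<lambda>x. f x - g x)"
  unfolding locally_lipschitz_on_def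
proof
  fix x assume x: "x \<in> S"
  obtain e L where 1: "e > 0" "L-lipschitz_on (ball x e) f"
    using assms(1) x unfolding locally_lipschitz_on_def by blast
  obtain e' L' where 2: "e' > 0" "L'-lipschitz_on (ball x e') g"
    using assms(2) x unfolding locally_lipschitz_on_def by blast
  have "(L + L')-lipschitz_on (ball x (min e e')) (\<lambda>x. f x - g x)"
    by (intro lipschitz_on_diff lipschitz_on_subset[OF 1(2)] lipschitz_on_subset[OF 2(2)]) auto
  moreover have "min e e' > 0" using 1 2 by auto
  ultimately show "\<exists>e>0. \<exists>L. L-lipschitz_on (ball x e) (\<lambda>x. f x - g x)" by blast
qed

lemma locally_lipschitz_on_scaleR:
  fixes f :: "'a::metric_space \<Rightarrow> real" and g :: "'a \<Rightarrow> 'b::real_normed_vector"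
  assumes "locally_lipschitz_on S f" "locally_lipschitz_on S g"
  shows "locally_lipschitz_on S (\<lambda>x. f x *\<^sub>R g x)"
  unfolding locally_lipschitz_on_def
proof
  fix x assume x: "x \<in> S"
  obtain e L where 1: "e > 0" "L-lipschitz_on (ball x e) f"
    using assms(1) x unfolding locally_lipschitz_on_def by blast
  obtain e' L' where 2: "e' > 0" "L'-lipschitz_on (ball x e') g"
    using assms(2) x unfolding locally_lipschitz_on_def by blast
  define d where "d = min 1 (min e e')"
  define A where "A = \<bar>f x\<bar> + L"
  define B where "B = norm (g x) + L'"
  have L: "L \<ge> 0" "L' \<ge> 0" using 1 2 lipschitz_on_nonneg by auto
  have d: "d > 0" "d \<le> 1" "d \<le> e" "d \<le> e'" using 1 2 by (auto simp: d_def)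
  have f: "\<bar>f y\<bar> \<le> A" if "y \<in> ball x d" for y
  proof -
    have "\<bar>f y - f x\<bar> \<le> L * dist y x"
      using lipschitz_onD[OF 1(2), of y x] that d by (auto simp: dist_real_def dist_commute)
    also have "\<dots> \<le> L * 1" using that d L by (intro mult_left_mono) (auto simp: dist_commute)
    finally show ?thesis by (auto simp: A_def)
  qed
  have g: "norm (g y) \<le> B" if "y \<in> ball x d" for y
  proof -
    have "norm (g y - g x) \<le> L' * dist y x"
      using lipschitz_onD[OF 2(2), of y x] that d by (auto simp: dist_norm dist_commute norm_minus_commute)
    also have "\<dots> \<le> L' * 1" using that d L by (intro mult_left_mono) (auto simp: dist_commute)
    finally show ?thesis using norm_triangle_sub[of "g y" "g x"] by (auto simp: B_def)
  qed
  have AB: "A \<ge> 0" "B \<ge> 0" using L by (auto simp: A_def B_def)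
  have "(A * L' + L * B)-lipschitz_on (ball x d) (\<lambda>x. f x *\<^sub>R g x)"
  proof (rule lipschitz_onI)
    fix y z assume yz: "y \<in> ball x d" "z \<in> ball x d"
    have "f y *\<^sub>R g y - f z *\<^sub>R g z = f y *\<^sub>R (g y - g z) + (f y - f z) *\<^sub>R g z"
      by (simp add: algebra_simps)
    then have "norm (f y *\<^sub>R g y - f z *\<^sub>R g z) \<le> \<bar>f y\<bar> * norm (g y - g z) + \<bar>f y - f z\<bar> * norm (g z)"
      by (metis norm_triangle_ineq norm_scaleR)
    also have "\<dots> \<le> A * (L' * dist y z) + (L * dist y z) * B"
      using f[OF yz(1)] g[OF yz(2)] AB L yz d lipschitz_onD[OF 1(2), of y z] lipschitz_onD[OF 2(2), of y z]
      by (intro add_mono mult_mono) (auto simp: dist_norm)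
    finally show "dist (f y *\<^sub>R g y) (f z *\<^sub>R g z) \<le> (A * L' + L * B) * dist y z"
      by (simp add: dist_norm algebra_simps)
  qed (use AB L in auto)
  with d(1) show "\<exists>e>0. \<exists>L. L-lipschitz_on (ball x e) (\<lambda>x. f x *\<^sub>R g x)" by blast
qed

text \<open>On a ball \<open>B\<close> somewhat larger than the support, compactness provides one Lipschitz constant.  A point of the
support and a point outside \<open>B\<close> are at distance at least 1, so there a bound for \<open>f\<close> is a Lipschitz constant.\<close>

lemma locally_lipschitz_bounded_support:
  fixes f :: "'a::euclidean_space \<Rightarrow> 'b::real_normed_vector"
  assumes lip: "locally_lipschitz_on UNIV f" and C: "bounded C" "\<And>x. x \<notin> C \<Longrightarrow> f x = 0"
  obtains L where "L-lipschitz_on UNIV f"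
proof -
  obtain R where R: "R > 0" "\<And>x. x \<in> C \<Longrightarrow> norm x \<le> R"
    using C(1) bounded_pos by metis
  have "local_lipschitz {0::real} (cball 0 (R + 1)) (\<lambda>_. f)"
    unfolding local_lipschitz_def
  proof (intro ballI)
    fix x :: 'a and t assume "x \<in> cball 0 (R+1)" "t \<in> {0::real}"
    obtain e L where "e > 0" "L-lipschitz_on (ball x e) f"
      using lip unfolding locally_lipschitz_on_def by blast
    then have "L-lipschitz_on (cball x (e/2) \<inter> cball 0 (R + 1)) f"
      by (elim lipschitz_on_subset) auto
    with \<open>e > 0\<close> show "\<exists>u>0. \<exists>L. \<forall>t\<in>cball t u \<inter> {0}. L-lipschitz_on (cball x u \<inter> cball 0 (R + 1)) f"
      by (intro exI[of _ "e/2"]) auto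
  qed
  then obtain L where L: "L-lipschitz_on (cball 0 (R+1)) f"
    using local_lipschitz_compact_implies_lipschitz[of "{0::real}" "cball 0 (R+1)" "\<lambda>_. f"] by auto
  have cont: "continuous_on UNIV f"
    using locally_lipschitz_imp_isCont[OF lip] by (simp add: continuous_at_imp_continuous_on)
  obtain B where B: "B > 0" "\<And>x. x \<in> cball 0 (R+1) \<Longrightarrow> norm (f x) \<le> B"
    using compact_imp_bounded[OF compact_continuous_image[OF continuous_on_subset[OF cont] compact_cball[of 0 "R+1"]]]
    unfolding bounded_pos by auto
  have L0: "L \<ge> 0" using L lipschitz_on_nonneg by auto
  have far: "norm (f x - f y) \<le> B * dist x y" if "norm x \<le> R + 1" "norm y > R + 1" for x y
  proof (cases "x \<in> C")
    case True
    have fy: "f y = 0" using C(2)[of y] R(2)[of y] that by fastforce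
    have "dist x y \<ge> 1" using R(2)[OF True] that norm_triangle_ineq2[of y x]
      by (simp add: dist_norm norm_minus_commute)
    then have "B * 1 \<le> B * dist x y" using B by (intro mult_left_mono) auto
    then show ?thesis using B(2)[of x] that fy by auto
  next
    case False
    have fy: "f y = 0" using C(2)[of y] R(2)[of y] that by fastforce
    then show ?thesis using C(2)[OF False] B by auto
  qed
  have "(L + B)-lipschitz_on UNIV f"
  proof (rule lipschitz_onI)
    fix x y :: 'a
    have 1: "L * dist x y \<le> (L + B) * dist x y" "B * dist x y \<le> (L + B) * dist x y"
      using L0 B by (auto intro: mult_right_mono)
    consider "norm x \<le> R+1" "norm y \<le> R+1" | "norm x \<le> R+1" "norm y > R+1"
      | "norm x > R+1" "norm y \<le> R+1" | "norm x > R+1" "norm y > R+1" by linarith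
    then have "dist (f x) (f y) \<le> L * dist x y \<or> dist (f x) (f y) \<le> B * dist x y"
    proof cases
      case 1 then show ?thesis using lipschitz_onD[OF L, of x y] by auto
    next
      case 2 then show ?thesis using far[of x y] by (auto simp: dist_norm)
    next
      case 3 then show ?thesis using far[of y x] by (auto simp: dist_norm norm_minus_commute)
    next
      case 4
      then have "f x = 0" "f y = 0" using C(2) R(2) by fastforce+
      then show ?thesis using B by auto
    qed
    with 1 show "dist (f x) (f y) \<le> (L + B) * dist x y" by linarith
  qed (use L0 B in auto)
  then show thesis by (rule that)
qed

text \<open>Lebesgue measure is translation invariant, so every difference quotient of \<open>f\<close> has integral zero.  The
quotients are dominated by the Lipschitz constant on a bounded set, and dominated convergence applies.\<close>

lemma integral_directional_derivative_zero:
  fixes f :: "'a::euclidean_space \<Rightarrow> real"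
  assumes lip: "L-lipschitz_on UNIV f" and C: "bounded C" "\<And>x. x \<notin> C \<Longrightarrow> f x = 0"
    and der: "\<And>x. (f has_derivative f' x) (at x)"
  shows "has_bochner_integral lborel (\<lambda>x. f' x b) 0"
proof -
  obtain R where R: "R > 0" "\<And>x. x \<in> C \<Longrightarrow> norm x \<le> R"
    using C(1) bounded_pos by metis
  have cont: "continuous_on UNIV f"
    using lip lipschitz_on_continuous_on by blast
  have int: "integrable lborel f"
  proof -
    have "integrable lborel (\<lambda>x. indicator (cball 0 R) x *\<^sub>R f x)"
      by (intro borel_integrable_compact continuous_on_subset[OF cont]) auto
    moreover have "indicator (cball 0 R) x *\<^sub>R f x = f x" for x
      using C(2)[of x] R(2)[of x] by (cases "x \<in> C") auto
    ultimately show ?thesis by (simp only:)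
  qed
  define q where "q = (\<lambda>(k::nat) x. real (Suc k) * (f (inverse (real (Suc k)) *\<^sub>R b + x) - f x))"
  have shift_int: "integrable lborel (\<lambda>x. f (c + x))" "integral\<^sup>L lborel (\<lambda>x. f (c + x)) = integral\<^sup>L lborel f" for c
  proof -
    have m: "f \<in> borel_measurable borel" using cont by (rule borel_measurable_continuous_onI)
    show "integrable lborel (\<lambda>x. f (c + x))"
      using integrable_distr_eq[of "(+) c" lborel borel f] m int by (simp add: lborel_distr_plus)
    show "integral\<^sup>L lborel (\<lambda>x. f (c + x)) = integral\<^sup>L lborel f"
      using integral_distr[of "(+) c" lborel borel f] m by (simp add: lborel_distr_plus)
  qed
  have q0: "integral\<^sup>L lborel (q k) = 0" for k
    unfolding q_def using shift_int[of "inverse (real (Suc k)) *\<^sub>R b"] int by simp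
  define w where "w = (\<lambda>x::'a. indicator (cball 0 (R + norm b)) x *\<^sub>R (L * norm b))"
  have w: "integrable lborel w"
    unfolding w_def by (intro borel_integrable_compact) (auto intro: continuous_intros)
  have lim: "(\<lambda>k. q k x) \<longlonglongrightarrow> f' x b" for x
  proof -
    have lin: "linear (f' x)" using der has_derivative_linear by blast
    let ?h = "\<lambda>k. inverse (real (Suc k)) *\<^sub>R b"
    have h0: "?h \<longlonglongrightarrow> 0"
      using tendsto_scaleR[OF LIMSEQ_inverse_real_of_nat tendsto_const[of b]] by simp
    show ?thesis
    proof (cases "b = 0")
      case True
      then show ?thesis using linear_0[OF lin] by (simp add: q_def)
    next
      case False
      have "filterlim ?h (at 0) sequentially"
        using h0 False by (auto simp: filterlim_at)
      moreover have "((\<lambda>h. norm (f (x + h) - f x - f' x h) / norm h) \<longlongrightarrow> 0) (at 0)"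
        using der[of x] unfolding has_derivative_at by auto
      ultimately have "(\<lambda>k. norm (f (x + ?h k) - f x - f' x (?h k)) / norm (?h k)) \<longlonglongrightarrow> 0"
        by (rule filterlim_compose[rotated])
      from tendsto_mult_right[OF this, of "norm b"]
      have "(\<lambda>k. (norm (f (x + ?h k) - f x - f' x (?h k)) / norm (?h k)) * norm b) \<longlonglongrightarrow> 0"
        by (simp add: mult.commute)
      moreover have "(norm (f (x + ?h k) - f x - f' x (?h k)) / norm (?h k)) * norm b
            = \<bar>q k x - f' x b\<bar>" for k
      proof -
        define A where "A = f (x + ?h k) - f x - f' x (?h k)"
        have "real (Suc k) * f' x (?h k) = f' x b"
          by (simp add: linear_scale[OF lin] del: of_nat_Suc)
        then have "q k x - f' x b = real (Suc k) * A"
          unfolding q_def A_def right_diff_distrib by (simp add: add.commute del: of_nat_Suc)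
        moreover have "norm (?h k) = norm b / real (Suc k)"
          by (simp add: field_simps del: of_nat_Suc)
        ultimately show ?thesis
          unfolding A_def[symmetric] using False by (simp add: abs_mult del: of_nat_Suc)
      qed
      ultimately have "(\<lambda>k. \<bar>q k x - f' x b\<bar>) \<longlonglongrightarrow> 0" by simp
      then have "(\<lambda>k. q k x - f' x b) \<longlonglongrightarrow> 0" using tendsto_rabs_zero_iff by blast
      then show ?thesis using LIM_zero_iff by blast
    qed
  qed
  have bound: "norm (q k x) \<le> w x" for k x
  proof (cases "x \<in> cball 0 (R + norm b)")
    case True
    have "\<bar>f (inverse (real (Suc k)) *\<^sub>R b + x) - f x\<bar> \<le> L * (inverse (real (Suc k)) * norm b)"
      using lipschitz_onD[OF lip, of "inverse (real (Suc k)) *\<^sub>R b + x" x]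
      by (simp add: dist_norm del: of_nat_Suc)
    then have "real (Suc k) * \<bar>f (inverse (real (Suc k)) *\<^sub>R b + x) - f x\<bar> \<le> real (Suc k) * (L * (inverse (real (Suc k)) * norm b))"
      by (intro mult_left_mono) auto
    also have "\<dots> = L * norm b" by (simp del: of_nat_Suc)
    finally show ?thesis using True by (simp add: q_def w_def abs_mult del: of_nat_Suc)
  next
    case False
    then have x: "norm x > R + norm b" by simp
    have "norm (inverse (real (Suc k)) *\<^sub>R b) \<le> 1 * norm b"
      unfolding norm_scaleR by (intro mult_right_mono) (auto simp: field_simps)
    then have "norm (inverse (real (Suc k)) *\<^sub>R b + x) > R"
      using x norm_triangle_ineq2[of x "- (inverse (real (Suc k)) *\<^sub>R b)"]
      by (simp add: add.commute del: of_nat_Suc)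
    moreover have "norm x > R" using x norm_ge_zero[of b] by linarith
    ultimately have "f (inverse (real (Suc k)) *\<^sub>R b + x) = 0" "f x = 0"
      using C(2) R(2) by fastforce+
    then show ?thesis using False by (simp add: q_def w_def)
  qed
  have meas: "q k \<in> borel_measurable lborel" for k
    unfolding q_def using shift_int(1)[of "inverse (real (Suc k)) *\<^sub>R b"] int
    by (intro borel_measurable_integrable Bochner_Integration.integrable_mult_right
        Bochner_Integration.integrable_diff)
  have meas': "(\<lambda>x. f' x b) \<in> borel_measurable lborel"
    by (rule borel_measurable_LIMSEQ_metric[OF meas]) (rule lim)
  note dct = meas' meas w AE_I2[OF lim] AE_I2[OF bound]
  have "integrable lborel (\<lambda>x. f' x b)"
    by (rule integrable_dominated_convergence[OF dct])
  moreover have "(\<lambda>k. integral\<^sup>L lborel (q k)) \<longlonglongrightarrow> integral\<^sup>L lborel (\<lambda>x. f' x b)"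
    by (rule integral_dominated_convergence[OF dct])
  then have "integral\<^sup>L lborel (\<lambda>x. f' x b) = 0"
    using q0 by (simp add: LIMSEQ_const_iff)
  ultimately show ?thesis by (simp add: has_bochner_integral_iff)
qed

lemma integral_divergence_zero:
  fixes F :: "'a::euclidean_space \<Rightarrow> 'a"
  assumes lip: "locally_lipschitz_on UNIV F" and C: "bounded C" "\<And>x. x \<notin> C \<Longrightarrow> F x = 0"
    and der: "\<And>x. (F has_derivative F' x) (at x)"
  shows "has_bochner_integral lborel (\<lambda>x. \<Sum>b\<in>Basis. F' x b \<bullet> b) 0"
proof -
  obtain L where L: "L-lipschitz_on UNIV F"
    using locally_lipschitz_bounded_support[OF lip C] by blast
  have "has_bochner_integral lborel (\<lambda>x. F' x b \<bullet> b) 0" if b: "b \<in> Basis" for b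
  proof (rule integral_directional_derivative_zero[where L=L and C=C and f="\<lambda>x. F x \<bullet> b" and f'="\<lambda>x h. F' x h \<bullet> b"])
    show "L-lipschitz_on UNIV (\<lambda>x. F x \<bullet> b)"
    proof (rule lipschitz_onI)
      fix x y
      have "\<bar>F x \<bullet> b - F y \<bullet> b\<bar> \<le> norm (F x - F y)"
        unfolding inner_diff_left[symmetric] using b by (rule Basis_le_norm)
      also have "\<dots> \<le> L * dist x y" using lipschitz_onD[OF L] by (simp add: dist_norm)
      finally show "dist (F x \<bullet> b) (F y \<bullet> b) \<le> L * dist x y" by (simp add: dist_norm)
    qed (use L lipschitz_on_nonneg in auto)
  qed (use C der in \<open>auto intro!: derivative_eq_intros\<close>)
  then have "has_bochner_integral lborel (\<lambda>x. \<Sum>b\<in>Basis. F' x b \<bullet> b) (\<Sum>b\<in>(Basis :: 'a set). 0)"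
    by (rule has_bochner_integral_sum)
  then show ?thesis by simp
qed

section \<open>A vanishing principle for vector fields on convex domains\<close>

text \<open>The cutoff is a function of the distance to \<open>K\<close>, so its gradient at \<open>x\<close> is a nonnegative multiple of
\<open>p x - x\<close>, where \<open>p x\<close> is the point of \<open>K\<close> nearest to \<open>x\<close>.  The squared distance to a closed convex set is
differentiable everywhere because the nearest-point map is Lipschitz.
The bound for \<open>r * norm (g x)\<close> uses that the half-space bounded by the hyperplane through \<open>p x\<close> and
orthogonal to \<open>x - p x\<close> contains \<open>K\<close>, and with it the whole ball of radius \<open>r\<close> around \<open>a\<close>.  It turns an
integral of \<open>norm (g x)\<close> into the integral of a radial derivative, which is computed by a divergence.\<close>

lemma radial_cutoff:
  fixes K :: "'a::euclidean_space set"
  assumes K: "compact K" "convex K" and ball: "cball a r \<subseteq> K" "r > 0" and \<delta>: "\<delta> > 0"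
  obtains \<zeta> :: "'a \<Rightarrow> real" and g :: "'a \<Rightarrow> 'a" and L where
    "\<And>x. 0 \<le> \<zeta> x" "\<And>x. \<zeta> x \<le> 1" "\<And>x. x \<in> K \<Longrightarrow> \<zeta> x = 1"
    "\<And>x. \<zeta> x \<noteq> 0 \<Longrightarrow> \<exists>y\<in>K. dist x y < \<delta>" "\<And>x. \<zeta> x = 0 \<Longrightarrow> g x = 0" "\<And>x. x \<in> K \<Longrightarrow> g x = 0"
    "\<And>x. (\<zeta> has_derivative (\<lambda>h. g x \<bullet> h)) (at x)"
    "\<And>x. r * norm (g x) \<le> - (g x \<bullet> (x - a))"
    "L-lipschitz_on UNIV \<zeta>"
proof -
  have cl: "closed K" using K compact_imp_closed by blast
  have aK: "a \<in> K" using ball by auto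
  then have ne: "K \<noteq> {}" by auto
  define p where "p = closest_point K"
  have pK: "p x \<in> K" for x using closest_point_in_set[OF cl ne] by (simp add: p_def)
  have pdist: "dist x (p x) \<le> dist x y" if "y \<in> K" for x y
    using closest_point_le[OF cl that] by (simp add: p_def)
  have plip: "norm (p x - p y) \<le> norm (x - y)" for x y
    using closest_point_lipschitz[OF K(2) cl ne] by (simp add: p_def dist_norm)
  define d2 where "d2 = (\<lambda>x. (norm (x - p x))\<^sup>2)"
  have d2_der: "(d2 has_derivative (\<lambda>h. 2 * ((x - p x) \<bullet> h))) (at x)" for x
  proof -
    have est: "\<bar>d2 (x + h) - d2 x - 2 * ((x - p x) \<bullet> h)\<bar> \<le> norm h * norm h" for h
    proof -
      have "d2 (x + h) \<le> (norm (x + h - p x))\<^sup>2"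
        unfolding d2_def using pdist[OF pK[of x], of "x + h"] by (intro power_mono) (auto simp: dist_norm)
      also have "\<dots> = d2 x + 2 * ((x - p x) \<bullet> h) + norm h * norm h"
        by (simp add: d2_def power2_norm_eq_inner inner_simps inner_commute flip: power2_eq_square)
      finally have up: "d2 (x + h) \<le> d2 x + 2 * ((x - p x) \<bullet> h) + norm h * norm h" .
      have "d2 x \<le> (norm (x - p (x + h)))\<^sup>2"
        unfolding d2_def using pdist[OF pK[of "x + h"], of x] by (intro power_mono) (auto simp: dist_norm)
      also have "\<dots> = d2 (x + h) - 2 * ((x - p (x + h)) \<bullet> h) - norm h * norm h"
        by (simp add: d2_def power2_norm_eq_inner inner_simps inner_commute flip: power2_eq_square)
      also have "(x - p (x + h)) \<bullet> h = (x - p x) \<bullet> h + (p x - p (x + h)) \<bullet> h"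
        by (simp add: inner_simps)
      finally have lo: "d2 (x + h) - d2 x - 2 * ((x - p x) \<bullet> h) \<ge> 2 * ((p x - p (x + h)) \<bullet> h) + norm h * norm h"
        by simp
      have "\<bar>(p x - p (x + h)) \<bullet> h\<bar> \<le> norm (p x - p (x + h)) * norm h"
        by (rule Cauchy_Schwarz_ineq2)
      also have "\<dots> \<le> norm h * norm h"
        using plip[of x "x + h"] by (intro mult_right_mono) auto
      finally show ?thesis using up lo by linarith
    qed
    have "((\<lambda>h. norm (d2 (x + h) - d2 x - 2 * ((x - p x) \<bullet> h)) / norm h) \<longlongrightarrow> 0) (at 0)"
    proof (rule Lim_null_comparison)
      show "\<forall>\<^sub>F h in at 0. norm (norm (d2 (x + h) - d2 x - 2 * ((x - p x) \<bullet> h)) / norm h) \<le> norm h"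
        by (rule always_eventually) (use est in \<open>auto simp: divide_simps\<close>)
      show "((\<lambda>h. norm h) \<longlongrightarrow> 0) (at (0::'a))" by (rule tendsto_norm_zero) (rule tendsto_ident_at)
    qed
    moreover have "bounded_linear (\<lambda>h. 2 * ((x - p x) \<bullet> h))"
      using bounded_linear_const_mult[OF bounded_linear_inner_right] by blast
    ultimately show ?thesis unfolding has_derivative_at by blast
  qed
  define \<psi> where "\<psi> = (\<lambda>s::real. (max 0 (1 - s / \<delta>\<^sup>2))\<^sup>2)"
  define \<psi>' where "\<psi>' = (\<lambda>s::real. - (2 / \<delta>\<^sup>2) * max 0 (1 - s / \<delta>\<^sup>2))"
  have sq: "((\<lambda>s::real. (max 0 s)\<^sup>2) has_real_derivative 2 * max 0 s) (at s)" for s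
  proof -
    consider "s > 0" | "s < 0" | "s = 0" by linarith
    then show ?thesis
    proof cases
      case 1
      have "((\<lambda>s::real. s\<^sup>2) has_real_derivative 2 * s) (at s)" by (auto intro!: derivative_eq_intros)
      moreover have "\<forall>\<^sub>F x in nhds s. x\<^sup>2 = (max 0 x)\<^sup>2"
        using eventually_nhds_in_open[of "{0<..}" s] 1 by (auto elim!: eventually_mono)
      ultimately show ?thesis
        using 1 DERIV_cong_ev[of s s "\<lambda>s. s\<^sup>2" "\<lambda>s. (max 0 s)\<^sup>2" "2 * s" "2 * max 0 s"] by simp
    next
      case 2
      have "((\<lambda>s::real. 0) has_real_derivative 0) (at s)" by (rule DERIV_const)
      moreover have "\<forall>\<^sub>F x in nhds s. 0 = (max 0 x)\<^sup>2"
        using eventually_nhds_in_open[of "{..<0}" s] 2 by (auto elim!: eventually_mono)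
      ultimately show ?thesis
        using 2 DERIV_cong_ev[of s s "\<lambda>s. 0" "\<lambda>s. (max 0 s)\<^sup>2" 0 "2 * max 0 s"] by simp
    next
      case 3
      have "((\<lambda>h. ((max 0 (0 + h))\<^sup>2 - (max 0 0)\<^sup>2) / h) \<longlongrightarrow> (0::real)) (at 0)"
      proof (rule Lim_null_comparison)
        show "\<forall>\<^sub>F h in at 0. norm (((max 0 (0 + h))\<^sup>2 - (max 0 0)\<^sup>2) / h) \<le> \<bar>h::real\<bar>"
          by (rule always_eventually) (auto simp: power2_eq_square max_def)
        show "((\<lambda>h::real. \<bar>h\<bar>) \<longlongrightarrow> 0) (at 0)" by (rule tendsto_rabs_zero) (rule tendsto_ident_at)
      qed
      then show ?thesis using 3 by (simp add: DERIV_def)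
    qed
  qed
  have \<psi>_der: "(\<psi> has_real_derivative \<psi>' s) (at s)" for s
  proof -
    have "((\<lambda>s. 1 - s / \<delta>\<^sup>2) has_real_derivative - (1 / \<delta>\<^sup>2)) (at s)"
      using \<delta> by (auto intro!: derivative_eq_intros simp: field_simps)
    from DERIV_chain2[OF sq this] show ?thesis unfolding \<psi>_def \<psi>'_def by (simp add: algebra_simps)
  qed
  define \<zeta> where "\<zeta> = (\<lambda>x. \<psi> (d2 x))"
  define g where "g = (\<lambda>x. (2 * \<psi>' (d2 x)) *\<^sub>R (x - p x))"
  have \<psi>'0: "\<psi>' s \<le> 0" for s using \<delta> by (simp add: \<psi>'_def mult_nonpos_nonneg)
  have d20: "d2 x \<ge> 0" for x by (simp add: d2_def)
  have dK: "p x = x" if "x \<in> K" for x using closest_point_self[OF that] by (simp add: p_def)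
  have far: "\<psi>' (d2 x) = 0" "\<zeta> x = 0" if "norm (x - p x) \<ge> \<delta>" for x
  proof -
    have "d2 x \<ge> \<delta>\<^sup>2" using that \<delta> by (simp add: d2_def power_mono)
    then have "1 - d2 x / \<delta>\<^sup>2 \<le> 0" using \<delta> by simp
    then show "\<psi>' (d2 x) = 0" "\<zeta> x = 0" unfolding \<psi>'_def \<zeta>_def \<psi>_def by auto
  qed
  have \<zeta>_der: "(\<zeta> has_derivative (\<lambda>h. g x \<bullet> h)) (at x)" for x
  proof -
    have "((\<lambda>x. \<psi> (d2 x)) has_derivative (\<lambda>h. \<psi>' (d2 x) * (2 * ((x - p x) \<bullet> h)))) (at x)"
      by (rule has_derivative_compose[OF d2_der, of \<psi>, OF \<psi>_der[unfolded has_field_derivative_def]])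
    then show ?thesis by (simp add: \<zeta>_def g_def mult.assoc mult.left_commute)
  qed
  have gb: "norm (g x) \<le> 4 / \<delta>" for x
  proof (cases "norm (x - p x) \<ge> \<delta>")
    case True then show ?thesis using far(1)[OF True] \<delta> by (simp add: g_def)
  next
    case False
    have "\<bar>\<psi>' (d2 x)\<bar> \<le> 2 / \<delta>\<^sup>2"
      using d20[of x] \<delta> by (simp add: \<psi>'_def abs_mult divide_right_mono)
    then have "2 * \<bar>\<psi>' (d2 x)\<bar> * norm (x - p x) \<le> 2 * (2 / \<delta>\<^sup>2) * \<delta>"
      using False by (intro mult_mono) auto
    then show ?thesis using \<delta> by (simp add: g_def abs_mult power2_eq_square)
  qed
  show thesis
  proof (rule that[of \<zeta> g "4 / \<delta>"])
    show "0 \<le> \<zeta> x" for x by (simp add: \<zeta>_def \<psi>_def)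
    show "\<zeta> x \<le> 1" for x
    proof -
      have "max 0 (1 - d2 x / \<delta>\<^sup>2) \<le> 1" using d20[of x] by simp
      then show ?thesis unfolding \<zeta>_def \<psi>_def by (intro power_le_one) auto
    qed
    show "\<zeta> x = 1" if "x \<in> K" for x using dK[OF that] by (simp add: \<zeta>_def \<psi>_def d2_def)
    show "\<exists>y\<in>K. dist x y < \<delta>" if "\<zeta> x \<noteq> 0" for x
      using far(2)[of x] that pK[of x] by (force simp: dist_norm)
    show "g x = 0" if "\<zeta> x = 0" for x
      using that by (simp add: \<zeta>_def \<psi>_def g_def \<psi>'_def)
    show "g x = 0" if "x \<in> K" for x using dK[OF that] by (simp add: g_def)
    show "(\<zeta> has_derivative (\<lambda>h. g x \<bullet> h)) (at x)" for x by (rule \<zeta>_der)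
    show "r * norm (g x) \<le> - (g x \<bullet> (x - a))" for x
    proof -
      let ?w = "x - p x"
      have key: "r * norm ?w \<le> ?w \<bullet> (x - a)"
      proof (cases "?w = 0")
        case False
        let ?y = "a + (r / norm ?w) *\<^sub>R ?w"
        have "?y \<in> K" using ball False by (intro subsetD[OF ball(1)]) (simp add: dist_norm)
        then have "?w \<bullet> (?y - p x) \<le> 0" using closest_point_dot[OF K(2) cl] by (simp add: p_def)
        moreover have "?w \<bullet> (?y - p x) = ?w \<bullet> (a - x) + r * norm ?w + ?w \<bullet> ?w"
        proof -
          have "?y - p x = (a - x) + ?w + (r / norm ?w) *\<^sub>R ?w" by simp
          moreover have "(r / norm ?w) * (?w \<bullet> ?w) = r * norm ?w"
            using False by (simp add: dot_square_norm power2_eq_square)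
          ultimately show ?thesis by (simp only: inner_add_right inner_scaleR_right)
        qed
        moreover have "?w \<bullet> ?w \<ge> 0" by simp
        ultimately have "?w \<bullet> (a - x) + r * norm ?w \<le> 0" by linarith
        then show ?thesis by (simp add: inner_simps)
      qed simp
      have "- (2 * \<psi>' (d2 x)) * (r * norm ?w) \<le> - (2 * \<psi>' (d2 x)) * (?w \<bullet> (x - a))"
        using key \<psi>'0[of "d2 x"] by (intro mult_left_mono) auto
      moreover have "norm (g x) = - (2 * \<psi>' (d2 x)) * norm ?w"
        using \<psi>'0[of "d2 x"] by (simp add: g_def abs_mult)
      moreover have "g x \<bullet> (x - a) = 2 * \<psi>' (d2 x) * (?w \<bullet> (x - a))" by (simp add: g_def)
      ultimately show ?thesis by (simp add: mult.left_commute)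
    qed
    show "(4 / \<delta>)-lipschitz_on UNIV \<zeta>"
    proof (rule lipschitz_onI)
      fix x y :: 'a
      have "norm (\<zeta> x - \<zeta> y) \<le> 4 / \<delta> * norm (x - y)"
      proof (rule differentiable_bound[OF convex_UNIV])
        show "(\<zeta> has_derivative (\<lambda>h. g x \<bullet> h)) (at x within UNIV)" for x using \<zeta>_der by simp
        show "onorm (\<lambda>h. g x \<bullet> h) \<le> 4 / \<delta>" for x
        proof (rule onorm_le)
          fix h
          have "norm (g x \<bullet> h) \<le> norm (g x) * norm h" using Cauchy_Schwarz_ineq2 by simp
          also have "\<dots> \<le> 4 / \<delta> * norm h" using gb by (intro mult_right_mono) auto
          finally show "norm (g x \<bullet> h) \<le> 4 / \<delta> * norm h" .
        qed
      qed auto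
      then show "dist (\<zeta> x) (\<zeta> y) \<le> 4 / \<delta> * dist x y" by (simp add: dist_norm)
    qed (use \<delta> in auto)
  qed
qed

text \<open>Let \<open>\<zeta>\<close> be a cutoff that is 1 outside a small neighbourhood of the boundary.  The divergence of
\<open>\<zeta> \<phi> P\<close> integrates to zero, and it is the sum of two nonnegative terms, \<open>\<zeta> \<phi> div P\<close> and \<open>\<zeta> grad \<bullet> P\<close>, and the
error term \<open>\<phi> (g \<bullet> P)\<close> with \<open>g\<close> the gradient of \<open>\<zeta>\<close>.  The error is at most
\<open>C \<epsilon> norm g \<le> - (C \<epsilon> / r) (g \<bullet> (x - x0))\<close>.  The divergence of \<open>\<zeta> (x - x0)\<close> also integrates to zero, so the integral
of this bound is \<open>C \<epsilon> / r\<close> times the integral of \<open>n \<zeta>\<close>, which tends to zero with \<open>\<epsilon>\<close> however steep the cutoff is.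
If \<open>grad \<bullet> P\<close> were positive at \<open>x0\<close>, the integral of \<open>\<zeta> grad \<bullet> P\<close> would stay above a fixed positive number.\<close>

lemma boundary_null_field_orthogonal:
  fixes \<Omega> :: "'a::euclidean_space set"
  assumes \<Omega>: "open \<Omega>" "convex \<Omega>" "bounded \<Omega>"
    and \<phi>: "\<And>x. x \<in> \<Omega> \<Longrightarrow> (\<phi> has_derivative (\<lambda>h. grad x \<bullet> h)) (at x)"
    and \<phi>_lip: "locally_lipschitz_on \<Omega> \<phi>"
    and \<phi>_bd: "\<And>x. x \<in> \<Omega> \<Longrightarrow> 0 \<le> \<phi> x" "\<And>x. x \<in> \<Omega> \<Longrightarrow> \<phi> x \<le> C"
    and P: "\<And>x. x \<in> \<Omega> \<Longrightarrow> (P has_derivative P' x) (at x)"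
    and P_lip: "locally_lipschitz_on \<Omega> P"
    and div: "\<And>x. x \<in> \<Omega> \<Longrightarrow> 0 \<le> (\<Sum>b\<in>Basis. P' x b \<bullet> b)"
    and nonneg: "\<And>x. x \<in> \<Omega> \<Longrightarrow> 0 \<le> grad x \<bullet> P x"
    and cont: "continuous_on \<Omega> (\<lambda>x. grad x \<bullet> P x)"
    and decay: "\<And>\<epsilon>. \<epsilon> > 0 \<Longrightarrow> \<exists>K. compact K \<and> K \<subseteq> \<Omega> \<and> (\<forall>x\<in>\<Omega> - K. norm (P x) \<le> \<epsilon>)"
    and x0: "x0 \<in> \<Omega>"
  shows "grad x0 \<bullet> P x0 = 0"
proof (rule ccontr)
  assume "\<not> ?thesis"
  then have pos: "grad x0 \<bullet> P x0 > 0" using nonneg[OF x0] by simp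
  define c where "c = (grad x0 \<bullet> P x0) / 2"
  have c: "c > 0" using pos by (simp add: c_def)
  obtain r where r: "r > 0" "cball x0 r \<subseteq> \<Omega>" "\<And>x. x \<in> cball x0 r \<Longrightarrow> c \<le> grad x \<bullet> P x"
  proof -
    obtain e where e: "e > 0" "ball x0 e \<subseteq> \<Omega>" using \<Omega>(1) x0 openE by blast
    have "isCont (\<lambda>x. grad x \<bullet> P x) x0" using cont \<Omega>(1) x0 continuous_on_eq_continuous_at by blast
    then obtain d where d: "d > 0" "\<And>x. dist x x0 < d \<Longrightarrow> dist (grad x \<bullet> P x) (grad x0 \<bullet> P x0) < c"
      unfolding continuous_at_eps_delta using c by blast
    show thesis
    proof (rule that[of "min d e / 2"])
      show "cball x0 (min d e / 2) \<subseteq> \<Omega>" using e d by (intro order_trans[OF _ e(2)]) auto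
      show "c \<le> grad x \<bullet> P x" if "x \<in> cball x0 (min d e / 2)" for x
      proof -
        have "dist x x0 < d" using that d e by (auto simp: dist_commute)
        from d(2)[OF this] have "\<bar>grad x \<bullet> P x - 2 * c\<bar> < c" by (simp add: c_def dist_real_def)
        then show ?thesis by linarith
      qed
    qed (use d e in auto)
  qed
  have C0: "C \<ge> 0" using \<phi>_bd[OF x0] by linarith
  define V where "V = measure lborel (cball x0 r)"
  have V: "V > 0" unfolding V_def using content_cball_pos[OF r(1)] by simp
  obtain R where R: "R > 0" "\<Omega> \<subseteq> cball 0 R"
    using \<Omega>(3) unfolding bounded_pos by (meson mem_cball_0 subsetI)
  define m where "m = measure lborel (cball (0::'a) R)"
  have m0: "m \<ge> 0" by (simp add: m_def)
  define n where "n = real DIM('a)"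
  have n1: "n \<ge> 1" using DIM_positive[where 'a='a] by (simp add: n_def Suc_leI)
  define D where "D = (C + 1) * (m + 1)"
  have D: "D > 0" using C0 m0 by (simp add: D_def)
  \<comment> \<open>The value makes the bound \<open>C \<epsilon> n m / r\<close> for the error term smaller than \<open>c * V\<close>, which is a lower bound for the
contribution of the ball around \<open>x0\<close>.\<close>
  define \<epsilon> where "\<epsilon> = (c * V / D) * (r / n)"
  have \<epsilon>: "\<epsilon> > 0" using c V r(1) D n1 by (simp add: \<epsilon>_def)
  obtain K0 where K0: "compact K0" "K0 \<subseteq> \<Omega>" "\<And>x. x \<in> \<Omega> - K0 \<Longrightarrow> norm (P x) \<le> \<epsilon>"
    using decay[OF \<epsilon>] by blast
  define K where "K = convex hull (K0 \<union> cball x0 r)"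
  have K: "compact K" "convex K" "K \<subseteq> \<Omega>" "K0 \<subseteq> K" "cball x0 r \<subseteq> K"
  proof -
    show "compact K" unfolding K_def using K0(1) by (intro compact_convex_hull compact_Un) auto
    show "convex K" unfolding K_def by (rule convex_convex_hull)
    show "K \<subseteq> \<Omega>" unfolding K_def using K0(2) r(2) \<Omega>(2) by (intro hull_minimal) auto
    show "K0 \<subseteq> K" "cball x0 r \<subseteq> K" unfolding K_def using hull_subset[of "K0 \<union> cball x0 r" convex] by auto
  qed
  obtain \<delta>' where \<delta>': "\<delta>' > 0" "(\<Union>x\<in>K. cball x \<delta>') \<subseteq> \<Omega>"
    using compact_subset_open_imp_cball_epsilon_subset[OF K(1) \<Omega>(1) K(3)] by blast
  define \<delta> where "\<delta> = \<delta>' / 2"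
  have \<delta>: "\<delta> > 0" using \<delta>' by (simp add: \<delta>_def)
  obtain \<zeta> g L where \<zeta>: "\<And>x. 0 \<le> \<zeta> x" "\<And>x. \<zeta> x \<le> 1" "\<And>x. x \<in> K \<Longrightarrow> \<zeta> x = 1"
    "\<And>x. \<zeta> x \<noteq> 0 \<Longrightarrow> \<exists>y\<in>K. dist x y < \<delta>" and g0: "\<And>x. \<zeta> x = 0 \<Longrightarrow> g x = 0"
    and gK: "\<And>x. x \<in> K \<Longrightarrow> g x = 0"
    and \<zeta>_der: "\<And>x. (\<zeta> has_derivative (\<lambda>h. g x \<bullet> h)) (at x)"
    and g_rad: "\<And>x. r * norm (g x) \<le> - (g x \<bullet> (x - x0))"
    and \<zeta>_lip: "L-lipschitz_on UNIV \<zeta>"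
    by (rule radial_cutoff[OF K(1,2,5) r(1) \<delta>], rule that) assumption+
  have supp: "x \<in> \<Omega>" if "\<zeta> x \<noteq> 0" for x
  proof -
    obtain y where "y \<in> K" "dist x y < \<delta>" using \<zeta>(4)[OF \<open>\<zeta> x \<noteq> 0\<close>] by blast
    then have "x \<in> (\<Union>x\<in>K. cball x \<delta>')" using \<delta> by (auto simp: \<delta>_def dist_commute intro!: bexI[of _ y])
    then show ?thesis using \<delta>'(2) by blast
  qed
  have far: "\<zeta> y = 0" if "x \<notin> \<Omega>" "y \<in> ball x \<delta>" for x y
  proof (rule ccontr)
    assume "\<zeta> y \<noteq> 0"
    then obtain z where "z \<in> K" "dist y z < \<delta>" using \<zeta>(4) by blast
    moreover have "dist z x \<le> dist y z + dist x y" by (metis add.commute dist_commute dist_triangle)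
    ultimately have "x \<in> (\<Union>x\<in>K. cball x \<delta>')"
      using that(2) by (auto simp: \<delta>_def intro!: bexI[of _ z])
    then show False using \<delta>'(2) that(1) by blast
  qed
  have \<zeta>_ll: "locally_lipschitz_on S \<zeta>" for S using locally_lipschitz_on_Lipschitz[OF \<zeta>_lip] .

  define F where "F = (\<lambda>x. (\<zeta> x * \<phi> x) *\<^sub>R P x)"
  define F' where "F' = (\<lambda>x h. if x \<in> \<Omega> then (\<zeta> x * \<phi> x) *\<^sub>R P' x h + (\<zeta> x * (grad x \<bullet> h) + (g x \<bullet> h) * \<phi> x) *\<^sub>R P x else 0)"
  have F_out: "F y = 0" if "x \<notin> \<Omega>" "y \<in> ball x \<delta>" for x y
    using far[OF that] by (simp add: F_def)
  have F_der: "(F has_derivative F' x) (at x)" for x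
  proof (cases "x \<in> \<Omega>")
    case True
    have "(F has_derivative (\<lambda>h. (\<zeta> x * \<phi> x) *\<^sub>R P' x h + (\<zeta> x * (grad x \<bullet> h) + (g x \<bullet> h) * \<phi> x) *\<^sub>R P x)) (at x)"
      unfolding F_def
      by (rule has_derivative_scaleR[OF has_derivative_mult[OF \<zeta>_der \<phi>[OF True]] P[OF True]])
    then show ?thesis using True by (simp add: F'_def)
  next
    case False
    have "((\<lambda>_. 0) has_derivative (\<lambda>h. 0)) (at x)" by simp
    then have "(F has_derivative (\<lambda>h. 0)) (at x)"
      by (rule has_derivative_transform_within_open[OF _ open_ball[of x \<delta>]]) (use False \<delta> F_out in auto)
    then show ?thesis using False by (simp add: F'_def)
  qed
  have F_lip: "locally_lipschitz_on UNIV F"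
  proof -
    have 1: "locally_lipschitz_on \<Omega> F"
      unfolding F_def using locally_lipschitz_on_scaleR[OF locally_lipschitz_on_scaleR[OF \<zeta>_ll \<phi>_lip] P_lip] by simp
    have 2: "\<exists>e>0. \<exists>L. L-lipschitz_on (ball x e) F" if "x \<notin> \<Omega>" for x
    proof -
      have "0-lipschitz_on (ball x \<delta>) F" using F_out[OF that] by (intro lipschitz_onI) auto
      then show ?thesis using \<delta> by blast
    qed
    show ?thesis using 1 2 unfolding locally_lipschitz_on_def by blast
  qed
  have F_int: "has_bochner_integral lborel (\<lambda>x. \<Sum>b\<in>Basis. F' x b \<bullet> b) 0"
    by (rule integral_divergence_zero[OF F_lip \<Omega>(3) _ F_der]) (use supp in \<open>auto simp: F_def\<close>)
  have divF: "(\<Sum>b\<in>Basis. F' x b \<bullet> b)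
      = \<zeta> x * \<phi> x * (\<Sum>b\<in>Basis. P' x b \<bullet> b) + \<zeta> x * (grad x \<bullet> P x) + \<phi> x * (g x \<bullet> P x)"
    if "x \<in> \<Omega>" for x
    using that unfolding F'_def euclidean_inner[of "grad x" "P x"] euclidean_inner[of "g x" "P x"]
    by (simp add: inner_simps sum.distrib sum_distrib_left algebra_simps)

  define G where "G = (\<lambda>x. \<zeta> x *\<^sub>R (x - x0))"
  define G' where "G' = (\<lambda>x h. \<zeta> x *\<^sub>R h + (g x \<bullet> h) *\<^sub>R (x - x0))"
  have G_der: "(G has_derivative G' x) (at x)" for x
    unfolding G_def G'_def by (rule derivative_eq_intros \<zeta>_der refl | simp)+
  have "1-lipschitz_on UNIV (\<lambda>x. x - x0)" by (intro lipschitz_onI) (auto simp: dist_norm)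
  then have G_lip: "locally_lipschitz_on UNIV G"
    unfolding G_def by (intro locally_lipschitz_on_scaleR \<zeta>_ll locally_lipschitz_on_Lipschitz)
  have G_int: "has_bochner_integral lborel (\<lambda>x. \<Sum>b\<in>Basis. G' x b \<bullet> b) 0"
    by (rule integral_divergence_zero[OF G_lip \<Omega>(3) _ G_der]) (use supp in \<open>auto simp: G_def\<close>)
  have divG: "(\<Sum>b\<in>Basis. G' x b \<bullet> b) = n * \<zeta> x + g x \<bullet> (x - x0)" for x
    unfolding G'_def euclidean_inner[of "g x" "x - x0"]
    by (simp add: inner_add_left sum.distrib n_def)
  have \<zeta>_eq: "\<zeta> x = indicator (cball 0 R) x *\<^sub>R \<zeta> x" for x
    using supp[of x] R(2) by (cases "\<zeta> x = 0") auto
  have \<zeta>_int: "integrable lborel \<zeta>"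
  proof -
    have "continuous_on (cball 0 R) \<zeta>"
      using lipschitz_on_continuous_on[OF \<zeta>_lip] continuous_on_subset by blast
    then have "integrable lborel (\<lambda>x. indicator (cball 0 R) x *\<^sub>R \<zeta> x)"
      by (rule borel_integrable_compact[OF compact_cball])
    then show ?thesis by (simp only: \<zeta>_eq[symmetric])
  qed
  have \<zeta>_m: "integral\<^sup>L lborel \<zeta> \<le> m"
  proof -
    have "\<zeta> x \<le> indicator (cball 0 R) x" for x
      using supp[of x] R(2) \<zeta>(2)[of x] by (cases "\<zeta> x = 0") auto
    moreover have "integrable lborel (indicator (cball (0::'a) R) :: 'a \<Rightarrow> real)"
      by (intro integrable_real_indicator) (simp_all add: emeasure_bounded_finite flip: infinity_ennreal_def)
    ultimately have "integral\<^sup>L lborel \<zeta> \<le> integral\<^sup>L lborel (indicator (cball (0::'a) R))"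
      using \<zeta>_int by (intro integral_mono)
    also have "\<dots> = m" by (simp add: m_def)
    finally show ?thesis .
  qed
  define k where "k = C * \<epsilon> / r"
  have k0: "k \<ge> 0" using C0 \<epsilon> r(1) by (simp add: k_def)
  \<comment> \<open>The ball, where \<open>\<zeta>\<close> is 1, contributes \<open>c\<close>; the term with \<open>k\<close> is the bound for the error, written with the divergence of
\<open>\<zeta> (x - x0)\<close>.\<close>
  have lower: "c * indicator (cball x0 r) x + k * ((\<Sum>b\<in>Basis. G' x b \<bullet> b) - n * \<zeta> x) \<le> (\<Sum>b\<in>Basis. F' x b \<bullet> b)" for x
  proof (cases "x \<in> \<Omega>")
    case False
    then have "\<zeta> x = 0" "x \<notin> cball x0 r" using supp r(2) by auto
    then show ?thesis using False g0 by (simp add: divG F'_def)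
  next
    case True
    have a1: "0 \<le> \<zeta> x * \<phi> x * (\<Sum>b\<in>Basis. P' x b \<bullet> b)"
      using \<zeta>(1) \<phi>_bd(1)[OF True] div[OF True] by simp
    have a2: "c * indicator (cball x0 r) x \<le> \<zeta> x * (grad x \<bullet> P x)"
    proof (cases "x \<in> cball x0 r")
      case True
      then show ?thesis using r(3)[OF True] \<zeta>(3)[of x] K(5) by auto
    next
      case False
      then show ?thesis using \<zeta>(1)[of x] nonneg[OF True] by simp
    qed
    have a3: "k * (g x \<bullet> (x - x0)) \<le> \<phi> x * (g x \<bullet> P x)"
    proof (cases "x \<in> K")
      case True then show ?thesis using gK by simp
    next
      case False
      then have Px: "norm (P x) \<le> \<epsilon>" using K0(3) K(4) True by blast
      have "\<bar>\<phi> x * (g x \<bullet> P x)\<bar> \<le> C * (norm (g x) * \<epsilon>)"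
        unfolding abs_mult using \<phi>_bd[OF True] Px C0 Cauchy_Schwarz_ineq2[of "g x" "P x"]
        by (intro mult_mono) (auto intro: order_trans[OF _ mult_left_mono[OF Px]])
      also have "\<dots> = k * (r * norm (g x))" using r(1) by (simp add: k_def)
      also have "\<dots> \<le> k * (- (g x \<bullet> (x - x0)))" using g_rad k0 by (intro mult_left_mono) auto
      finally show ?thesis by linarith
    qed
    show ?thesis unfolding divF[OF True] divG using a1 a2 a3 by simp
  qed
  have "has_bochner_integral lborel (\<lambda>x. c * indicator (cball x0 r) x + k * ((\<Sum>b\<in>Basis. G' x b \<bullet> b) - n * \<zeta> x))
      (c * V + k * (0 - n * integral\<^sup>L lborel \<zeta>))"
    unfolding V_def
    by (intro has_bochner_integral_add has_bochner_integral_mult_right has_bochner_integral_diff G_int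
        has_bochner_integral_integrable \<zeta>_int has_bochner_integral_real_indicator)
      (simp_all add: emeasure_bounded_finite flip: infinity_ennreal_def)
  then have "c * V + k * (0 - n * integral\<^sup>L lborel \<zeta>) \<le> 0"
    using F_int lower unfolding has_bochner_integral_iff by (metis (no_types, lifting) integral_mono)
  moreover have "k * (n * integral\<^sup>L lborel \<zeta>) < c * V"
  proof -
    have "k * (n * integral\<^sup>L lborel \<zeta>) \<le> k * (n * m)"
      using \<zeta>_m k0 n1 by (intro mult_left_mono) auto
    also have "\<dots> = c * V * ((C * m) / D)"
      using r(1) n1 by (simp add: k_def \<epsilon>_def)
    also have "\<dots> < c * V * 1"
      using c V C0 m0 D by (intro mult_strict_left_mono) (auto simp: D_def algebra_simps)
    finally show ?thesis by simp
  qed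
  ultimately show False by simp
qed

section \<open>Linear algebra and second derivatives\<close>

text \<open>The first-order condition at the minimum \<open>t = 0\<close>.\<close>

lemma nonneg_quadratic_imp_linear_coeff_zero:
  fixes p q :: real
  assumes "\<And>t. 0 \<le> 2 * t * p + t\<^sup>2 * q"
  shows "p = 0"
proof (rule ccontr)
  assume p: "p \<noteq> 0"
  have q: "q \<ge> 0" using assms[of 1] assms[of "-1"] by simp
  define t where "t = - p / (q + 1)"
  have "(q + 1) * t = - p" using q by (simp add: t_def)
  then have t: "p = - ((q + 1) * t)" by simp
  have "2 * t * p + t\<^sup>2 * q = - (t\<^sup>2 * (q + 2))"
    unfolding t by (simp add: power2_eq_square algebra_simps)
  moreover have "t\<^sup>2 * (q + 2) > 0" using p q by (auto simp: t_def)
  ultimately show False using assms[of t] by simp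
qed

text \<open>A maximiser of the quadratic form on the unit sphere of \<open>S\<close> is an eigenvector, and its orthogonal complement
in \<open>S\<close> is again invariant; the rest is induction on the dimension.\<close>

lemma selfadjoint_orthonormal_eigenbasis_on:
  fixes A :: "'a::euclidean_space \<Rightarrow> 'a"
  assumes lin: "linear A" and sym: "\<And>x y. A x \<bullet> y = x \<bullet> A y"
    and S: "subspace S" "A ` S \<subseteq> S"
  shows "\<exists>B\<subseteq>S. pairwise orthogonal B \<and> (\<forall>b\<in>B. norm b = 1 \<and> (\<exists>c. A b = c *\<^sub>R b)) \<and> span B = S"
  using S
proof (induction "dim S" arbitrary: S rule: less_induct)
  case less
  show ?case
  proof (cases "S \<subseteq> {0}")
    case True
    then have "S = {0}" using less.prems(1) subspace_0 by blast
    then show ?thesis by (intro exI[of _ "{}"]) auto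
  next
    case False
    then obtain y where y: "y \<in> S" "y \<noteq> 0" by blast
    define T where "T = S \<inter> sphere 0 1"
    have "compact T" unfolding T_def
      by (intro closed_Int_compact closed_subspace less.prems compact_sphere)
    moreover have "y /\<^sub>R norm y \<in> T" using y less.prems(1) by (simp add: T_def subspace_scale)
    moreover have "continuous_on T (\<lambda>x. x \<bullet> A x)"
      by (intro continuous_intros linear_continuous_on linear_linear[THEN iffD2] lin)
    ultimately obtain b where b: "b \<in> T" "\<And>x. x \<in> T \<Longrightarrow> x \<bullet> A x \<le> b \<bullet> A b"
      using continuous_attains_sup[of T "\<lambda>x. x \<bullet> A x"] by blast
    define c where "c = b \<bullet> A b"
    have bS: "b \<in> S" and nb: "norm b = 1" using b by (auto simp: T_def)
    have bb: "b \<bullet> b = 1" using nb by (simp add: norm_eq_1)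
    have Q: "0 \<le> c * (x \<bullet> x) - x \<bullet> A x" if x: "x \<in> S" for x
    proof (cases "x = 0")
      case False
      have "x /\<^sub>R norm x \<in> T" using x False less.prems(1) by (simp add: T_def subspace_scale)
      from b(2)[OF this] have "(x \<bullet> A x) / (norm x)\<^sup>2 \<le> c"
        by (simp add: c_def linear_scale[OF lin] power2_eq_square field_simps)
      then show ?thesis using False by (simp add: field_simps power2_norm_eq_inner)
    qed (simp add: linear_0[OF lin])
    define w where "w = c *\<^sub>R b - A b"
    have wS: "w \<in> S" unfolding w_def using bS less.prems by (auto intro!: subspace_diff subspace_scale)
    have "0 \<le> 2 * t * (w \<bullet> w) + t\<^sup>2 * (c * (w \<bullet> w) - w \<bullet> A w)" for t
    proof -
      have "b + t *\<^sub>R w \<in> S" using bS wS less.prems by (auto intro!: subspace_add subspace_scale)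
      from Q[OF this] have "0 \<le> c * ((b + t *\<^sub>R w) \<bullet> (b + t *\<^sub>R w)) - (b + t *\<^sub>R w) \<bullet> A (b + t *\<^sub>R w)" .
      also have "\<dots> = c * (b \<bullet> b) - b \<bullet> A b + 2 * t * (c * (b \<bullet> w) - A b \<bullet> w) + t\<^sup>2 * (c * (w \<bullet> w) - w \<bullet> A w)"
        using sym[of b w] by (simp add: linear_add[OF lin] linear_scale[OF lin] inner_simps inner_commute
            power2_eq_square algebra_simps)
      also have "c * (b \<bullet> w) - A b \<bullet> w = w \<bullet> w"
      proof -
        have "w \<bullet> w = (c *\<^sub>R b - A b) \<bullet> w" by (simp only: w_def)
        then show ?thesis by (simp add: inner_diff_left)
      qed
      finally show ?thesis by (simp add: bb c_def)
    qed
    then have "w \<bullet> w = 0" by (rule nonneg_quadratic_imp_linear_coeff_zero)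
    then have Ab: "A b = c *\<^sub>R b" by (simp add: w_def)
    define S' where "S' = {x \<in> S. x \<bullet> b = 0}"
    have S': "subspace S'" using less.prems(1) by (auto simp: S'_def subspace_def inner_simps)
    have inv: "A ` S' \<subseteq> S'"
    proof
      fix z assume "z \<in> A ` S'"
      then obtain x where x: "x \<in> S" "x \<bullet> b = 0" "z = A x" by (auto simp: S'_def)
      then show "z \<in> S'" using less.prems(2) sym[of x b] Ab by (auto simp: S'_def)
    qed
    have "b \<notin> S'" using bb by (simp add: S'_def)
    moreover have "S' \<subseteq> S" by (auto simp: S'_def)
    ultimately have "S' \<subset> S" using bS by blast
    then have "dim S' < dim S"
      by (metis S' less.prems(1) dim_psubset span_eq_iff)
    from less.hyps[OF this S' inv] obtain B where
      B: "B \<subseteq> S'" "pairwise orthogonal B" "\<forall>b\<in>B. norm b = 1 \<and> (\<exists>c. A b = c *\<^sub>R b)" "span B = S'"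
      by blast
    have "S \<subseteq> span (insert b B)"
    proof
      fix x assume x: "x \<in> S"
      have "x - (x \<bullet> b) *\<^sub>R b \<in> S'"
        using x bS less.prems(1) bb by (auto simp: S'_def inner_simps intro!: subspace_diff subspace_scale)
      then show "x \<in> span (insert b B)" unfolding span_insert using B(4) by blast
    qed
    moreover have "span (insert b B) \<subseteq> S"
      using B(1) bS less.prems(1) by (intro span_minimal) (auto simp: S'_def)
    moreover have "pairwise orthogonal (insert b B)"
      using B(1,2) by (auto simp: pairwise_insert S'_def orthogonal_def inner_commute)
    ultimately show ?thesis
      using B(1,3) bS nb Ab by (intro exI[of _ "insert b B"]) (auto simp: S'_def)
  qed
qed

lemma selfadjoint_orthonormal_eigenbasis:
  fixes A :: "real ^ 'n \<Rightarrow> real ^ 'n"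
  assumes "linear A" "\<And>x y. A x \<bullet> y = x \<bullet> A y"
  obtains b :: "'n \<Rightarrow> real ^ 'n" and c where
    "\<And>i j. b i \<bullet> b j = (if i = j then 1 else 0)" "\<And>i. A (b i) = c i *\<^sub>R b i"
proof -
  obtain B where B: "pairwise orthogonal B" "\<forall>b\<in>B. norm b = 1 \<and> (\<exists>c. A b = c *\<^sub>R b)" "span B = UNIV"
    using selfadjoint_orthonormal_eigenbasis_on[OF assms subspace_UNIV] by auto
  have "0 \<notin> B" using B(2) by force
  then have ind: "independent B" using B(1) pairwise_orthogonal_independent by blast
  then have fin: "finite B" using independent_imp_finite by blast
  have "card B = CARD('n)"
    using dim_eq_card_independent[OF ind] dim_span[of B] B(3) by simp
  then obtain b :: "'n \<Rightarrow> real ^ 'n" where b: "bij_betw b UNIV B"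
    using finite_same_card_bij[of "UNIV :: 'n set" B] fin by auto
  have bB: "b i \<in> B" for i using b bij_betwE by blast
  have "\<forall>i. \<exists>c. A (b i) = c *\<^sub>R b i" using B(2) bB by blast
  from choice[OF this] obtain c where c: "\<And>i. A (b i) = c i *\<^sub>R b i" by blast
  have orth: "b i \<bullet> b j = (if i = j then 1 else 0)" for i j
  proof (cases "i = j")
    case True then show ?thesis using B(2) bB[of i] by (simp add: norm_eq_1)
  next
    case False
    then have "b i \<noteq> b j" using b by (auto simp: bij_betw_def inj_def)
    then show ?thesis using B(1) bB[of i] bB[of j] False by (auto simp: pairwise_def orthogonal_def)
  qed
  show thesis using orth c by (rule that)
qed

text \<open>The mean value theorem in direction \<open>a\<close> and then in direction \<open>b\<close>.\<close>

lemma mixed_second_difference: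
  fixes f :: "'a::real_normed_vector \<Rightarrow> real"
  assumes h: "h > 0"
    and S: "\<And>s t. 0 \<le> s \<Longrightarrow> s \<le> h \<Longrightarrow> 0 \<le> t \<Longrightarrow> t \<le> h \<Longrightarrow> x + s *\<^sub>R a + t *\<^sub>R b \<in> S"
    and f': "\<And>y. y \<in> S \<Longrightarrow> (f has_derivative f' y) (at y)"
    and fa: "\<And>y. y \<in> S \<Longrightarrow> ((\<lambda>y. f' y a) has_derivative fa y) (at y)"
  obtains s t where "0 \<le> s" "s \<le> h" "0 \<le> t" "t \<le> h"
    "f (x + h *\<^sub>R a + h *\<^sub>R b) - f (x + h *\<^sub>R a) - f (x + h *\<^sub>R b) + f x = h\<^sup>2 * fa (x + s *\<^sub>R a + t *\<^sub>R b) b"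
proof -
  have line: "((\<lambda>s. g (p + s *\<^sub>R d)) has_real_derivative g' d) (at s)"
    if "(g has_derivative g') (at (p + s *\<^sub>R d))" for g :: "'a \<Rightarrow> real" and g' p d s
  proof -
    have "((\<lambda>s. p + s *\<^sub>R d) has_derivative (\<lambda>r. r *\<^sub>R d)) (at s)"
      by (intro derivative_eq_intros) auto
    then have "((\<lambda>s. g (p + s *\<^sub>R d)) has_derivative (\<lambda>r. g' (r *\<^sub>R d))) (at s)"
      using that by (rule has_derivative_compose)
    moreover have "g' (r *\<^sub>R d) = g' d * r" for r
      using linear_scale[OF has_derivative_linear[OF that]] by simp
    ultimately show ?thesis by (simp add: has_field_derivative_def)
  qed
  have swap: "x + s *\<^sub>R a + t *\<^sub>R b = x + t *\<^sub>R b + s *\<^sub>R a" for s t by (simp add: algebra_simps)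
  define \<phi> where "\<phi> = (\<lambda>s. f (x + h *\<^sub>R b + s *\<^sub>R a) - f (x + s *\<^sub>R a))"
  have "\<exists>s. 0 < s \<and> s < h \<and> \<phi> h - \<phi> 0 = (h - 0) * (f' (x + h *\<^sub>R b + s *\<^sub>R a) a - f' (x + s *\<^sub>R a) a)"
  proof (rule MVT2[OF h])
    fix s assume s: "0 \<le> s" "s \<le> h"
    have "x + h *\<^sub>R b + s *\<^sub>R a \<in> S" using S[of s h] s h by (simp add: swap)
    moreover have "x + s *\<^sub>R a \<in> S" using S[of s 0] s h by simp
    ultimately show "(\<phi> has_real_derivative f' (x + h *\<^sub>R b + s *\<^sub>R a) a - f' (x + s *\<^sub>R a) a) (at s)"
      unfolding \<phi>_def by (intro DERIV_diff line f')
  qed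
  then obtain s where s: "0 < s" "s < h" and e1: "\<phi> h - \<phi> 0 = h * (f' (x + h *\<^sub>R b + s *\<^sub>R a) a - f' (x + s *\<^sub>R a) a)"
    by auto
  have "\<exists>t. 0 < t \<and> t < h \<and> f' (x + s *\<^sub>R a + h *\<^sub>R b) a - f' (x + s *\<^sub>R a + 0 *\<^sub>R b) a
      = (h - 0) * fa (x + s *\<^sub>R a + t *\<^sub>R b) b"
    using S s by (intro MVT2[OF h] line[of "\<lambda>y. f' y a"] fa) auto
  then obtain t where t: "0 < t" "t < h"
    and e2: "f' (x + s *\<^sub>R a + h *\<^sub>R b) a - f' (x + s *\<^sub>R a) a = h * fa (x + s *\<^sub>R a + t *\<^sub>R b) b"
    by auto
  have "\<phi> h - \<phi> 0 = h\<^sup>2 * fa (x + s *\<^sub>R a + t *\<^sub>R b) b"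
    using e1 e2 by (simp add: swap[symmetric] power2_eq_square)
  moreover have "\<phi> h - \<phi> 0 = f (x + h *\<^sub>R a + h *\<^sub>R b) - f (x + h *\<^sub>R a) - f (x + h *\<^sub>R b) + f x"
    by (simp add: \<phi>_def swap)
  ultimately show thesis using s t by (intro that[of s t]) auto
qed

text \<open>The second difference over a parallelogram with sides \<open>h a\<close> and \<open>h b\<close> is symmetric in \<open>a\<close> and \<open>b\<close>, and it equals
\<open>h\<^sup>2\<close> times either mixed derivative at some point of the parallelogram.\<close>

lemma second_derivative_symmetric:
  fixes f :: "'a::real_normed_vector \<Rightarrow> real"
  assumes S: "open S" "x \<in> S"
    and f': "\<And>y. y \<in> S \<Longrightarrow> (f has_derivative f' y) (at y)"
    and fa: "\<And>y. y \<in> S \<Longrightarrow> ((\<lambda>y. f' y a) has_derivative fa y) (at y)"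
    and fb: "\<And>y. y \<in> S \<Longrightarrow> ((\<lambda>y. f' y b) has_derivative fb y) (at y)"
    and cont: "continuous_on S (\<lambda>y. fa y b)" "continuous_on S (\<lambda>y. fb y a)"
  shows "fa x b = fb x a"
proof -
  have "\<bar>fa x b - fb x a\<bar> \<le> \<epsilon>" if \<epsilon>: "\<epsilon> > 0" for \<epsilon>
  proof -
    obtain d1 where d1: "d1 > 0" "\<And>y. dist y x < d1 \<Longrightarrow> \<bar>fa y b - fa x b\<bar> < \<epsilon> / 2"
    proof -
      have "isCont (\<lambda>y. fa y b) x" using cont(1) S continuous_on_eq_continuous_at by blast
      then show thesis
        using that \<epsilon> unfolding continuous_at_eps_delta dist_real_def by (meson half_gt_zero)
    qed
    obtain d2 where d2: "d2 > 0" "\<And>y. dist y x < d2 \<Longrightarrow> \<bar>fb y a - fb x a\<bar> < \<epsilon> / 2"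
    proof -
      have "isCont (\<lambda>y. fb y a) x" using cont(2) S continuous_on_eq_continuous_at by blast
      then show thesis
        using that \<epsilon> unfolding continuous_at_eps_delta dist_real_def by (meson half_gt_zero)
    qed
    obtain d3 where d3: "d3 > 0" "ball x d3 \<subseteq> S" using S openE by blast
    define d where "d = min d1 (min d2 d3)"
    have d: "d > 0" "d \<le> d1" "d \<le> d2" "d \<le> d3" using d1 d2 d3 by (auto simp: d_def)
    define h where "h = d / (norm a + norm b + 1)"
    have nn: "norm a + norm b + 1 > 0" using norm_ge_zero[of a] norm_ge_zero[of b] by linarith
    have h: "h > 0" using d nn by (simp add: h_def)
    have near: "dist (x + s *\<^sub>R a + t *\<^sub>R b) x < d" if "0 \<le> s" "s \<le> h" "0 \<le> t" "t \<le> h" for s t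
    proof -
      have "norm (s *\<^sub>R a + t *\<^sub>R b) \<le> s * norm a + t * norm b"
        using that norm_triangle_ineq[of "s *\<^sub>R a" "t *\<^sub>R b"] by simp
      also have "\<dots> \<le> h * norm a + h * norm b" using that by (intro add_mono mult_right_mono) auto
      also have "\<dots> < h * (norm a + norm b + 1)" using h by (simp add: algebra_simps)
      also have "\<dots> = d" using nn by (simp add: h_def)
      finally show ?thesis by (simp add: dist_norm algebra_simps)
    qed
    have inS: "x + s *\<^sub>R a + t *\<^sub>R b \<in> S" if "0 \<le> s" "s \<le> h" "0 \<le> t" "t \<le> h" for s t
      using near[OF that] d d3 by (auto simp: dist_commute subset_iff)
    obtain s t where st: "0 \<le> s" "s \<le> h" "0 \<le> t" "t \<le> h"
      and 1: "f (x + h *\<^sub>R a + h *\<^sub>R b) - f (x + h *\<^sub>R a) - f (x + h *\<^sub>R b) + f x = h\<^sup>2 * fa (x + s *\<^sub>R a + t *\<^sub>R b) b"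
      using mixed_second_difference[OF h inS f' fa] by blast
    have inS': "x + s *\<^sub>R b + t *\<^sub>R a \<in> S" if "0 \<le> s" "s \<le> h" "0 \<le> t" "t \<le> h" for s t
      using inS[of t s] that by (simp add: algebra_simps)
    obtain s' t' where st': "0 \<le> s'" "s' \<le> h" "0 \<le> t'" "t' \<le> h"
      and 2: "f (x + h *\<^sub>R b + h *\<^sub>R a) - f (x + h *\<^sub>R b) - f (x + h *\<^sub>R a) + f x = h\<^sup>2 * fb (x + s' *\<^sub>R b + t' *\<^sub>R a) a"
      using mixed_second_difference[OF h inS' f' fb] by blast
    have "h\<^sup>2 * fa (x + s *\<^sub>R a + t *\<^sub>R b) b = h\<^sup>2 * fb (x + s' *\<^sub>R b + t' *\<^sub>R a) a"
      unfolding 1[symmetric] 2[symmetric] by (simp add: algebra_simps)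
    then have eq: "fa (x + s *\<^sub>R a + t *\<^sub>R b) b = fb (x + s' *\<^sub>R b + t' *\<^sub>R a) a" using h by simp
    have "\<bar>fa (x + s *\<^sub>R a + t *\<^sub>R b) b - fa x b\<bar> < \<epsilon> / 2" using near[OF st] d by (intro d1) auto
    moreover have "\<bar>fb (x + s' *\<^sub>R b + t' *\<^sub>R a) a - fb x a\<bar> < \<epsilon> / 2"
      using near[OF st'(3,4,1,2)] d by (intro d2) (auto simp: algebra_simps)
    ultimately show ?thesis using eq by linarith
  qed
  then have "\<bar>fa x b - fb x a\<bar> \<le> 0" by (rule field_le_epsilon[of _ 0, simplified])
  then show ?thesis by simp
qed

text \<open>For square matrices the left inverse \<open>B\<close> of \<open>A\<close> is also a right inverse.\<close>

lemma trace_conjugate: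
  fixes A B d :: "real ^ 'n \<Rightarrow> real ^ 'n"
  assumes "linear A" "linear B" "linear d" and inv: "\<And>x. B (A x) = x"
  shows "(\<Sum>i\<in>UNIV. B (d (A (axis i 1))) $ i) = (\<Sum>i\<in>UNIV. d (axis i 1) $ i)"
proof -
  have tr: "(\<Sum>i\<in>UNIV. f (axis i 1) $ i) = trace (matrix f)" for f :: "real ^ 'n \<Rightarrow> real ^ 'n"
    by (simp add: trace_def matrix_def)
  have BA: "matrix B ** matrix A = mat 1"
  proof -
    have "B \<circ> A = id" using inv by auto
    then show ?thesis using matrix_compose[OF assms(1,2)] by (simp add: matrix_id_mat_1)
  qed
  have "matrix (\<lambda>x. B (d (A x))) = matrix B ** (matrix d ** matrix A)"
    using matrix_compose[OF linear_compose[OF assms(1,3)] assms(2)] matrix_compose[OF assms(1,3)]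
    unfolding o_def by simp
  then have "trace (matrix (\<lambda>x. B (d (A x)))) = trace ((matrix d ** matrix A) ** matrix B)"
    by (simp only: trace_mul_sym[of "matrix B"])
  also have "\<dots> = trace (matrix d)"
    by (simp only: matrix_mul_assoc[symmetric] matrix_left_right_inverse1[OF BA] matrix_mul_rid)
  finally show ?thesis using tr[of "\<lambda>x. B (d (A x))"] tr[of d] by simp
qed

text \<open>The special case of \<open>trace_conjugate\<close> where \<open>A\<close> and \<open>B\<close> translate between coordinates with respect to \<open>b\<close> and vectors.\<close>

lemma trace_orthonormal:
  fixes d :: "real ^ 'n \<Rightarrow> real ^ 'n" and b :: "'n \<Rightarrow> real ^ 'n"
  assumes d: "linear d" and b: "\<And>i j. b i \<bullet> b j = (if i = j then 1 else 0)"
  shows "(\<Sum>i\<in>UNIV. d (b i) \<bullet> b i) = (\<Sum>i\<in>UNIV. d (axis i 1) $ i)"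
proof -
  define A where "A = (\<lambda>z :: real ^ 'n. \<Sum>i\<in>UNIV. (z $ i) *\<^sub>R b i)"
  define B where "B = (\<lambda>w :: real ^ 'n. \<chi> i. w \<bullet> b i)"
  have "linear A" unfolding A_def
    by (intro linearI) (simp_all add: sum.distrib scaleR_left_distrib scaleR_sum_right)
  moreover have "linear B" unfolding B_def
    by (intro linearI) (simp_all add: vec_eq_iff inner_simps)
  moreover have "B (A x) = x" for x
  proof -
    have "(x $ j) * (b j \<bullet> b i) = (if j = i then x $ j else 0)" for i j by (simp add: b)
    then show ?thesis by (simp add: A_def B_def vec_eq_iff inner_sum_left)
  qed
  moreover have "A (axis i 1) = b i" for i
  proof -
    have "(axis i 1 $ j) *\<^sub>R b j = (if j = i then b j else 0)" for j by (simp add: axis_def)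
    then show ?thesis by (simp add: A_def)
  qed
  ultimately have "(\<Sum>i\<in>UNIV. B (d (b i)) $ i) = (\<Sum>i\<in>UNIV. d (axis i 1) $ i)"
    using trace_conjugate[of A B d] d by simp
  then show ?thesis by (simp add: B_def)
qed

section \<open>Local graphs and their tangent spaces\<close>

lemma unit_vector_of_hyperplane:
  fixes a W :: "'a::real_inner"
  assumes a: "norm a = 1" and W: "W \<noteq> 0" and perp: "\<And>w. w \<bullet> W = 0 \<Longrightarrow> a \<bullet> w = 0"
  shows "a = (1 / norm W) *\<^sub>R W \<or> a = (- 1 / norm W) *\<^sub>R W"
proof -
  define k where "k = (a \<bullet> W) / (W \<bullet> W)"
  define w where "w = a - k *\<^sub>R W"
  have wW: "w \<bullet> W = 0" using W by (simp add: w_def k_def inner_diff_left)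
  have "w \<bullet> w = a \<bullet> w - k * (w \<bullet> W)"
  proof -
    have "w \<bullet> w = (a - k *\<^sub>R W) \<bullet> w" by (simp only: w_def)
    then show ?thesis using inner_commute[of W w] by (simp add: inner_diff_left)
  qed
  then have "w = 0" using perp[OF wW] wW by simp
  then have ak: "a = k *\<^sub>R W" by (simp add: w_def)
  then have "\<bar>k\<bar> * norm W = 1" using a by simp
  then have "\<bar>k\<bar> = 1 / norm W" using W by (simp add: field_simps)
  then have "k = 1 / norm W \<or> k = - 1 / norm W" by (auto simp: abs_if split: if_splits)
  then show ?thesis using ak by auto
qed

text \<open>For orthonormal axes \<open>e\<close> this is an isometry of \<open>n\<close>-space onto their span; \<open>frame_coords\<close> below is its adjoint, and
its inverse on that span.\<close>

definition frame_map :: "('n::finite \<Rightarrow> 'n point) \<Rightarrow> real ^ 'n \<Rightarrow> 'n point" where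
  "frame_map e z = (\<Sum>i\<in>UNIV. (z $ i) *\<^sub>R e i)"

definition frame_coords :: "('n::finite \<Rightarrow> 'n point) \<Rightarrow> 'n point \<Rightarrow> real ^ 'n" where
  "frame_coords e w = (\<chi> i. w \<bullet> e i)"

lemma linear_frame_map: "linear (frame_map e)"
  unfolding frame_map_def
  by (intro linearI) (simp_all add: sum.distrib scaleR_left_distrib scaleR_sum_right)

lemma linear_frame_coords: "linear (frame_coords e)"
  unfolding frame_coords_def by (intro linearI) (simp_all add: vec_eq_iff inner_simps)

lemmas bounded_linear_frame_map = linear_frame_map[unfolded linear_conv_bounded_linear]
lemmas bounded_linear_frame_coords = linear_frame_coords[unfolded linear_conv_bounded_linear]

locale orthonormal_frame =
  fixes e :: "'n::finite \<Rightarrow> 'n point" and N :: "'n point"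
  assumes ortho: "orthonormal_family e" and unit: "norm N = 1" and perp: "\<And>i. e i \<bullet> N = 0"
begin

lemma e_inner: "e i \<bullet> e j = (if i = j then 1 else 0)"
  using ortho by (simp add: orthonormal_family_def)

lemma NN: "N \<bullet> N = 1"
  using unit by (simp add: norm_eq_1)

lemma frame_map_inner: "frame_map e z \<bullet> w = z \<bullet> frame_coords e w"
  by (simp add: frame_map_def frame_coords_def inner_vec_def inner_sum_left inner_commute[of w])

lemma coords_frame_map [simp]: "frame_coords e (frame_map e z) = z"
proof -
  have "(z $ j) * (e j \<bullet> e i) = (if j = i then z $ j else 0)" for i j by (simp add: e_inner)
  then show ?thesis by (simp add: frame_map_def frame_coords_def vec_eq_iff inner_sum_left)
qed

lemma coords_N [simp]: "frame_coords e N = 0"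
  using perp by (simp add: frame_coords_def vec_eq_iff inner_commute)

lemma frame_map_N [simp]: "frame_map e z \<bullet> N = 0" "N \<bullet> frame_map e z = 0"
  by (simp_all add: frame_map_inner inner_commute[of N])

lemma frame_map_inner_frame_map [simp]: "frame_map e z \<bullet> frame_map e w = z \<bullet> w"
  by (simp add: frame_map_inner)

lemma norm_frame_map [simp]: "norm (frame_map e z) = norm z"
  by (simp add: norm_eq_sqrt_inner)

text \<open>The \<open>n + 1\<close> orthonormal vectors \<open>e i\<close> and \<open>N\<close> span a space of dimension \<open>n + 1\<close>, so a vector orthogonal to all
of them vanishes.\<close>

lemma decomp: "w = frame_map e (frame_coords e w) + (w \<bullet> N) *\<^sub>R N"
proof -
  have inj: "inj e"
  proof (rule injI)
    fix i j assume "e i = e j"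
    then show "i = j" using e_inner[of i i] e_inner[of i j] by (auto split: if_splits)
  qed
  have "N \<notin> range e" using perp NN by fastforce
  have "e i \<noteq> 0" for i using e_inner[of i i] by auto
  moreover have "N \<noteq> 0" using unit by auto
  ultimately have "0 \<notin> insert N (range e)" by (metis imageE insertE)
  moreover have "pairwise orthogonal (insert N (range e))"
    unfolding pairwise_insert using perp
    by (auto simp: pairwise_def orthogonal_def inner_commute e_inner)
  ultimately have ind: "independent (insert N (range e))"
    using pairwise_orthogonal_independent by blast
  have "card (insert N (range e)) = DIM('n point)"
    using \<open>N \<notin> range e\<close> card_image[OF inj] by (simp add: DIM_prod)
  then have span: "span (insert N (range e)) = UNIV"
    using ind by (metis UNIV_I card_eq_dim dim_UNIV subset_UNIV subsetI subset_antisym independent_imp_finite)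
  define u where "u = w - frame_map e (frame_coords e w) - (w \<bullet> N) *\<^sub>R N"
  have "u \<bullet> N = 0" by (simp add: u_def inner_simps NN)
  moreover have "u \<bullet> e i = 0" for i
  proof -
    have "frame_coords e u = 0"
      unfolding u_def by (simp add: linear_diff[OF linear_frame_coords] linear_scale[OF linear_frame_coords])
    then show ?thesis by (simp add: frame_coords_def vec_eq_iff)
  qed
  ultimately have "orthogonal u b" if "b \<in> insert N (range e)" for b
    using that by (auto simp: orthogonal_def)
  then have "orthogonal u u"
    using span orthogonal_to_span[of u "insert N (range e)" u] by (simp add: orthogonal_commute)
  then have "u = 0" by (simp add: orthogonal_def)
  then show ?thesis by (simp add: u_def algebra_simps)
qed

lemma norm_coords_le: "norm (frame_coords e w) \<le> norm w"
proof -
  have "w \<bullet> w = (frame_map e (frame_coords e w) + (w \<bullet> N) *\<^sub>R N) \<bullet> w"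
    by (subst decomp[of w]) simp
  also have "\<dots> = frame_coords e w \<bullet> frame_coords e w + (w \<bullet> N)\<^sup>2"
    by (simp add: inner_add_left frame_map_inner power2_eq_square inner_commute[of N])
  finally show ?thesis by (simp add: norm_le)
qed

lemma perp_N_eq_frame_map: "w \<bullet> N = 0 \<Longrightarrow> w = frame_map e (frame_coords e w)"
  using decomp[of w] by simp

end

text \<open>The data whose existence \<open>local_graph\<close> asserts.\<close>

locale graph_chart = orthonormal_frame e N
  for e :: "'n::finite \<Rightarrow> 'n point" and N +
  fixes M :: "'n point set" and X :: "'n point" and v :: "real ^ 'n \<Rightarrow> real" and B U
  assumes v0: "v 0 = 0" and dv0: "(v has_derivative (\<lambda>_. 0)) (at 0)"
    and B: "open B" "0 \<in> B" and smooth: "smooth_on v B" and U: "open U" "X \<in> U"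
    and MU: "M \<inter> U = (\<lambda>z. X + (\<Sum>i\<in>UNIV. (z $ i) *\<^sub>R e i) + v z *\<^sub>R N) ` B"
begin

definition param :: "real ^ 'n \<Rightarrow> 'n point" where
  "param z = X + frame_map e z + v z *\<^sub>R N"

definition grad :: "real ^ 'n \<Rightarrow> real ^ 'n" where
  "grad z = (\<chi> i. frechet_derivative v (at z) (axis i 1))"

definition hess :: "real ^ 'n \<Rightarrow> real ^ 'n \<Rightarrow> real ^ 'n" where
  "hess z h = (\<chi> i. frechet_derivative (\<lambda>y. frechet_derivative v (at y) (axis i 1)) (at z) h)"

text \<open>A normal vector of \<open>M\<close> at \<open>param z\<close>, scaled so that its component in direction \<open>N\<close> is 1.\<close>

definition conormal :: "real ^ 'n \<Rightarrow> 'n point" where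
  "conormal z = N - frame_map e (grad z)"

lemma M_param: "M \<inter> U = param ` B"
  using MU by (simp add: param_def[abs_def] frame_map_def)

lemma param_0: "param 0 = X"
  by (simp add: param_def v0 linear_0[OF linear_frame_map])

lemma X_in_M: "X \<in> M"
  using B(2) param_0 M_param by (metis IntD1 imageI)

lemma coords_param: "frame_coords e (param z - X) = z"
  by (simp add: param_def linear_add[OF linear_frame_coords] linear_scale[OF linear_frame_coords])

lemma param_N: "(param z - X) \<bullet> N = v z"
  by (simp add: param_def inner_simps NN)

lemma M_near:
  assumes "Y \<in> M \<inter> U"
  shows "frame_coords e (Y - X) \<in> B" "param (frame_coords e (Y - X)) = Y"
proof -
  obtain z where "z \<in> B" "Y = param z" using assms M_param by blast
  then show "frame_coords e (Y - X) \<in> B" "param (frame_coords e (Y - X)) = Y"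
    using coords_param by auto
qed

lemma linear_axis_expand:
  assumes "linear f"
  shows "f h = (\<Sum>i\<in>UNIV. (h $ i) *\<^sub>R f (axis i (1::real)))"
proof -
  have "f h = f (\<Sum>i\<in>UNIV. (h $ i) *\<^sub>R axis i 1)"
    using basis_expansion[of h] by (simp add: scalar_mult_eq_scaleR)
  then show ?thesis by (simp add: linear_sum[OF assms] linear_scale[OF assms])
qed

lemma v_der: "z \<in> B \<Longrightarrow> (v has_derivative (\<lambda>h. grad z \<bullet> h)) (at z)"
proof -
  assume z: "z \<in> B"
  have "Ck_on 1 v B" using smooth by (simp add: smooth_on_def)
  then have d: "(v has_derivative frechet_derivative v (at z)) (at z)"
    using z frechet_derivative_works by auto
  have "frechet_derivative v (at z) h = grad z \<bullet> h" for h
    using linear_axis_expand[OF has_derivative_linear[OF d], of h]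
    by (simp add: grad_def inner_vec_def mult.commute)
  then have "frechet_derivative v (at z) = (\<lambda>h. grad z \<bullet> h)" by auto
  with d show ?thesis by simp
qed

lemma grad_0: "grad 0 = 0"
proof -
  have "(\<lambda>h. grad 0 \<bullet> h) = (\<lambda>_. 0)" using has_derivative_unique[OF v_der[OF B(2)] dv0] .
  then have "grad 0 \<bullet> grad 0 = 0" by meson
  then show ?thesis by simp
qed

lemma grad_component_der:
  assumes "z \<in> B"
  shows "((\<lambda>z. grad z $ i) has_derivative (\<lambda>h. hess z h $ i)) (at z)"
proof -
  have "Ck_on (Suc (Suc 0)) v B" using smooth unfolding smooth_on_def by blast
  then have "(\<lambda>y. frechet_derivative v (at y) (axis i 1)) differentiable (at z)"
    using assms by simp
  then show ?thesis
    unfolding grad_def hess_def by (simp add: frechet_derivative_works)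
qed

lemma grad_der:
  assumes "z \<in> B"
  shows "(grad has_derivative hess z) (at z)"
  using assms grad_component_der
  by (subst has_derivative_componentwise_within)
     (auto simp: Basis_vec_def inner_axis)

lemma linear_hess: "z \<in> B \<Longrightarrow> linear (hess z)"
  using grad_der has_derivative_linear by blast

lemma hess_cont: "continuous_on B (\<lambda>z. hess z h)"
proof -
  have "Ck_on (Suc (Suc 0)) v B" using smooth unfolding smooth_on_def by blast
  then have "continuous_on B (\<lambda>z. frechet_derivative (\<lambda>y. frechet_derivative v (at y) (axis i 1)) (at z) h)" for i
    by simp
  then show ?thesis unfolding hess_def by (intro continuous_on_vec_lambda)
qed

lemma hess_sym: "hess 0 x \<bullet> y = x \<bullet> hess 0 y"
proof -
  have d: "((\<lambda>y. grad y \<bullet> c) has_derivative (\<lambda>h. hess y h \<bullet> c)) (at y)" if "y \<in> B" for y c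
    using grad_der[OF that] by (rule has_derivative_inner_left)
  have c: "continuous_on B (\<lambda>y. hess y a \<bullet> b)" for a b
    using hess_cont by (auto intro: continuous_intros)
  have comp: "hess 0 b \<bullet> a = hess 0 a \<bullet> b" for a b
    by (rule second_derivative_symmetric[OF B v_der d d c c])
  show ?thesis using comp[of x y] by (simp add: inner_commute)
qed

lemma grad_lipschitz_near_0:
  obtains \<rho> L where "\<rho> > 0" "ball 0 \<rho> \<subseteq> B" "L-lipschitz_on (ball 0 \<rho>) grad"
proof -
  obtain \<rho> where \<rho>: "\<rho> > 0" "cball 0 \<rho> \<subseteq> B" using B open_contains_cball by blast
  have "\<exists>b. \<forall>z\<in>cball 0 \<rho>. norm (hess z (axis i 1)) \<le> b" for i
  proof -
    have "bounded ((\<lambda>z. hess z (axis i 1)) ` cball 0 \<rho>)"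
      using hess_cont continuous_on_subset[OF _ \<rho>(2)]
      by (intro compact_imp_bounded compact_continuous_image) auto
    then show ?thesis unfolding bounded_iff by auto
  qed
  then have "\<forall>i. \<exists>b. \<forall>z\<in>cball 0 \<rho>. norm (hess z (axis i 1)) \<le> b" by blast
  from choice[OF this] obtain b where b: "\<And>i z. z \<in> cball 0 \<rho> \<Longrightarrow> norm (hess z (axis i 1)) \<le> b i"
    by blast
  define L where "L = (\<Sum>i\<in>UNIV. b i)"
  have L0: "L \<ge> 0" unfolding L_def
    using b[of 0] \<rho>(1) by (intro sum_nonneg) (auto intro: order_trans[OF norm_ge_zero])
  have on: "onorm (hess z) \<le> L" if z: "z \<in> ball 0 \<rho>" for z
  proof (rule onorm_le)
    fix h
    have zB: "z \<in> B" using z \<rho> by auto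
    have "norm (hess z h) \<le> (\<Sum>i\<in>UNIV. norm ((h $ i) *\<^sub>R hess z (axis i 1)))"
      by (subst linear_axis_expand[OF linear_hess[OF zB]]) (rule norm_sum)
    also have "\<dots> \<le> (\<Sum>i\<in>UNIV. norm h * b i)"
    proof (rule sum_mono)
      fix i
      show "norm ((h $ i) *\<^sub>R hess z (axis i 1)) \<le> norm h * b i"
        unfolding norm_scaleR using z b[of z i] component_le_norm_cart[of h i] by (intro mult_mono) auto
    qed
    also have "\<dots> = L * norm h" by (simp add: L_def sum_distrib_left mult.commute)
    finally show "norm (hess z h) \<le> L * norm h" .
  qed
  have "L-lipschitz_on (ball 0 \<rho>) grad"
  proof (rule lipschitz_onI)
    fix x y :: "real ^ 'n" assume xy: "x \<in> ball 0 \<rho>" "y \<in> ball 0 \<rho>"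
    have "norm (grad x - grad y) \<le> L * norm (x - y)"
      using \<rho> xy on
      by (intro differentiable_bound[of "ball 0 \<rho>" grad hess])
         (auto intro!: has_derivative_at_withinI[OF grad_der])
    then show "dist (grad x) (grad y) \<le> L * dist x y" by (simp add: dist_norm)
  qed (rule L0)
  moreover have "ball 0 \<rho> \<subseteq> B" using \<rho> by auto
  ultimately show thesis using \<rho>(1) that by blast
qed

lemma conormal_0: "conormal 0 = N"
  by (simp add: conormal_def grad_0 linear_0[OF linear_frame_map])

lemma conormal_N: "conormal z \<bullet> N = 1"
  by (simp add: conormal_def inner_simps NN)

lemma norm_conormal: "norm (conormal z) \<ge> 1"
  using Cauchy_Schwarz_ineq2[of "conormal z" N] by (simp add: conormal_N unit)

lemma inner_conormal: "w \<bullet> conormal z = w \<bullet> N - frame_coords e w \<bullet> grad z"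
proof -
  have "w \<bullet> frame_map e (grad z) = frame_coords e w \<bullet> grad z"
    by (metis frame_map_inner inner_commute)
  then show ?thesis by (simp add: conormal_def inner_diff_right)
qed

text \<open>Lines in the parameter domain give curves in \<open>M\<close> whose velocities fill the hyperplane.  Conversely a curve in
\<open>M\<close> through the point stays in the chart for a short time, so its coordinate in direction \<open>N\<close> is \<open>v\<close> of its other
coordinates, and differentiating this relation puts its velocity in the hyperplane.\<close>

lemma tangent_space_param:
  assumes z: "z \<in> B"
  shows "tangent_space M (param z) = {w. w \<bullet> conormal z = 0}"
proof (intro set_eqI iffI)
  fix w assume "w \<in> {w. w \<bullet> conormal z = 0}"
  then have w: "w \<bullet> N = grad z \<bullet> frame_coords e w" by (simp add: inner_conormal inner_commute)
  define h where "h = frame_coords e w"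
  define \<gamma> where "\<gamma> = (\<lambda>t. param (z + t *\<^sub>R h))"
  obtain r where r: "r > 0" "ball z r \<subseteq> B" using B(1) z openE by blast
  define \<epsilon> where "\<epsilon> = r / (norm h + 1)"
  have nh: "norm h + 1 > 0" by (simp add: add_nonneg_pos)
  have \<epsilon>: "\<epsilon> > 0" using r nh by (simp add: \<epsilon>_def)
  have "z + t *\<^sub>R h \<in> B" if "t \<in> {-\<epsilon><..<\<epsilon>}" for t
  proof -
    have "\<bar>t\<bar> * norm h \<le> \<epsilon> * norm h" using that by (intro mult_right_mono) auto
    also have "\<dots> < \<epsilon> * (norm h + 1)" using \<epsilon> by (simp add: algebra_simps)
    also have "\<dots> = r" using nh by (simp add: \<epsilon>_def)
    finally show ?thesis using r(2) by (auto simp: dist_norm)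
  qed
  then have "\<gamma> ` {-\<epsilon><..<\<epsilon>} \<subseteq> M" using M_param by (auto simp: \<gamma>_def)
  moreover have "\<gamma> 0 = param z" by (simp add: \<gamma>_def)
  moreover have "(\<gamma> has_vector_derivative w) (at 0)"
  proof -
    have l: "((\<lambda>t. z + t *\<^sub>R h) has_derivative (\<lambda>t. t *\<^sub>R h)) (at 0)"
      by (intro derivative_eq_intros) auto
    have 1: "((\<lambda>t. v (z + t *\<^sub>R h)) has_derivative (\<lambda>t. grad z \<bullet> (t *\<^sub>R h))) (at 0)"
      by (rule has_derivative_compose[OF l]) (use v_der[OF z] in simp)
    have 2: "((\<lambda>t. frame_map e (z + t *\<^sub>R h)) has_derivative (\<lambda>t. frame_map e (t *\<^sub>R h))) (at 0)"
      by (rule bounded_linear.has_derivative[OF bounded_linear_frame_map l])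
    have "(\<gamma> has_derivative (\<lambda>t. frame_map e (t *\<^sub>R h) + (grad z \<bullet> (t *\<^sub>R h)) *\<^sub>R N)) (at 0)"
      unfolding \<gamma>_def param_def
      by (rule derivative_eq_intros 1 2 refl | simp)+
    moreover have "frame_map e (t *\<^sub>R h) + (grad z \<bullet> (t *\<^sub>R h)) *\<^sub>R N = t *\<^sub>R w" for t
      using decomp[of w] w by (simp add: linear_scale[OF linear_frame_map] h_def scaleR_add_right[symmetric]
          flip: scaleR_scaleR)
    ultimately show ?thesis by (simp add: has_vector_derivative_def)
  qed
  ultimately show "w \<in> tangent_space M (param z)" unfolding tangent_space_def using \<epsilon> by blast
next
  fix w assume "w \<in> tangent_space M (param z)"
  then obtain \<gamma> \<epsilon> where \<epsilon>: "\<epsilon> > 0" "\<gamma> ` {-\<epsilon><..<\<epsilon>} \<subseteq> M" and \<gamma>0: "\<gamma> 0 = param z"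
    and der: "(\<gamma> has_vector_derivative w) (at 0)" unfolding tangent_space_def by blast
  have "isCont \<gamma> 0" using der has_vector_derivative_continuous by blast
  moreover have "\<gamma> 0 \<in> U" using M_param z \<gamma>0 by auto
  ultimately have evU: "\<forall>\<^sub>F t in nhds 0. \<gamma> t \<in> U"
    using U(1) unfolding continuous_at_open eventually_nhds by blast
  have "\<forall>\<^sub>F t in nhds 0. t \<in> {-\<epsilon><..<\<epsilon>}" using \<epsilon> by (intro eventually_nhds_in_open) auto
  with evU have ev: "\<forall>\<^sub>F t in nhds 0. \<gamma> t \<in> M \<inter> U"
    by eventually_elim (use \<epsilon>(2) in blast)
  define c where "c = (\<lambda>t. frame_coords e (\<gamma> t - X))"
  have der': "(\<gamma> has_derivative (\<lambda>t. t *\<^sub>R w)) (at 0)" using der by (simp add: has_vector_derivative_def)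
  have c0: "c 0 = z" by (simp add: c_def \<gamma>0 coords_param)
  have dc: "(c has_derivative (\<lambda>t. frame_coords e (t *\<^sub>R w))) (at 0)"
    unfolding c_def
    by (rule bounded_linear.has_derivative[OF bounded_linear_frame_coords])
      (rule derivative_eq_intros der' refl | simp)+
  have 1: "((\<lambda>t. v (c t)) has_derivative (\<lambda>t. grad z \<bullet> frame_coords e (t *\<^sub>R w))) (at 0)"
    by (rule has_derivative_compose[OF dc]) (use v_der[OF z] c0 in simp)
  have 2: "((\<lambda>t. (\<gamma> t - X) \<bullet> N) has_derivative (\<lambda>t. (t *\<^sub>R w) \<bullet> N)) (at 0)"
    by (rule derivative_eq_intros der' refl | simp)+
  obtain A where A: "open A" "0 \<in> A" "\<And>t. t \<in> A \<Longrightarrow> \<gamma> t \<in> M \<inter> U"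
    using ev unfolding eventually_nhds by blast
  have eq: "v (c t) = (\<gamma> t - X) \<bullet> N" if "t \<in> A" for t
    using M_near(2)[OF A(3)[OF that]] param_N[of "c t"] by (simp add: c_def)
  have "(\<lambda>t. grad z \<bullet> frame_coords e (t *\<^sub>R w)) = (\<lambda>t. (t *\<^sub>R w) \<bullet> N)"
    by (rule has_derivative_unique[OF has_derivative_transform_within_open[OF 1 A(1,2) eq] 2])
  from fun_cong[OF this, of 1] show "w \<in> {w. w \<bullet> conormal z = 0}"
    by (simp add: inner_conormal inner_commute)
qed

lemma tangent_space_X: "tangent_space M X = {w. w \<bullet> N = 0}"
  using tangent_space_param[OF B(2)] by (simp add: param_0 conormal_0)

lemma unit_normal_cases:
  assumes "norm a = 1" "\<forall>w\<in>tangent_space M X. a \<bullet> w = 0"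
  shows "a = N \<or> a = - N"
proof -
  have "N \<noteq> 0" using unit by auto
  moreover have "a \<bullet> w = 0" if "w \<bullet> N = 0" for w using assms(2) that unfolding tangent_space_X by blast
  ultimately show ?thesis using unit_vector_of_hyperplane[OF assms(1), of N] unit by simp
qed

end

lemma local_graph_chart:
  assumes "local_graph M X e N v"
  obtains B U where "graph_chart e N M X v B U"
  using assms unfolding local_graph_def graph_chart_def graph_chart_axioms_def orthonormal_frame_def
  by blast

section \<open>Inner normals and mean curvature of convex hypersurfaces\<close>

text \<open>Conormals have norm at least 1, so this bounds the Lipschitz constant of the unit normal by that of the gradient.\<close>

lemma dist_normalized_le:
  fixes V W :: "'a::real_normed_vector"
  assumes "norm V \<ge> 1" "norm W \<ge> 1"
  shows "norm ((1 / norm V) *\<^sub>R V - (1 / norm W) *\<^sub>R W) \<le> 2 * norm (V - W)"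
proof -
  have pos: "norm V > 0" "norm W > 0" using assms by linarith+
  have "(1 / norm V) *\<^sub>R V - (1 / norm W) *\<^sub>R W
      = (1 / norm V) *\<^sub>R (V - W) + (1 / norm V - 1 / norm W) *\<^sub>R W"
    by (simp add: algebra_simps)
  then have "norm ((1 / norm V) *\<^sub>R V - (1 / norm W) *\<^sub>R W)
      \<le> (1 / norm V) * norm (V - W) + \<bar>1 / norm V - 1 / norm W\<bar> * norm W"
    using norm_triangle_ineq[of "(1 / norm V) *\<^sub>R (V - W)" "(1 / norm V - 1 / norm W) *\<^sub>R W"] pos by simp
  also have "\<bar>1 / norm V - 1 / norm W\<bar> * norm W = \<bar>(1 / norm V - 1 / norm W) * norm W\<bar>"
    by (simp add: abs_mult)
  also have "(1 / norm V - 1 / norm W) * norm W = (1 / norm V) * (norm W - norm V)"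
    using pos by (simp add: field_simps)
  also have "\<bar>(1 / norm V) * (norm W - norm V)\<bar> = (1 / norm V) * \<bar>norm W - norm V\<bar>"
    using pos by (simp add: abs_mult)
  also have "\<dots> \<le> (1 / norm V) * norm (V - W)"
    using pos norm_triangle_ineq3[of W V] by (intro mult_left_mono) (auto simp: norm_minus_commute)
  also have "(1 / norm V) * norm (V - W) + (1 / norm V) * norm (V - W) \<le> 1 * norm (V - W) + 1 * norm (V - W)"
    using assms pos by (intro add_mono mult_right_mono) auto
  finally show ?thesis by simp
qed

locale convex_hypersurface =
  fixes M G :: "'n::finite point set"
  assumes smooth_M: "smooth_hypersurface M" and G: "open G" "convex G" "G \<noteq> {}"
    and frontier: "frontier G = M"
begin

abbreviation \<nu> :: "'n point \<Rightarrow> 'n point" where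
  "\<nu> \<equiv> inner_normal M G"

text \<open>The normals of supporting half-spaces.  They do not refer to tangent spaces, and the condition is closed in
both arguments.\<close>

definition supports :: "'n point \<Rightarrow> 'n point \<Rightarrow> bool" where
  "supports a Y \<longleftrightarrow> norm a = 1 \<and> (\<forall>g\<in>G. 0 \<le> a \<bullet> (g - Y))"

lemma closed_M: "closed M"
  using frontier frontier_closed by blast

lemma M_closure: "M \<subseteq> closure G" and M_G: "Y \<in> M \<Longrightarrow> Y \<notin> G"
  using frontier interior_open[OF G(1)] by (auto simp: frontier_def)

lemma chart_exists:
  assumes "X \<in> M"
  obtains e N v B U where "graph_chart e N M X v B U"
  using assms smooth_M local_graph_chart unfolding smooth_hypersurface_def by metis

lemma supports_closure:
  assumes "supports a Y" "Z \<in> closure G"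
  shows "0 \<le> a \<bullet> (Z - Y)"
proof -
  have "closure G \<subseteq> {Z. a \<bullet> Z \<ge> a \<bullet> Y}"
    using assms(1) by (intro closure_minimal closed_halfspace_ge) (auto simp: supports_def inner_diff_right)
  then show ?thesis using assms(2) by (auto simp: inner_diff_right)
qed

lemma supports_strict:
  assumes a: "supports a Y" and g: "g \<in> G"
  shows "0 < a \<bullet> (g - Y)"
proof (rule ccontr)
  assume "\<not> ?thesis"
  then have le: "a \<bullet> (g - Y) \<le> 0" by simp
  have na: "norm a = 1" using a by (simp add: supports_def)
  obtain r where r: "r > 0" "ball g r \<subseteq> G" using G(1) g openE by blast
  have "g - (r / 2) *\<^sub>R a \<in> G" using r na by (intro subsetD[OF r(2)]) (simp add: dist_norm)
  then have "0 \<le> a \<bullet> (g - (r / 2) *\<^sub>R a - Y)" using a by (simp add: supports_def)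
  also have "\<dots> = a \<bullet> (g - Y) - r / 2"
    using na by (simp add: inner_simps norm_eq_1)
  finally show False using le r(1) by linarith
qed

text \<open>Along a curve in \<open>M\<close> the function \<open>a \<bullet> (\<gamma> t - Y)\<close> has a minimum at \<open>t = 0\<close>.\<close>

lemma supports_tangent:
  assumes a: "supports a Y" and w: "w \<in> tangent_space M Y"
  shows "a \<bullet> w = 0"
proof -
  obtain \<gamma> \<epsilon> where \<epsilon>: "\<epsilon> > 0" "\<gamma> ` {-\<epsilon><..<\<epsilon>} \<subseteq> M" and \<gamma>0: "\<gamma> 0 = Y"
    and der: "(\<gamma> has_vector_derivative w) (at 0)" using w unfolding tangent_space_def by blast
  have der': "(\<gamma> has_derivative (\<lambda>t. t *\<^sub>R w)) (at 0)" using der by (simp add: has_vector_derivative_def)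
  have d: "((\<lambda>t. a \<bullet> (\<gamma> t - Y)) has_derivative (\<lambda>t. a \<bullet> (t *\<^sub>R w))) (at 0)"
    by (rule derivative_eq_intros der' refl | simp)+
  have "a \<bullet> (\<gamma> 0 - Y) \<le> a \<bullet> (\<gamma> t - Y)" if "t \<in> {-\<epsilon><..<\<epsilon>}" for t
  proof -
    have "\<gamma> t \<in> closure G" using that \<epsilon>(2) M_closure by blast
    then show ?thesis using supports_closure[OF a] \<gamma>0 by simp
  qed
  moreover have "\<forall>\<^sub>F t in at 0. t \<in> {-\<epsilon><..<\<epsilon>}"
    using \<epsilon>(1) by (intro eventually_at_in_open') auto
  ultimately have "\<forall>\<^sub>F t in at 0. a \<bullet> (\<gamma> 0 - Y) \<le> a \<bullet> (\<gamma> t - Y)"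
    by (auto elim: eventually_mono)
  from has_derivative_local_min[OF d this] have "a \<bullet> (1 *\<^sub>R w) = 0" by meson
  then show ?thesis by simp
qed

lemma supports_exists:
  assumes "Y \<in> M"
  obtains a where "supports a Y"
proof -
  have "{Y} \<inter> G = {}" using M_G[OF assms] by simp
  then obtain a b where ab: "a \<noteq> 0" "a \<bullet> Y \<le> b" "\<And>g. g \<in> G \<Longrightarrow> b \<le> a \<bullet> g"
    using separating_hyperplane_sets[of "{Y}" G] G by auto
  have "supports (a /\<^sub>R norm a) Y"
    unfolding supports_def using ab by (force simp: inner_diff_right)
  then show thesis by (rule that)
qed

text \<open>Both vectors are \<open>N\<close> or \<open>- N\<close> in a chart, and opposite vectors cannot both support an open set.\<close>

lemma supports_unique:
  assumes Y: "Y \<in> M" and a: "supports a Y" and b: "supports b Y"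
  shows "a = b"
proof -
  obtain e N v B U where "graph_chart e N M Y v B U" using chart_exists[OF Y] .
  then interpret C: graph_chart e N M Y v B U .
  have pm: "c = N \<or> c = - N" if "supports c Y" for c
    using C.unit_normal_cases supports_tangent[OF that] that by (auto simp: supports_def)
  obtain g where g: "g \<in> G" using G(3) by blast
  have "\<not> (supports N Y \<and> supports (- N) Y)"
  proof
    assume "supports N Y \<and> supports (- N) Y"
    then have "0 < N \<bullet> (g - Y)" "0 < - N \<bullet> (g - Y)" using supports_strict[OF _ g] by blast+
    then show False by simp
  qed
  then show ?thesis using pm[OF a] pm[OF b] a b by auto
qed

text \<open>If the ray from \<open>Y\<close> in direction \<open>a\<close> missed \<open>G\<close>, a hyperplane would separate them.  It passes through \<open>Y\<close> and
supports \<open>G\<close>, so by uniqueness its normal is a positive multiple of \<open>a\<close>; then the ray enters the side of \<open>G\<close>.\<close>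

lemma supports_points_inward:
  assumes Y: "Y \<in> M" and a: "supports a Y"
  shows "\<exists>\<epsilon>>0. \<forall>s\<in>{0<..<\<epsilon>}. Y + s *\<^sub>R a \<in> G"
proof (cases "\<exists>s>0. Y + s *\<^sub>R a \<in> G")
  case True
  then obtain s0 where s0: "s0 > 0" "Y + s0 *\<^sub>R a \<in> G" by blast
  have seg: "open_segment (Y + s0 *\<^sub>R a) Y \<subseteq> interior G"
    using s0 G(1,2) Y M_closure by (intro in_interior_closure_convex_segment) (auto simp: interior_open)
  have na: "a \<noteq> 0" using a by (auto simp: supports_def)
  have "Y + s *\<^sub>R a \<in> G" if s: "0 < s" "s < s0" for s
  proof -
    have "Y + s *\<^sub>R a \<in> open_segment (Y + s0 *\<^sub>R a) Y"
      unfolding in_segment using s s0 na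
      by (auto intro!: exI[of _ "1 - s / s0"] simp: algebra_simps)
    then show ?thesis using seg interior_subset by blast
  qed
  then show ?thesis using s0(1) by auto
next
  case False
  define R where "R = (\<lambda>s. Y + s *\<^sub>R a) ` {0..}"
  have "convex ((\<lambda>x. Y + x) ` ((\<lambda>s. s *\<^sub>R a) ` {0::real..}))"
    by (intro convex_translation convex_linear_image) (auto intro!: linearI simp: algebra_simps)
  then have "convex R" by (simp add: R_def image_image)
  moreover have "R \<inter> G = {}" using False M_G[OF Y] by (force simp: R_def le_less)
  moreover have "R \<noteq> {}" by (simp add: R_def)
  ultimately obtain c \<beta> where c: "c \<noteq> 0" "\<And>x. x \<in> R \<Longrightarrow> c \<bullet> x \<le> \<beta>" "\<And>g. g \<in> G \<Longrightarrow> \<beta> \<le> c \<bullet> g"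
    using separating_hyperplane_sets[of R G] G(2,3) by blast
  have "Y \<in> R" "Y + a \<in> R" by (auto simp: R_def intro: image_eqI[of _ _ 0] image_eqI[of _ _ 1])
  from this[THEN c(2)] have 1: "c \<bullet> Y \<le> \<beta>" "c \<bullet> Y + c \<bullet> a \<le> \<beta>" by (simp_all add: inner_add_right)
  have "supports (c /\<^sub>R norm c) Y"
    unfolding supports_def using c(1,3) 1 by (force simp: inner_diff_right)
  then have "a = c /\<^sub>R norm c" using supports_unique[OF Y a] by simp
  then have "c \<bullet> a = norm c" using c(1) by (simp add: power2_norm_eq_inner[symmetric] power2_eq_square)
  then have "c \<bullet> Y < \<beta>" using 1(2) c(1) zero_less_norm_iff[of c] by linarith
  moreover have "closure G \<subseteq> {x. c \<bullet> x \<ge> \<beta>}"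
    using c(3) by (intro closure_minimal closed_halfspace_ge) auto
  then have "\<beta> \<le> c \<bullet> Y" using Y M_closure by blast
  ultimately show ?thesis by simp
qed

lemma inner_normal_eq:
  assumes Y: "Y \<in> M" and a: "supports a Y"
  shows "\<nu> Y = a"
  unfolding inner_normal_def
proof (rule the_equality)
  show "norm a = 1 \<and> (\<forall>w\<in>tangent_space M Y. a \<bullet> w = 0) \<and> (\<exists>\<epsilon>>0. \<forall>s\<in>{0<..<\<epsilon>}. Y + s *\<^sub>R a \<in> G)"
    using a supports_tangent[OF a] supports_points_inward[OF Y a] by (auto simp: supports_def)
next
  fix N' assume N': "norm N' = 1 \<and> (\<forall>w\<in>tangent_space M Y. N' \<bullet> w = 0) \<and> (\<exists>\<epsilon>>0. \<forall>s\<in>{0<..<\<epsilon>}. Y + s *\<^sub>R N' \<in> G)"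
  obtain e N v B U where "graph_chart e N M Y v B U" using chart_exists[OF Y] .
  then interpret C: graph_chart e N M Y v B U .
  have na: "norm a = 1" using a by (simp add: supports_def)
  have "a = N \<or> a = - N" using C.unit_normal_cases[OF na] supports_tangent[OF a] by blast
  moreover have "N' = N \<or> N' = - N" using C.unit_normal_cases N' by blast
  moreover have "N' \<noteq> - a"
  proof
    assume eq: "N' = - a"
    obtain \<epsilon> where "\<epsilon> > 0" "\<And>s. s \<in> {0<..<\<epsilon>} \<Longrightarrow> Y + s *\<^sub>R N' \<in> G" using N' by blast
    then have "Y + (\<epsilon> / 2) *\<^sub>R N' \<in> G" by simp
    from supports_strict[OF a this] show False
      using \<open>\<epsilon> > 0\<close> na by (simp add: eq norm_eq_1)
  qed
  ultimately show "N' = a" by auto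
qed

lemma supports_inner_normal:
  assumes "Y \<in> M"
  shows "supports (\<nu> Y) Y"
proof -
  obtain a where "supports a Y" by (rule supports_exists[OF assms])
  then show ?thesis using inner_normal_eq[OF assms] by simp
qed

lemma norm_inner_normal: "Y \<in> M \<Longrightarrow> norm (\<nu> Y) = 1"
  using supports_inner_normal by (simp add: supports_def)

lemma inner_normal_strict: "Y \<in> M \<Longrightarrow> g \<in> G \<Longrightarrow> 0 < \<nu> Y \<bullet> (g - Y)"
  using supports_strict[OF supports_inner_normal] .

text \<open>The graph of \<open>\<nu>\<close> is closed because supporting is a closed condition, and \<open>\<nu>\<close> has values in a compact sphere.\<close>

lemma continuous_inner_normal: "continuous_on M \<nu>"
proof (rule continuous_from_closed_graph[OF compact_sphere[of 0 1]])
  show "\<nu> \<in> M \<rightarrow> sphere 0 1" using norm_inner_normal by auto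
  have "(\<lambda>x. (x, \<nu> x)) ` M = (M \<times> sphere 0 1) \<inter> (\<Inter>g\<in>G. {p. 0 \<le> snd p \<bullet> (g - fst p)})"
  proof (intro set_eqI iffI)
    fix p assume "p \<in> (\<lambda>x. (x, \<nu> x)) ` M"
    then show "p \<in> (M \<times> sphere 0 1) \<inter> (\<Inter>g\<in>G. {p. 0 \<le> snd p \<bullet> (g - fst p)})"
      using supports_inner_normal norm_inner_normal unfolding supports_def by fastforce
  next
    fix p assume p: "p \<in> (M \<times> sphere 0 1) \<inter> (\<Inter>g\<in>G. {p. 0 \<le> snd p \<bullet> (g - fst p)})"
    then have "supports (snd p) (fst p)" "fst p \<in> M" by (auto simp: supports_def)
    then have "\<nu> (fst p) = snd p" by (intro inner_normal_eq) auto
    then show "p \<in> (\<lambda>x. (x, \<nu> x)) ` M" using \<open>fst p \<in> M\<close> by (intro image_eqI[of _ _ "fst p"]) auto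
  qed
  moreover have "closed {p :: 'n point \<times> 'n point. 0 \<le> snd p \<bullet> (g - fst p)}" for g
    by (intro closed_Collect_le continuous_intros)
  ultimately show "closed ((\<lambda>x. (x, \<nu> x)) ` M)"
    using closed_M by (auto intro!: closed_Int closed_Times closed_INT)
qed

end

locale charted_hypersurface = convex_hypersurface M G + graph_chart e N M X v B U
  for M G :: "'n::finite point set" and e N X v B U
begin

text \<open>Whether the axis \<open>N\<close> of the chart is the inner or the outer normal: \<open>1\<close> or \<open>- 1\<close>.\<close>

definition orientation :: real where "orientation = \<nu> X \<bullet> N"

text \<open>The differential of \<open>\<nu>\<close> at \<open>X\<close>, extended to all vectors by zero in direction \<open>N\<close>.\<close>

definition dnormal :: "'n point \<Rightarrow> 'n point" where
  "dnormal w = - (orientation *\<^sub>R frame_map e (hess 0 (frame_coords e w)))"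

lemma normal_param_pm:
  assumes "z \<in> B"
  shows "\<nu> (param z) = (1 / norm (conormal z)) *\<^sub>R conormal z
       \<or> \<nu> (param z) = (- 1 / norm (conormal z)) *\<^sub>R conormal z"
proof (rule unit_vector_of_hyperplane)
  have M: "param z \<in> M" using assms M_param by blast
  show "norm (\<nu> (param z)) = 1" using norm_inner_normal[OF M] .
  show "conormal z \<noteq> 0" using norm_conormal[of z] by (metis norm_zero not_one_le_zero)
  show "\<nu> (param z) \<bullet> w = 0" if "w \<bullet> conormal z = 0" for w
    using supports_tangent[OF supports_inner_normal[OF M]] tangent_space_param[OF assms] that by blast
qed

lemma orientation_pm: "orientation = 1 \<or> orientation = - 1"
  and normal_X: "\<nu> X = orientation *\<^sub>R N"
proof -
  have "\<nu> X = N \<or> \<nu> X = - N" using normal_param_pm[OF B(2)] by (simp add: param_0 conormal_0 unit)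
  then show "orientation = 1 \<or> orientation = - 1" "\<nu> X = orientation *\<^sub>R N"
    by (metis NN inner_minus_left orientation_def, metis NN inner_minus_left orientation_def scaleR_minus1_left scaleR_one)
qed

text \<open>A priori the normal at each point is one of two opposite unit vectors.  By continuity its component in
direction \<open>N\<close> stays close to its value 1 or -1 at \<open>X\<close>, which fixes the sign.\<close>

lemma normal_near:
  assumes "\<rho> > 0"
  obtains r where "r > 0" "\<And>Y. Y \<in> M \<inter> ball X r \<Longrightarrow> Y \<in> U" "\<And>Y. Y \<in> M \<inter> ball X r \<Longrightarrow> frame_coords e (Y - X) \<in> ball 0 \<rho>"
    "\<And>Y. Y \<in> M \<inter> ball X r \<Longrightarrow> \<nu> Y = (orientation / norm (conormal (frame_coords e (Y - X)))) *\<^sub>R conormal (frame_coords e (Y - X))"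
proof -
  obtain r1 where r1: "r1 > 0" "ball X r1 \<subseteq> U" using U openE by blast
  have "continuous (at X within M) \<nu>"
    using continuous_inner_normal X_in_M by (simp add: continuous_on_eq_continuous_within)
  then obtain r2 where r2: "r2 > 0" "\<And>Y. Y \<in> M \<Longrightarrow> dist Y X < r2 \<Longrightarrow> dist (\<nu> Y) (\<nu> X) < 1"
    unfolding continuous_within_eps_delta using zero_less_one by blast
  define r where "r = min \<rho> (min r1 r2)"
  have r: "r > 0" "r \<le> \<rho>" "r \<le> r1" "r \<le> r2" using r1 r2 assms by (auto simp: r_def)
  show thesis
  proof (rule that[OF r(1)])
    fix Y assume Y: "Y \<in> M \<inter> ball X r"
    show YU: "Y \<in> U" using Y r r1 by auto
    define z where "z = frame_coords e (Y - X)"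
    have "norm z \<le> norm (Y - X)" unfolding z_def by (rule norm_coords_le)
    then show "frame_coords e (Y - X) \<in> ball 0 \<rho>" using Y r(2) by (simp add: z_def dist_norm norm_minus_commute)
    have zB: "z \<in> B" "param z = Y" using M_near[of Y] Y YU by (auto simp: z_def)
    have "\<bar>(\<nu> Y - \<nu> X) \<bullet> N\<bar> < 1"
      using Cauchy_Schwarz_ineq2[of "\<nu> Y - \<nu> X" N] r2(2)[of Y] Y r(4) unit
      by (auto simp: dist_norm norm_minus_commute[of X])
    then have close: "\<bar>\<nu> Y \<bullet> N - orientation\<bar> < 1" by (simp add: orientation_def inner_diff_left)
    define k where "k = 1 / norm (conormal z)"
    have k: "k > 0" unfolding k_def using norm_conormal[of z] by (intro divide_pos_pos) linarith+
    have "\<nu> Y = k *\<^sub>R conormal z \<or> \<nu> Y = (- k) *\<^sub>R conormal z"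
      using normal_param_pm[OF zB(1)] zB(2) by (simp add: k_def)
    then have "\<nu> Y = (orientation * k) *\<^sub>R conormal z"
      using close k orientation_pm by (auto simp: conormal_N)
    then show "\<nu> Y = (orientation / norm (conormal (frame_coords e (Y - X)))) *\<^sub>R conormal (frame_coords e (Y - X))"
      by (simp add: k_def z_def)
  qed
qed

lemma normal_lipschitz_near:
  obtains r L where "r > 0" "L-lipschitz_on (M \<inter> ball X r) \<nu>"
proof -
  obtain \<rho> L where \<rho>: "\<rho> > 0" "ball 0 \<rho> \<subseteq> B" and L: "L-lipschitz_on (ball 0 \<rho>) grad"
    by (rule grad_lipschitz_near_0)
  obtain r where r: "r > 0" and in_\<rho>: "\<And>Y. Y \<in> M \<inter> ball X r \<Longrightarrow> frame_coords e (Y - X) \<in> ball 0 \<rho>"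
    and eq: "\<And>Y. Y \<in> M \<inter> ball X r \<Longrightarrow> \<nu> Y = (orientation / norm (conormal (frame_coords e (Y - X)))) *\<^sub>R conormal (frame_coords e (Y - X))"
    using normal_near[OF \<rho>(1)] by metis
  have L0: "L \<ge> 0" using L lipschitz_on_nonneg by auto
  have "(2 * L)-lipschitz_on (M \<inter> ball X r) \<nu>"
  proof (rule lipschitz_onI)
    fix Y Z assume YZ: "Y \<in> M \<inter> ball X r" "Z \<in> M \<inter> ball X r"
    define y z where "y = frame_coords e (Y - X)" and "z = frame_coords e (Z - X)"
    have "\<nu> Y - \<nu> Z = orientation *\<^sub>R ((1 / norm (conormal y)) *\<^sub>R conormal y - (1 / norm (conormal z)) *\<^sub>R conormal z)"
      using eq[OF YZ(1)] eq[OF YZ(2)] by (simp add: y_def z_def scaleR_diff_right)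
    then have "norm (\<nu> Y - \<nu> Z) = norm ((1 / norm (conormal y)) *\<^sub>R conormal y - (1 / norm (conormal z)) *\<^sub>R conormal z)"
      using orientation_pm by auto
    also have "\<dots> \<le> 2 * norm (conormal y - conormal z)"
      by (intro dist_normalized_le norm_conormal)
    also have "norm (conormal y - conormal z) = norm (grad y - grad z)"
    proof -
      have "conormal y - conormal z = frame_map e (grad z - grad y)"
        by (simp add: conormal_def linear_diff[OF linear_frame_map])
      then show ?thesis by (simp add: norm_minus_commute)
    qed
    also have "norm (grad y - grad z) \<le> L * norm (y - z)"
      using lipschitz_onD[OF L in_\<rho>[OF YZ(1)] in_\<rho>[OF YZ(2)]] by (simp add: y_def z_def dist_norm)
    also have "y - z = frame_coords e (Y - Z)"
      unfolding y_def z_def by (simp add: linear_diff[OF linear_frame_coords, symmetric])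
    also have "L * norm (frame_coords e (Y - Z)) \<le> L * norm (Y - Z)"
      by (intro mult_left_mono norm_coords_le L0)
    finally show "dist (\<nu> Y) (\<nu> Z) \<le> 2 * L * dist Y Z" by (simp add: dist_norm)
  qed (use L0 in auto)
  then show thesis using r that by blast
qed

text \<open>The differential of the conormal at \<open>X\<close> is orthogonal to \<open>N\<close>, so the normalising factor is stationary there and
only the Hessian term remains.\<close>

lemma normal_has_derivative: "(\<nu> has_derivative dnormal) (at X within M)"
proof -
  define c where "c = (\<lambda>Y. frame_coords e (Y - X))"
  define F where "F = (\<lambda>Y. orientation *\<^sub>R (inverse (norm (conormal (c Y))) *\<^sub>R conormal (c Y)))"
  define dW where "dW = (\<lambda>w. - frame_map e (hess 0 (frame_coords e w)))"
  obtain r where r: "r > 0"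
    and eq: "\<And>Y. Y \<in> M \<inter> ball X r \<Longrightarrow> \<nu> Y = (orientation / norm (conormal (frame_coords e (Y - X)))) *\<^sub>R conormal (frame_coords e (Y - X))"
    using normal_near[OF zero_less_one] by metis
  have cX: "c X = 0" by (simp add: c_def linear_0[OF linear_frame_coords])
  have dc: "(c has_derivative frame_coords e) (at X)"
    unfolding c_def
    by (rule bounded_linear.has_derivative[OF bounded_linear_frame_coords])
      (rule derivative_eq_intros refl | simp)+
  have "((\<lambda>Y. grad (c Y)) has_derivative (\<lambda>w. hess 0 (frame_coords e w))) (at X)"
    by (rule has_derivative_compose[OF dc]) (use grad_der[OF B(2)] cX in simp)
  from bounded_linear.has_derivative[OF bounded_linear_frame_map this]
  have W: "((\<lambda>Y. conormal (c Y)) has_derivative dW) (at X)"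
    unfolding conormal_def dW_def by (auto intro!: derivative_eq_intros)
  have WX: "conormal (c X) = N" by (simp add: cX conormal_0)
  have N0: "N \<noteq> 0" using unit by auto
  have n: "((\<lambda>Y. norm (conormal (c Y))) has_derivative (\<lambda>w. dW w \<bullet> sgn N)) (at X)"
    using has_derivative_compose[OF W, of norm "\<lambda>h. h \<bullet> sgn N"] has_derivative_norm[OF N0] WX
    by (simp add: inner_commute)
  have dWN: "dW w \<bullet> sgn N = 0" for w by (simp add: dW_def sgn_div_norm)
  have i: "((\<lambda>Y. inverse (norm (conormal (c Y)))) has_derivative (\<lambda>w. 0)) (at X)"
    using Deriv.has_derivative_inverse[OF _ n] WX N0 by (simp add: dWN)
  have "(F has_derivative dnormal) (at X)"
    unfolding F_def
    by (rule has_derivative_eq_rhs[OF has_derivative_scaleR_right[OF has_derivative_scaleR[OF i W]]])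
      (simp add: WX unit dnormal_def dW_def fun_eq_iff)
  then have "(F has_derivative dnormal) (at X within M)" by (rule has_derivative_at_withinI)
  then show ?thesis
    by (rule has_derivative_transform_within[OF _ r X_in_M])
      (use eq in \<open>auto simp: F_def c_def dist_commute field_simps\<close>)
qed

lemma tangent_plane_approx:
  assumes "\<epsilon> > 0"
  obtains r where "r > 0" "\<And>Y. Y \<in> M \<inter> ball X r \<Longrightarrow> \<bar>\<nu> X \<bullet> (Y - X)\<bar> \<le> \<epsilon> * norm (Y - X)"
proof -
  obtain d where d: "d > 0" "\<And>z. norm (z - 0) < d \<Longrightarrow> norm (v z - v 0 - 0) \<le> \<epsilon> * norm (z - 0)"
    using dv0 assms unfolding has_derivative_at_alt by blast
  obtain r where r: "r > 0" "\<And>Y. Y \<in> M \<inter> ball X r \<Longrightarrow> Y \<in> U" "\<And>Y. Y \<in> M \<inter> ball X r \<Longrightarrow> frame_coords e (Y - X) \<in> ball 0 d"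
    using normal_near[OF d(1)] by metis
  show thesis
  proof (rule that[OF r(1)])
    fix Y assume Y: "Y \<in> M \<inter> ball X r"
    define z where "z = frame_coords e (Y - X)"
    have "param z = Y" using M_near(2)[of Y] Y r(2)[OF Y] by (auto simp: z_def)
    then have "(Y - X) \<bullet> N = v z" using param_N by blast
    then have "\<bar>\<nu> X \<bullet> (Y - X)\<bar> = \<bar>v z\<bar>"
      using orientation_pm by (auto simp: normal_X inner_commute abs_mult)
    also have "\<dots> \<le> \<epsilon> * norm z" using d(2)[of z] r(3)[OF Y] by (simp add: v0 z_def)
    also have "\<dots> \<le> \<epsilon> * norm (Y - X)"
      unfolding z_def using assms by (intro mult_left_mono norm_coords_le) auto
    finally show "\<bar>\<nu> X \<bullet> (Y - X)\<bar> \<le> \<epsilon> * norm (Y - X)" .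
  qed
qed

lemma normal_derivative_unique:
  assumes D: "(\<nu> has_derivative D) (at X within M)" and w: "w \<in> tangent_space M X"
  shows "D w = dnormal w"
proof -
  obtain \<gamma> \<epsilon> where \<epsilon>: "\<epsilon> > 0" "\<gamma> ` {-\<epsilon><..<\<epsilon>} \<subseteq> M" and \<gamma>0: "\<gamma> 0 = X"
    and der: "(\<gamma> has_vector_derivative w) (at 0)" using w unfolding tangent_space_def by blast
  let ?I = "{-\<epsilon><..<\<epsilon>}"
  have at: "at 0 within ?I = at 0" using \<epsilon>(1) by (intro at_within_open) auto
  have d\<gamma>: "(\<gamma> has_derivative (\<lambda>t. t *\<^sub>R w)) (at 0 within ?I)"
    using der by (simp add: has_vector_derivative_def at)
  have "((\<lambda>t. \<nu> (\<gamma> t)) has_derivative (\<lambda>t. E (t *\<^sub>R w))) (at 0)"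
    if "(\<nu> has_derivative E) (at X within M)" for E
    using has_derivative_in_compose[OF d\<gamma>, of \<nu> E] has_derivative_subset[OF that \<epsilon>(2)] \<gamma>0 by (simp add: at)
  from has_derivative_unique[OF this[OF D] this[OF normal_has_derivative]]
  have "D (1 *\<^sub>R w) = dnormal (1 *\<^sub>R w)" by meson
  then show ?thesis by simp
qed

definition hess_trace :: real where
  "hess_trace = (\<Sum>i\<in>UNIV. hess 0 (axis i 1) $ i)"

lemma dnormal_frame_map: "dnormal (frame_map e h) = - (orientation *\<^sub>R frame_map e (hess 0 h))"
  by (simp add: dnormal_def)

lemma principal_curvatures_exist: "\<exists>k. principal_curvatures M G X k"
proof -
  obtain b c where b: "\<And>i j. b i \<bullet> b j = (if i = j then 1 else 0)" "\<And>i. hess 0 (b i) = c i *\<^sub>R b (i::'n)"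
    using selfadjoint_orthonormal_eigenbasis[OF linear_hess[OF B(2)] hess_sym] by blast
  have "orthonormal_family (\<lambda>i. frame_map e (b i))" by (simp add: orthonormal_family_def b(1))
  moreover have "frame_map e (b i) \<in> tangent_space M X" for i by (simp add: tangent_space_X)
  moreover have "- dnormal (frame_map e (b i)) = (orientation * c i) *\<^sub>R frame_map e (b i)" for i
    by (simp add: dnormal_frame_map b(2) linear_scale[OF linear_frame_map])
  ultimately show ?thesis unfolding principal_curvatures_def
    by (intro exI[of _ "\<lambda>i. orientation * c i"] exI[of _ "\<lambda>i. frame_map e (b i)"] exI[of _ dnormal])
      (auto intro: normal_has_derivative)
qed

text \<open>On tangent vectors every derivative of \<open>\<nu>\<close> within \<open>M\<close> agrees with \<open>dnormal\<close>.  So the sum of the principal curvatures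
is a trace, which is the same in all orthonormal bases.  With \<open>principal_curvatures_exist\<close> this makes the mean
curvature well defined.\<close>

lemma principal_curvatures_sum:
  assumes "principal_curvatures M G X k"
  shows "(\<Sum>i\<in>UNIV. k i) = orientation * hess_trace"
proof -
  obtain f D where f: "orthonormal_family f" "\<And>i. f i \<in> tangent_space M X"
    and D: "(\<nu> has_derivative D) (at X within M)" "\<And>i. - D (f i) = k i *\<^sub>R f i"
    using assms unfolding principal_curvatures_def by blast
  define b where "b = (\<lambda>i. frame_coords e (f i))"
  have fb: "f i = frame_map e (b i)" for i
    using f(2)[of i] perp_N_eq_frame_map[of "f i"] by (simp add: tangent_space_X b_def)
  have bo: "b i \<bullet> b j = (if i = j then 1 else 0)" for i j
    using f(1) by (simp add: orthonormal_family_def fb)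
  have "k i = orientation * (hess 0 (b i) \<bullet> b i)" for i
  proof -
    have "k i = (k i *\<^sub>R f i) \<bullet> f i" using bo[of i i] by (simp add: fb)
    also have "\<dots> = - (dnormal (f i) \<bullet> f i)"
      unfolding D(2)[symmetric] normal_derivative_unique[OF D(1) f(2)] by simp
    also have "\<dots> = orientation * (hess 0 (b i) \<bullet> b i)" by (simp add: fb dnormal_frame_map)
    finally show ?thesis .
  qed
  then have "(\<Sum>i\<in>UNIV. k i) = orientation * (\<Sum>i\<in>UNIV. hess 0 (b i) \<bullet> b i)"
    by (simp add: sum_distrib_left)
  then show ?thesis using trace_orthonormal[OF linear_hess[OF B(2)], of b] bo by (simp add: hess_trace_def)
qed

lemma mean_curvature_hess: "real CARD('n) * mean_curvature M G X = orientation * hess_trace"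
proof -
  obtain k where k: "principal_curvatures M G X k" using principal_curvatures_exist by blast
  have "mean_curvature M G X = orientation * hess_trace / real CARD('n)"
    unfolding mean_curvature_def
    by (rule the_equality) (use k principal_curvatures_sum in \<open>auto intro!: exI[of _ k]\<close>)
  then show ?thesis by simp
qed

text \<open>When \<open>M\<close> is written as a graph over \<open>n\<close>-space, the tangent space at \<open>X\<close> consists of the vectors \<open>(h, L h)\<close>, and the
first projection inverts \<open>h \<mapsto> (h, L h)\<close>.  The differential of the horizontal part of the normal is
therefore conjugate to the differential of \<open>\<nu>\<close> on the tangent space, and its trace is \<open>- n H\<close>.
This takes the place of the explicit formula for the mean curvature of a graph.\<close>

lemma trace_dnormal_graph:
  assumes L: "linear L" and tangent: "\<And>h. \<nu> X \<bullet> (h, L h) = 0"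
  shows "(\<Sum>i\<in>UNIV. fst (dnormal (axis i 1, L (axis i 1))) $ i) = - (real CARD('n) * mean_curvature M G X)"
proof -
  define A where "A = (\<lambda>h. frame_coords e (h, L h))"
  define P where "P = (\<lambda>z. fst (frame_map e z))"
  have lA: "linear A" unfolding A_def
  proof (rule linearI)
    fix x y and r :: real
    show "frame_coords e (x + y, L (x + y)) = frame_coords e (x, L x) + frame_coords e (y, L y)"
      unfolding linear_add[OF L] linear_add[OF linear_frame_coords, symmetric] by simp
    show "frame_coords e (r *\<^sub>R x, L (r *\<^sub>R x)) = r *\<^sub>R frame_coords e (x, L x)"
      unfolding linear_scale[OF L] linear_scale[OF linear_frame_coords, symmetric] by simp
  qed
  have lP: "linear P" unfolding P_def
    by (intro linearI) (simp_all add: linear_add[OF linear_frame_map] linear_scale[OF linear_frame_map])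
  have EA: "frame_map e (A h) = (h, L h)" for h
  proof -
    have "N \<bullet> (h, L h) = 0" using tangent[of h] orientation_pm by (auto simp: normal_X)
    then show ?thesis unfolding A_def using perp_N_eq_frame_map[of "(h, L h)"] by (simp add: inner_commute)
  qed
  then have inv: "P (A h) = h" for h by (simp add: P_def)
  have "(\<Sum>i\<in>UNIV. fst (dnormal (axis i 1, L (axis i 1))) $ i)
      = (\<Sum>i\<in>UNIV. - orientation * (P (hess 0 (A (axis i 1))) $ i))"
    unfolding EA[symmetric] dnormal_frame_map by (simp add: P_def)
  also have "\<dots> = - orientation * hess_trace"
    using trace_conjugate[OF lA lP linear_hess[OF B(2)] inv] 
    by (simp only: hess_trace_def sum_distrib_left[symmetric])
  finally show ?thesis by (simp add: mean_curvature_hess)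
qed

end

context convex_hypersurface
begin

lemma charted_exists:
  assumes "X \<in> M"
  obtains e N v B U where "charted_hypersurface M G e N X v B U"
  using chart_exists[OF assms] convex_hypersurface_axioms unfolding charted_hypersurface_def by metis

lemma inner_normal_lipschitz_near:
  assumes "X \<in> M"
  obtains r L where "r > 0" "L-lipschitz_on (M \<inter> ball X r) \<nu>"
  using charted_exists[OF assms] charted_hypersurface.normal_lipschitz_near by metis

lemma inner_normal_tangent_plane:
  assumes "X \<in> M" "\<epsilon> > 0"
  obtains r where "r > 0" "\<And>Y. Y \<in> M \<inter> ball X r \<Longrightarrow> \<bar>\<nu> X \<bullet> (Y - X)\<bar> \<le> \<epsilon> * norm (Y - X)"
  using charted_exists[OF assms(1)] charted_hypersurface.tangent_plane_approx[OF _ assms(2)] by metis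

lemma inner_normal_derivative_trace:
  assumes "X \<in> M"
  shows "\<exists>D. (\<nu> has_derivative D) (at X within M) \<and>
    (\<forall>L. linear L \<longrightarrow> (\<forall>h. \<nu> X \<bullet> (h, L h) = 0) \<longrightarrow>
      (\<Sum>i\<in>UNIV. fst (D (axis i 1, L (axis i 1))) $ i) = - (real CARD('n) * mean_curvature M G X))"
proof -
  obtain e N v B U where "charted_hypersurface M G e N X v B U" using charted_exists[OF assms] .
  then interpret charted_hypersurface M G e N X v B U .
  show ?thesis using normal_has_derivative trace_dnormal_graph by blast
qed

end

section \<open>Graph functions over the shadow of a convex body\<close>

lemma sum_Basis_vec:
  fixes f :: "real ^ 'n \<Rightarrow> real ^ 'n"
  shows "(\<Sum>b\<in>Basis. f b \<bullet> b) = (\<Sum>i\<in>UNIV. f (axis i 1) $ i)"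
proof -
  have eq: "Basis = range (\<lambda>i :: 'n. axis i (1::real))" by (auto simp: Basis_vec_def)
  have inj: "inj (\<lambda>i :: 'n. axis i (1::real))" by (auto simp: inj_def axis_eq_axis)
  show ?thesis unfolding eq sum.reindex[OF inj] by (simp add: inner_axis)
qed

text \<open>If \<open>(p, - a)\<close> and \<open>(q, - b)\<close> are unit vectors, then \<open>(1 / a) p\<close> and \<open>(1 / b) q\<close> are the gradients of graphs with these
normals.  The identity is the strict monotonicity of the map \<open>p \<mapsto> p / sqrt (1 - p \<bullet> p)\<close>.\<close>

lemma normal_difference_identity:
  fixes p q :: "'a::real_inner"
  assumes pos: "a > 0" "b > 0" and p: "p \<bullet> p + a\<^sup>2 = 1" and q: "q \<bullet> q + b\<^sup>2 = 1"
  shows "((1 / a) *\<^sub>R p - (1 / b) *\<^sub>R q) \<bullet> (p - q) = (1 / a + 1 / b) / 2 * ((p - q) \<bullet> (p - q) + (a - b)\<^sup>2)"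
proof -
  have 1: "(p - q) \<bullet> (p - q) + (a - b)\<^sup>2 = 2 * (1 - p \<bullet> q - a * b)"
    using p q by (simp add: inner_diff_left inner_diff_right inner_commute[of q p] power2_eq_square algebra_simps)
  have "((1 / a) *\<^sub>R p - (1 / b) *\<^sub>R q) \<bullet> (p - q)
      = (1 / a) * (p \<bullet> p - p \<bullet> q) + (1 / b) * (q \<bullet> q - p \<bullet> q)"
    by (simp add: inner_diff_left inner_diff_right inner_commute[of q p] algebra_simps)
  also have "p \<bullet> p = 1 - a\<^sup>2" using p by simp
  also have "q \<bullet> q = 1 - b\<^sup>2" using q by simp
  also have "(1 / a) * (1 - a\<^sup>2 - p \<bullet> q) + (1 / b) * (1 - b\<^sup>2 - p \<bullet> q) = (1 / a + 1 / b) * (1 - p \<bullet> q - a * b)"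
    using pos by (simp add: field_simps power2_eq_square)
  finally show ?thesis unfolding 1 by simp
qed

lemma open_interval_Inf_Sup:
  fixes S :: "real set"
  assumes "open S" "convex S" "bounded S" "S \<noteq> {}"
  shows "S = {Inf S<..<Sup S}"
proof (intro set_eqI iffI)
  have bdd: "bdd_above S" "bdd_below S" using assms(3) bounded_imp_bdd_above bounded_imp_bdd_below by auto
  fix s
  { assume s: "s \<in> S"
    obtain e where e: "e > 0" "ball s e \<subseteq> S" using assms(1) s openE by blast
    then have "s + e / 2 \<in> S" "s - e / 2 \<in> S" by (auto intro!: subsetD[OF e(2)] simp: dist_real_def)
    then have "s + e / 2 \<le> Sup S" "Inf S \<le> s - e / 2" using bdd by (auto intro: cSup_upper cInf_lower)
    then show "s \<in> {Inf S<..<Sup S}" using e(1) by auto }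
  { assume "s \<in> {Inf S<..<Sup S}"
    then obtain a b where "a \<in> S" "a < s" "b \<in> S" "s < b"
      using less_cSupD[OF assms(4)] cInf_lessD[OF assms(4)] by (metis greaterThanLessThan_iff)
    then show "s \<in> S" using assms(2) mem_is_interval_1_I[of S a b s] by (simp add: is_interval_convex_1) }
qed

text \<open>A part of \<open>M\<close> that is the graph of a continuous function and whose normal is nowhere horizontal.  The regularity of
the function is inherited from \<open>M\<close>.\<close>

locale transversal_graph = convex_hypersurface M G for M G :: "'n::finite point set" +
  fixes \<Omega> :: "(real ^ 'n) set" and f :: "real ^ 'n \<Rightarrow> real"
  assumes open_domain: "open \<Omega>" and f_cont: "continuous_on \<Omega> f"
    and graph_M: "\<And>x. x \<in> \<Omega> \<Longrightarrow> (x, f x) \<in> M"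
    and transversal: "\<And>x. x \<in> \<Omega> \<Longrightarrow> snd (\<nu> (x, f x)) \<noteq> 0"
begin

definition hnormal :: "real ^ 'n \<Rightarrow> real ^ 'n" where "hnormal x = fst (\<nu> (x, f x))"

definition vnormal :: "real ^ 'n \<Rightarrow> real" where "vnormal x = snd (\<nu> (x, f x))"

lemma vnormal_nonzero: "x \<in> \<Omega> \<Longrightarrow> vnormal x \<noteq> 0"
  using transversal by (simp add: vnormal_def)

lemma normal_parts_unit: "x \<in> \<Omega> \<Longrightarrow> hnormal x \<bullet> hnormal x + (vnormal x)\<^sup>2 = 1"
  using norm_inner_normal[OF graph_M, of x] unfolding norm_eq_1 by (simp add: hnormal_def vnormal_def inner_prod_def power2_eq_square)

lemma norm_hnormal_le: "x \<in> \<Omega> \<Longrightarrow> norm (hnormal x) \<le> 1"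
proof -
  assume "x \<in> \<Omega>"
  then have "hnormal x \<bullet> hnormal x \<le> 1" using normal_parts_unit[of x] zero_le_power2[of "vnormal x"] by linarith
  then show ?thesis by (simp add: norm_eq_sqrt_inner)
qed

lemma graph_cont: "continuous_on \<Omega> (\<lambda>x. (x, f x))"
  by (intro continuous_intros f_cont)

lemma normal_cont: "continuous_on \<Omega> (\<lambda>x. \<nu> (x, f x))"
  using graph_M by (intro continuous_on_compose2[OF continuous_inner_normal graph_cont]) auto

lemma hnormal_cont: "continuous_on \<Omega> hnormal" and vnormal_cont: "continuous_on \<Omega> vnormal"
  unfolding hnormal_def vnormal_def using normal_cont by (auto intro: continuous_intros)

lemma graph_near:
  assumes x: "x \<in> \<Omega>" and r: "r > 0"
  obtains d where "d > 0" "ball x d \<subseteq> \<Omega>" "\<And>y. y \<in> ball x d \<Longrightarrow> (y, f y) \<in> M \<inter> ball (x, f x) r"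
proof -
  obtain d1 where d1: "d1 > 0" "ball x d1 \<subseteq> \<Omega>" using open_domain x openE by blast
  have "isCont (\<lambda>x. (x, f x)) x" using graph_cont x open_domain continuous_on_eq_continuous_at by blast
  then obtain d2 where d2: "d2 > 0" "\<And>y. dist y x < d2 \<Longrightarrow> dist (y, f y) (x, f x) < r"
    unfolding continuous_at_eps_delta using r by blast
  show thesis
  proof (rule that[of "min d1 d2"])
    show "(y, f y) \<in> M \<inter> ball (x, f x) r" if "y \<in> ball x (min d1 d2)" for y
    proof -
      have "y \<in> \<Omega>" using that d1 by auto
      moreover have "dist (y, f y) (x, f x) < r" using that by (intro d2) (auto simp: dist_commute)
      ultimately show ?thesis using graph_M by (simp only: Int_iff mem_ball dist_commute)
    qed
  qed (use d1 d2 in auto)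
qed

text \<open>Points of \<open>M\<close> near \<open>(x, f x)\<close> lie within \<open>\<eta>\<close> times their distance from the tangent plane.  As that plane is not
vertical, this first bounds \<open>f y - f x\<close> by a multiple of \<open>y - x\<close>, and then yields differentiability.\<close>

lemma f_has_derivative:
  assumes x: "x \<in> \<Omega>"
  shows "(f has_derivative (\<lambda>h. (- (1 / vnormal x) *\<^sub>R hnormal x) \<bullet> h)) (at x)"
  unfolding has_derivative_at_alt
proof (intro conjI allI impI)
  show "bounded_linear (\<lambda>h. (- (1 / vnormal x) *\<^sub>R hnormal x) \<bullet> h)" by (rule bounded_linear_inner_right)
  fix \<epsilon> :: real assume \<epsilon>: "\<epsilon> > 0"
  have v_pos: "\<bar>vnormal x\<bar> > 0" using vnormal_nonzero[OF x] by simp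
  \<comment> \<open>The estimate \<open>b \<le> K a\<close> below holds once \<open>\<eta>\<close> is at most half of the vertical part of the normal; the second bound on \<open>\<eta>\<close>
then makes the deviation from the tangent plane at most \<open>\<epsilon> a\<close>.\<close>
  define K where "K = 2 / \<bar>vnormal x\<bar> + 1"
  have K: "K > 0" using v_pos by (simp add: K_def add_pos_pos)
  define \<eta> where "\<eta> = min (\<bar>vnormal x\<bar> / 2) (\<epsilon> * \<bar>vnormal x\<bar> / (1 + K))"
  have \<eta>: "\<eta> > 0" "\<eta> \<le> \<bar>vnormal x\<bar> / 2" "\<eta> * (1 + K) \<le> \<epsilon> * \<bar>vnormal x\<bar>"
  proof -
    show "\<eta> > 0" using v_pos K \<epsilon> by (simp add: \<eta>_def)
    show "\<eta> \<le> \<bar>vnormal x\<bar> / 2" unfolding \<eta>_def by (rule min.cobounded1)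
    have "\<eta> \<le> \<epsilon> * \<bar>vnormal x\<bar> / (1 + K)" unfolding \<eta>_def by (rule min.cobounded2)
    then show "\<eta> * (1 + K) \<le> \<epsilon> * \<bar>vnormal x\<bar>" using K by (simp add: field_simps)
  qed
  obtain r where r: "r > 0" "\<And>Y. Y \<in> M \<inter> ball (x, f x) r \<Longrightarrow> \<bar>\<nu> (x, f x) \<bullet> (Y - (x, f x))\<bar> \<le> \<eta> * norm (Y - (x, f x))"
    by (rule inner_normal_tangent_plane[OF graph_M[OF x] \<eta>(1)], rule that) assumption+
  obtain d where d: "d > 0" "\<And>y. y \<in> ball x d \<Longrightarrow> (y, f y) \<in> M \<inter> ball (x, f x) r"
    using graph_near[OF x r(1)] by metis
  show "\<exists>d>0. \<forall>y. norm (y - x) < d \<longrightarrow> norm (f y - f x - (- (1 / vnormal x) *\<^sub>R hnormal x) \<bullet> (y - x)) \<le> \<epsilon> * norm (y - x)"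
  proof (intro exI[of _ d] conjI allI impI d(1))
    fix y assume "norm (y - x) < d"
    then have "y \<in> ball x d" by (simp add: dist_norm norm_minus_commute)
    from r(2)[OF d(2)[OF this]]
    have *: "\<bar>hnormal x \<bullet> (y - x) + vnormal x * (f y - f x)\<bar> \<le> \<eta> * norm (y - x, f y - f x)"
      by (simp add: hnormal_def vnormal_def inner_prod_def)
    define a where "a = norm (y - x)"
    define b where "b = \<bar>f y - f x\<bar>"
    have ab: "a \<ge> 0" "b \<ge> 0" by (auto simp: a_def b_def)
    have "\<eta> * norm (y - x, f y - f x) \<le> \<eta> * (a + b)"
      using \<eta>(1) norm_Pair_le[of "y - x" "f y - f x"] by (intro mult_left_mono) (auto simp: a_def b_def)
    with * have est: "\<bar>hnormal x \<bullet> (y - x) + vnormal x * (f y - f x)\<bar> \<le> \<eta> * (a + b)" by linarith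
    have "\<bar>hnormal x \<bullet> (y - x)\<bar> \<le> 1 * a"
      unfolding a_def using norm_hnormal_le[OF x] by (intro order_trans[OF Cauchy_Schwarz_ineq2] mult_right_mono) auto
    moreover have "\<bar>vnormal x * (f y - f x)\<bar> = \<bar>vnormal x\<bar> * b" by (simp add: b_def abs_mult)
    ultimately have "\<bar>vnormal x\<bar> * b \<le> a + \<eta> * (a + b)" using est by linarith
    also have "\<dots> \<le> a + \<bar>vnormal x\<bar> / 2 * (a + b)" using \<eta>(2) ab by (intro add_left_mono mult_right_mono) auto
    also have "\<dots> = a + \<bar>vnormal x\<bar> / 2 * a + \<bar>vnormal x\<bar> * b / 2" by (simp add: field_simps)
    finally have "\<bar>vnormal x\<bar> / 2 * b \<le> a + \<bar>vnormal x\<bar> / 2 * a" by simp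
    then have "b \<le> K * a" using v_pos by (simp add: K_def field_simps)
    then have "\<eta> * (a + b) \<le> \<eta> * ((1 + K) * a)" using \<eta>(1) by (intro mult_left_mono) (auto simp: algebra_simps)
    also have "\<dots> \<le> \<epsilon> * \<bar>vnormal x\<bar> * a" using mult_right_mono[OF \<eta>(3) ab(1)] by (simp add: mult.assoc)
    finally have "\<bar>hnormal x \<bullet> (y - x) + vnormal x * (f y - f x)\<bar> \<le> \<epsilon> * \<bar>vnormal x\<bar> * a" using est by linarith
    moreover have "hnormal x \<bullet> (y - x) + vnormal x * (f y - f x) = vnormal x * (f y - f x - (- (1 / vnormal x) *\<^sub>R hnormal x) \<bullet> (y - x))"
      using v_pos by (simp add: algebra_simps)
    ultimately have "\<bar>vnormal x\<bar> * \<bar>f y - f x - (- (1 / vnormal x) *\<^sub>R hnormal x) \<bullet> (y - x)\<bar> \<le> \<bar>vnormal x\<bar> * (\<epsilon> * a)"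
      by (simp only: abs_mult mult.commute mult.left_commute)
    then show "norm (f y - f x - (- (1 / vnormal x) *\<^sub>R hnormal x) \<bullet> (y - x)) \<le> \<epsilon> * norm (y - x)"
      using v_pos by (simp only: mult_le_cancel_left_pos real_norm_def a_def)
  qed
qed

text \<open>The gradient is bounded near every point because the vertical part of the normal is continuous and nonzero.\<close>

lemma f_locally_lipschitz: "locally_lipschitz_on \<Omega> f"
  unfolding locally_lipschitz_on_def
proof
  fix x assume x: "x \<in> \<Omega>"
  have mx: "\<bar>vnormal x\<bar> > 0" using vnormal_nonzero[OF x] by simp
  obtain d1 where d1: "d1 > 0" "ball x d1 \<subseteq> \<Omega>" using open_domain x openE by blast
  have "isCont vnormal x" using vnormal_cont x open_domain continuous_on_eq_continuous_at by blast
  then obtain d2 where d2: "d2 > 0" "\<And>y. dist y x < d2 \<Longrightarrow> dist (vnormal y) (vnormal x) < \<bar>vnormal x\<bar> / 2"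
    unfolding continuous_at_eps_delta using mx half_gt_zero by blast
  define d where "d = min d1 d2"
  have d: "d > 0" "d \<le> d1" "d \<le> d2" using d1 d2 by (auto simp: d_def)
  have "(2 / \<bar>vnormal x\<bar>)-lipschitz_on (ball x d) f"
  proof (rule lipschitz_onI)
    fix y z assume yz: "y \<in> ball x d" "z \<in> ball x d"
    have "norm (f y - f z) \<le> 2 / \<bar>vnormal x\<bar> * norm (y - z)"
    proof (rule differentiable_bound[OF convex_ball[of x d]])
      fix s assume s: "s \<in> ball x d"
      have s\<Omega>: "s \<in> \<Omega>" using s d d1 by auto
      then show "(f has_derivative (\<lambda>h. (- (1 / vnormal s) *\<^sub>R hnormal s) \<bullet> h)) (at s within ball x d)"
        using f_has_derivative has_derivative_at_withinI by blast
      have "\<bar>vnormal s - vnormal x\<bar> < \<bar>vnormal x\<bar> / 2" using d2(2)[of s] s d by (auto simp: dist_real_def dist_commute)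
      then have ms: "\<bar>vnormal s\<bar> \<ge> \<bar>vnormal x\<bar> / 2" by linarith
      have "norm (- (1 / vnormal s) *\<^sub>R hnormal s) \<le> 2 / \<bar>vnormal x\<bar>"
      proof -
        have "norm (- (1 / vnormal s) *\<^sub>R hnormal s) = norm (hnormal s) / \<bar>vnormal s\<bar>" by simp
        also have "\<dots> \<le> 1 / (\<bar>vnormal x\<bar> / 2)"
          using norm_hnormal_le[OF s\<Omega>] ms mx by (intro frac_le) auto
        finally show ?thesis by simp
      qed
      then show "onorm (\<lambda>h. (- (1 / vnormal s) *\<^sub>R hnormal s) \<bullet> h) \<le> 2 / \<bar>vnormal x\<bar>"
        unfolding real_norm_def[symmetric]
        by (intro onorm_le order_trans[OF Cauchy_Schwarz_ineq2[folded real_norm_def]] mult_right_mono) auto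
    qed (use yz in auto)
    then show "dist (f y) (f z) \<le> 2 / \<bar>vnormal x\<bar> * dist y z" by (simp add: dist_norm)
  qed simp
  then show "\<exists>e>0. \<exists>L. L-lipschitz_on (ball x e) f" using d(1) by blast
qed

lemma hnormal_locally_lipschitz: "locally_lipschitz_on \<Omega> hnormal"
  unfolding locally_lipschitz_on_def
proof
  fix x assume x: "x \<in> \<Omega>"
  obtain d1 L1 where d1: "d1 > 0" "L1-lipschitz_on (ball x d1) f"
    using f_locally_lipschitz x unfolding locally_lipschitz_on_def by blast
  obtain r L where r: "r > 0" and L: "L-lipschitz_on (M \<inter> ball (x, f x) r) \<nu>"
    using inner_normal_lipschitz_near[OF graph_M[OF x]] .
  obtain d2 where d2: "d2 > 0" "\<And>y. y \<in> ball x d2 \<Longrightarrow> (y, f y) \<in> M \<inter> ball (x, f x) r"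
    using graph_near[OF x r] by metis
  have L0: "L \<ge> 0" "L1 \<ge> 0" using L d1 lipschitz_on_nonneg by auto
  have "(L * (1 + L1))-lipschitz_on (ball x (min d1 d2)) hnormal"
  proof (rule lipschitz_onI)
    fix y z assume yz: "y \<in> ball x (min d1 d2)" "z \<in> ball x (min d1 d2)"
    have "norm (hnormal y - hnormal z) \<le> norm (\<nu> (y, f y) - \<nu> (z, f z))"
      unfolding hnormal_def fst_diff[symmetric] by (metis norm_fst_le prod.collapse)
    also have "\<dots> \<le> L * norm ((y, f y) - (z, f z))"
      using lipschitz_onD[OF L d2(2) d2(2), of y z] yz by (simp add: dist_norm)
    also have "\<dots> \<le> L * (norm (y - z) + norm (f y - f z))"
      using L0 norm_Pair_le[of "y - z" "f y - f z"] by (intro mult_left_mono) auto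
    also have "\<dots> \<le> L * (norm (y - z) + L1 * norm (y - z))"
      using L0 lipschitz_onD[OF d1(2), of y z] yz by (intro mult_left_mono add_left_mono) (auto simp: dist_norm)
    finally show "dist (hnormal y) (hnormal z) \<le> L * (1 + L1) * dist y z" by (simp add: dist_norm algebra_simps)
  qed (use L0 in auto)
  moreover have "min d1 d2 > 0" using d1 d2 by simp
  ultimately show "\<exists>e>0. \<exists>L. L-lipschitz_on (ball x e) hnormal" by blast
qed

lemma hnormal_has_derivative:
  assumes x: "x \<in> \<Omega>"
  obtains p' where "(hnormal has_derivative p') (at x)"
    "(\<Sum>b\<in>Basis. p' b \<bullet> b) = - (real CARD('n) * mean_curvature M G (x, f x))"
proof -
  obtain D where D: "(\<nu> has_derivative D) (at (x, f x) within M)"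
    and tr: "\<forall>L. linear L \<longrightarrow> (\<forall>h. \<nu> (x, f x) \<bullet> (h, L h) = 0) \<longrightarrow>
      (\<Sum>i\<in>UNIV. fst (D (axis i 1, L (axis i 1))) $ i) = - (real CARD('n) * mean_curvature M G (x, f x))"
    using inner_normal_derivative_trace[OF graph_M[OF x]] by blast
  define L where "L = (\<lambda>h. (- (1 / vnormal x) *\<^sub>R hnormal x) \<bullet> h)"
  have at: "at x within \<Omega> = at x" using x open_domain by (rule at_within_open)
  have f: "(f has_derivative L) (at x)" unfolding L_def by (rule f_has_derivative[OF x])
  have "((\<lambda>y. (y, f y)) has_derivative (\<lambda>h. (h, L h))) (at x within \<Omega>)"
    unfolding at by (intro has_derivative_Pair has_derivative_ident f)
  moreover have "(\<nu> has_derivative D) (at (x, f x) within (\<lambda>y. (y, f y)) ` \<Omega>)"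
    using graph_M by (intro has_derivative_subset[OF D]) auto
  ultimately have "((\<lambda>y. \<nu> (y, f y)) has_derivative (\<lambda>h. D (h, L h))) (at x within \<Omega>)"
    by (rule has_derivative_in_compose)
  then have "(hnormal has_derivative (\<lambda>h. fst (D (h, L h)))) (at x)"
    unfolding at hnormal_def by (rule has_derivative_fst)
  moreover have "linear L" using f has_derivative_linear by blast
  moreover have "\<nu> (x, f x) \<bullet> (h, L h) = 0" for h
    using vnormal_nonzero[OF x] by (simp add: inner_prod_def L_def hnormal_def vnormal_def)
  ultimately have "(\<Sum>i\<in>UNIV. fst (D (axis i 1, L (axis i 1))) $ i)
      = - (real CARD('n) * mean_curvature M G (x, f x))" using tr by blast
  then show thesis
    using \<open>(hnormal has_derivative (\<lambda>h. fst (D (h, L h)))) (at x)\<close> that[of "\<lambda>h. fst (D (h, L h))"]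
    by (simp add: sum_Basis_vec)
qed

end

locale convex_body_boundary = convex_hypersurface M G for M G :: "'n::finite point set" +
  assumes bounded_G: "bounded G"
begin

definition shadow :: "(real ^ 'n) set" where "shadow = fst ` G"

definition slice :: "real ^ 'n \<Rightarrow> real set" where "slice x = {s. (x, s) \<in> G}"

definition upper :: "real ^ 'n \<Rightarrow> real" where "upper x = Sup (slice x)"

definition lower :: "real ^ 'n \<Rightarrow> real" where "lower x = Inf (slice x)"

lemma open_shadow: "open shadow" and convex_shadow: "convex shadow" and bounded_shadow: "bounded shadow"
  unfolding shadow_def
  using G bounded_G by (auto intro: open_image_fst convex_linear_image linear_fst bounded_fst)

lemma slice_props:
  assumes "x \<in> shadow"
  shows "open (slice x)" "convex (slice x)" "bounded (slice x)" "slice x \<noteq> {}"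
proof -
  have "slice x = (\<lambda>s. (x, s)) -` G" by (auto simp: slice_def)
  then show "open (slice x)" using G(1) by (simp add: open_vimage continuous_intros)
  show "convex (slice x)"
  proof (rule convexI)
    fix s t u v :: real
    assume st: "s \<in> slice x" "t \<in> slice x" and uv: "0 \<le> u" "0 \<le> v" "u + v = 1"
    have "u *\<^sub>R (x, s) + v *\<^sub>R (x, t) \<in> G"
      by (rule convexD[OF G(2) _ _ uv]) (use st in \<open>auto simp: slice_def\<close>)
    then show "u *\<^sub>R s + v *\<^sub>R t \<in> slice x"
      using uv by (simp add: slice_def flip: scaleR_add_left)
  qed
  have "slice x \<subseteq> snd ` G" by (force simp: slice_def)
  then show "bounded (slice x)" using bounded_snd[OF bounded_G] bounded_subset by blast
  show "slice x \<noteq> {}" using assms by (auto simp: shadow_def slice_def)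
qed

lemma slice_eq: "x \<in> shadow \<Longrightarrow> slice x = {lower x<..<upper x}"
  unfolding lower_def upper_def by (intro open_interval_Inf_Sup slice_props)

lemma lower_less_upper: "x \<in> shadow \<Longrightarrow> lower x < upper x"
  using slice_eq[of x] slice_props(4)[of x] by auto

lemma G_eq: "(x, s) \<in> G \<longleftrightarrow> x \<in> shadow \<and> lower x < s \<and> s < upper x"
proof -
  have "x \<in> shadow" if "(x, s) \<in> G" unfolding shadow_def using imageI[OF that, of fst] by simp
  moreover have "(x, s) \<in> G \<longleftrightarrow> s \<in> {lower x<..<upper x}" if "x \<in> shadow"
    unfolding slice_eq[OF that, symmetric] by (simp add: slice_def)
  ultimately show ?thesis by (metis greaterThanLessThan_iff)
qed

lemma slice_closure: "s \<in> closure (slice x) \<Longrightarrow> (x, s) \<in> closure G"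
proof -
  assume s: "s \<in> closure (slice x)"
  have "(\<lambda>s. (x, s)) ` closure (slice x) \<subseteq> closure G"
  proof (rule image_closure_subset)
    show "(\<lambda>s. (x, s)) ` slice x \<subseteq> closure G"
      using closure_subset by (auto simp: slice_def)
  qed (intro continuous_intros closed_closure)+
  then show ?thesis using s by blast
qed

lemma upper_M: "x \<in> shadow \<Longrightarrow> (x, upper x) \<in> M" and lower_M: "x \<in> shadow \<Longrightarrow> (x, lower x) \<in> M"
proof -
  assume x: "x \<in> shadow"
  have bdd: "bdd_above (slice x)" "bdd_below (slice x)"
    using slice_props(3)[OF x] bounded_imp_bdd_above bounded_imp_bdd_below by auto
  have "upper x \<in> closure (slice x)" "lower x \<in> closure (slice x)"
    unfolding upper_def lower_def using slice_props(4)[OF x] bdd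
    by (auto intro: closure_contains_Sup closure_contains_Inf)
  then have "(x, upper x) \<in> closure G" "(x, lower x) \<in> closure G" using slice_closure by auto
  moreover have "(x, upper x) \<notin> G" "(x, lower x) \<notin> G" by (auto simp: G_eq)
  ultimately show "(x, upper x) \<in> M" "(x, lower x) \<in> M"
    using frontier interior_open[OF G(1)] by (auto simp: frontier_def)
qed

text \<open>A point of the closure of \<open>G\<close> over \<open>z\<close> in the shadow lies between \<open>lower z\<close> and \<open>upper z\<close>: otherwise the segment that joins
it to a point of \<open>G\<close> over \<open>z\<close> would contain one of these boundary points, but it lies in \<open>G\<close>.  Both claims then
follow from the convexity of the closure.\<close>

lemma convex_lower: "convex_on shadow lower" and concave_upper: "convex_on shadow (\<lambda>x. - upper x)"
proof -
  have between: "lower z \<le> c \<and> c \<le> upper z" if z: "z \<in> shadow" and c: "(z, c) \<in> closure G" for z c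
  proof -
    obtain s where s: "(z, s) \<in> G" using z by (auto simp: shadow_def)
    have "open_segment (z, s) (z, c) \<subseteq> interior G"
      using s c G by (intro in_interior_closure_convex_segment) (auto simp: interior_open)
    then have seg: "(z, (1 - t) * s + t * c) \<in> G" if "0 < t" "t < 1" "s \<noteq> c" for t
    proof -
      have "(z, (1 - t) * s + t * c) \<in> open_segment (z, s) (z, c)"
        unfolding in_segment using that by (auto intro!: exI[of _ t] simp flip: scaleR_add_left)
      then show ?thesis using \<open>open_segment (z, s) (z, c) \<subseteq> interior G\<close> interior_subset by blast
    qed
    have mid: "lower z < (1 - t) * s + t * c \<and> (1 - t) * s + t * c < upper z" if "0 < t" "t < 1" "s \<noteq> c" for t
      using seg[OF that] by (simp add: G_eq)
    have s': "lower z < s" "s < upper z" using s by (auto simp: G_eq)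
    show ?thesis
    proof (rule ccontr)
      assume "\<not> ?thesis"
      then consider "c < lower z" | "c > upper z" by linarith
      then show False
      proof cases
        case 1
        define t where "t = (s - lower z) / (s - c)"
        have "t * (s - c) = s - lower z" using 1 s' by (simp add: t_def)
        then have "(1 - t) * s + t * c = lower z" by (simp add: algebra_simps)
        moreover have "0 < t" "t < 1" using 1 s' by (auto simp: t_def)
        ultimately show False using mid[of t] 1 s' by auto
      next
        case 2
        define t where "t = (upper z - s) / (c - s)"
        have "t * (c - s) = upper z - s" using 2 s' by (simp add: t_def)
        then have "(1 - t) * s + t * c = upper z" by (simp add: algebra_simps)
        moreover have "0 < t" "t < 1" using 2 s' by (auto simp: t_def)
        ultimately show False using mid[of t] 2 s' by auto
      qed
    qed
  qed
  have comb: "((1 - t) *\<^sub>R x + t *\<^sub>R y, (1 - t) * c + t * d) \<in> closure G"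
    if "(x, c) \<in> M" "(y, d) \<in> M" "0 < t" "t < 1" for x y c d and t :: real
    using convexD_alt[OF convex_closure[OF G(2)], of "(x, c)" "(y, d)" t] M_closure that by auto
  have inS: "(1 - t) *\<^sub>R x + t *\<^sub>R y \<in> shadow" if "x \<in> shadow" "y \<in> shadow" "0 < t" "t < 1" for x y and t :: real
    using convexD_alt[OF convex_shadow, of x y t] that by simp
  show "convex_on shadow lower"
    using between[OF inS comb[OF lower_M lower_M]] convex_shadow by (intro convex_onI) auto
  show "convex_on shadow (\<lambda>x. - upper x)"
    using between[OF inS comb[OF upper_M upper_M]] convex_shadow
    by (intro convex_onI) (fastforce simp: algebra_simps)+
qed

lemma lower_normal: "x \<in> shadow \<Longrightarrow> snd (\<nu> (x, lower x)) > 0"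
  and upper_normal: "x \<in> shadow \<Longrightarrow> snd (\<nu> (x, upper x)) < 0"
proof -
  assume x: "x \<in> shadow"
  then obtain s where s: "(x, s) \<in> G" by (auto simp: shadow_def)
  have s': "lower x < s" "s < upper x" using s by (auto simp: G_eq)
  have "0 < snd (\<nu> (x, lower x)) * (s - lower x)"
    using inner_normal_strict[OF lower_M[OF x] s] by (simp add: inner_prod_def)
  then show "snd (\<nu> (x, lower x)) > 0" using s' by (simp add: zero_less_mult_iff)
  have "0 < snd (\<nu> (x, upper x)) * (s - upper x)"
    using inner_normal_strict[OF upper_M[OF x] s] by (simp add: inner_prod_def)
  then show "snd (\<nu> (x, upper x)) < 0" using s' by (simp add: zero_less_mult_iff)
qed

sublocale up: transversal_graph M G shadow upper
proof
  have "continuous_on shadow (\<lambda>x. - (- upper x))"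
    by (rule continuous_on_minus[OF convex_on_continuous[OF open_shadow concave_upper]])
  then show "continuous_on shadow upper" by simp
qed (use open_shadow upper_M upper_normal in \<open>auto simp: less_imp_neq\<close>)

sublocale low: transversal_graph M G shadow lower
proof
  show "continuous_on shadow lower" by (rule convex_on_continuous[OF open_shadow convex_lower])
  show "snd (\<nu> (x, lower x)) \<noteq> 0" if "x \<in> shadow" for x using lower_normal[OF that] by simp
qed (use open_shadow lower_M in auto)

text \<open>A hyperplane separating \<open>x\<close> from the shadow lifts to a vertical hyperplane that supports \<open>G\<close> at both points.\<close>

lemma normal_equal_over_boundary:
  assumes "(x, a) \<in> M" "(x, b) \<in> M" "x \<notin> shadow"
  shows "\<nu> (x, a) = \<nu> (x, b)"
proof -
  obtain n \<beta> where n: "n \<noteq> 0" "n \<bullet> x \<le> \<beta>" "\<And>y. y \<in> shadow \<Longrightarrow> \<beta> \<le> n \<bullet> y"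
    using separating_hyperplane_sets[of "{x}" shadow] convex_shadow assms(3) G(3) by (auto simp: shadow_def)
  have "supports (n /\<^sub>R norm n, 0) (x, c)" for c
    unfolding supports_def
  proof
    show "norm (n /\<^sub>R norm n, 0::real) = 1" using n(1) by (simp add: norm_Pair)
    show "\<forall>g\<in>G. 0 \<le> (n /\<^sub>R norm n, 0) \<bullet> (g - (x, c))"
    proof
      fix g assume "g \<in> G"
      then have "fst g \<in> shadow" by (simp add: shadow_def)
      then have "n \<bullet> x \<le> n \<bullet> fst g" using n by fastforce
      then show "0 \<le> (n /\<^sub>R norm n, 0) \<bullet> (g - (x, c))" 
        by (simp add: inner_prod_def inner_diff_right mult_left_mono)
    qed
  qed
  then show ?thesis using inner_normal_eq assms by metis
qed

text \<open>The compact set is the projection of the set of pairs of points of \<open>M\<close> on a common vertical line whose normals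
have horizontal parts at distance at least \<open>\<epsilon>\<close>.  By \<open>normal_equal_over_boundary\<close> it lies in the shadow.\<close>

lemma normals_close_near_boundary:
  assumes \<epsilon>: "\<epsilon> > 0"
  shows "\<exists>K. compact K \<and> K \<subseteq> shadow \<and> (\<forall>x\<in>shadow - K. norm (up.hnormal x - low.hnormal x) \<le> \<epsilon>)"
proof -
  define T where "T = {q \<in> M \<times> M. fst (fst q) = fst (snd q) \<and> \<epsilon> \<le> norm (fst (\<nu> (fst q)) - fst (\<nu> (snd q)))}"
  have "bounded (closure G)" using bounded_G by (rule bounded_closure)
  then have compact_M: "compact M" using closed_M M_closure bounded_subset compact_eq_bounded_closed by blast
  have cont: "continuous_on (M \<times> M) (\<lambda>q. norm (fst (\<nu> (fst q)) - fst (\<nu> (snd q))))"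
    by (intro continuous_intros continuous_on_compose2[OF continuous_inner_normal]) auto
  have "closed T"
  proof -
    have "T = {q \<in> M \<times> M. \<epsilon> \<le> norm (fst (\<nu> (fst q)) - fst (\<nu> (snd q)))} \<inter> {q. fst (fst q) = fst (snd q)}"
      by (auto simp: T_def)
    moreover have "closed {q \<in> M \<times> M. \<epsilon> \<le> norm (fst (\<nu> (fst q)) - fst (\<nu> (snd q)))}"
      using closed_M cont by (intro continuous_on_closed_Collect_le) (auto intro: closed_Times continuous_intros)
    moreover have "closed {q :: 'n point \<times> 'n point. fst (fst q) = fst (snd q)}"
      by (intro closed_Collect_eq continuous_intros)
    ultimately show ?thesis by auto
  qed
  moreover have "T \<subseteq> M \<times> M" by (auto simp: T_def)
  ultimately have "compact T" using compact_Times[OF compact_M compact_M]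
    by (metis compact_Int_closed inf.absorb_iff2)
  then have "compact ((\<lambda>q. fst (fst q)) ` T)" by (intro compact_continuous_image continuous_intros)
  moreover have "(\<lambda>q. fst (fst q)) ` T \<subseteq> shadow"
  proof
    fix x assume "x \<in> (\<lambda>q. fst (fst q)) ` T"
    then obtain a b where ab: "(x, a) \<in> M" "(x, b) \<in> M" "\<epsilon> \<le> norm (fst (\<nu> (x, a)) - fst (\<nu> (x, b)))"
      by (force simp: T_def)
    show "x \<in> shadow"
    proof (rule ccontr)
      assume "x \<notin> shadow"
      then have "\<nu> (x, a) = \<nu> (x, b)" using normal_equal_over_boundary ab(1,2) by blast
      then show False using ab(3) \<epsilon> by simp
    qed
  qed
  moreover have "norm (up.hnormal x - low.hnormal x) \<le> \<epsilon>" if x: "x \<in> shadow - (\<lambda>q. fst (fst q)) ` T" for x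
  proof (rule ccontr)
    assume "\<not> ?thesis"
    then have "((x, upper x), (x, lower x)) \<in> T"
      using x upper_M lower_M by (auto simp: T_def up.hnormal_def low.hnormal_def)
    then have "fst (fst ((x, upper x), (x, lower x))) \<in> (\<lambda>q. fst (fst q)) ` T" by (rule imageI)
    then show False using x by simp
  qed
  ultimately show ?thesis by blast
qed

lemma main_assumption_vertical:
  assumes "main_assumption M G" "x \<in> shadow"
  shows "mean_curvature M G (x, upper x) \<le> mean_curvature M G (x, lower x)"
proof -
  have "{(x, \<theta> * upper x + (1 - \<theta>) * lower x) | \<theta>. 0 \<le> \<theta> \<and> \<theta> \<le> 1} \<subseteq> closure G"
  proof clarify
    fix \<theta> :: real assume \<theta>: "0 \<le> \<theta>" "\<theta> \<le> 1"
    have "(1 - \<theta>) *\<^sub>R (x, lower x) + \<theta> *\<^sub>R (x, upper x) \<in> closure G"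
      using convexD_alt[OF convex_closure[OF G(2)], of "(x, lower x)" "(x, upper x)" \<theta>]
        M_closure upper_M[OF assms(2)] lower_M[OF assms(2)] \<theta> by blast
    then show "(x, \<theta> * upper x + (1 - \<theta>) * lower x) \<in> closure G"
      by (simp add: add.commute flip: scaleR_add_left)
  qed
  then show ?thesis
    using assms upper_M[OF assms(2)] lower_M[OF assms(2)] lower_less_upper[OF assms(2)]
    unfolding main_assumption_def by (meson less_imp_le)
qed

definition grad_sum :: "real ^ 'n \<Rightarrow> real ^ 'n" where
  "grad_sum x = (1 / - up.vnormal x) *\<^sub>R up.hnormal x - (1 / low.vnormal x) *\<^sub>R low.hnormal x"

lemma grad_sum_flux:
  assumes x: "x \<in> shadow"
  shows "grad_sum x \<bullet> (up.hnormal x - low.hnormal x)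
    = (1 / - up.vnormal x + 1 / low.vnormal x) / 2 *
      ((up.hnormal x - low.hnormal x) \<bullet> (up.hnormal x - low.hnormal x) + (- up.vnormal x - low.vnormal x)\<^sup>2)"
  unfolding grad_sum_def
  using upper_normal[OF x] lower_normal[OF x] up.normal_parts_unit[OF x] low.normal_parts_unit[OF x]
  by (intro normal_difference_identity) (auto simp: up.vnormal_def low.vnormal_def)

lemma coeff_pos: "x \<in> shadow \<Longrightarrow> 0 < 1 / - up.vnormal x + 1 / low.vnormal x"
  using upper_normal[of x] lower_normal[of x] unfolding up.vnormal_def low.vnormal_def
  by (intro add_pos_pos) (auto intro: divide_pos_pos)

lemma upper_plus_lower_has_derivative:
  assumes "x \<in> shadow"
  shows "((\<lambda>x. upper x + lower x + C) has_derivative (\<lambda>h. grad_sum x \<bullet> h)) (at x)"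
  by (rule has_derivative_eq_rhs, rule has_derivative_add[OF has_derivative_add[OF up.f_has_derivative[OF assms] low.f_has_derivative[OF assms]] has_derivative_const])
    (simp add: grad_sum_def inner_diff_left fun_eq_iff)

text \<open>The vanishing principle is applied to \<open>\<phi> = upper + lower + 2 R\<close>, where \<open>R\<close> bounds \<open>G\<close>, and to the difference of the
horizontal normals.  By the strict monotonicity, vanishing of the flux forces equal horizontal and opposite vertical
parts of the two normals, and then the gradients of \<open>upper\<close> and \<open>lower\<close> cancel.\<close>

lemma upper_plus_lower_const:
  assumes main: "main_assumption M G"
  obtains c where "\<And>x. x \<in> shadow \<Longrightarrow> upper x + lower x = 2 * c"
proof -
  obtain R where R: "\<And>Y. Y \<in> closure G \<Longrightarrow> norm Y \<le> R"
    using bounded_closure[OF bounded_G] bounded_iff by metis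
  have bd: "\<bar>upper x\<bar> \<le> R" "\<bar>lower x\<bar> \<le> R" if "x \<in> shadow" for x
  proof -
    have "norm (x, upper x) \<le> R" "norm (x, lower x) \<le> R"
      using upper_M[OF that] lower_M[OF that] M_closure R by blast+
    then show "\<bar>upper x\<bar> \<le> R" "\<bar>lower x\<bar> \<le> R"
      using norm_snd_le[of "upper x" x] norm_snd_le[of "lower x" x] unfolding real_norm_def by linarith+
  qed
  define \<phi> where "\<phi> = (\<lambda>x. upper x + lower x + 2 * R)"
  define P where "P = (\<lambda>x. up.hnormal x - low.hnormal x)"
  have \<phi>_der: "(\<phi> has_derivative (\<lambda>h. grad_sum x \<bullet> h)) (at x)" if "x \<in> shadow" for x
    unfolding \<phi>_def by (rule upper_plus_lower_has_derivative[OF that])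
  have "\<exists>D. (P has_derivative D) (at x) \<and> 0 \<le> (\<Sum>b\<in>Basis. D b \<bullet> b)" if x: "x \<in> shadow" for x
  proof -
    obtain D1 where D1: "(up.hnormal has_derivative D1) (at x)"
      "(\<Sum>b\<in>Basis. D1 b \<bullet> b) = - (real CARD('n) * mean_curvature M G (x, upper x))"
      by (rule up.hnormal_has_derivative[OF x])
    obtain D2 where D2: "(low.hnormal has_derivative D2) (at x)"
      "(\<Sum>b\<in>Basis. D2 b \<bullet> b) = - (real CARD('n) * mean_curvature M G (x, lower x))"
      by (rule low.hnormal_has_derivative[OF x])
    have "(P has_derivative (\<lambda>h. D1 h - D2 h)) (at x)"
      unfolding P_def by (rule has_derivative_diff[OF D1(1) D2(1)])
    moreover have "(\<Sum>b\<in>Basis. (D1 b - D2 b) \<bullet> b)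
        = real CARD('n) * (mean_curvature M G (x, lower x) - mean_curvature M G (x, upper x))"
      by (simp add: inner_diff_left sum_subtractf D1(2) D2(2) right_diff_distrib)
    ultimately show ?thesis
      using main_assumption_vertical[OF main x] by (intro exI[of _ "\<lambda>h. D1 h - D2 h"]) auto
  qed
  then obtain P' where P': "\<And>x. x \<in> shadow \<Longrightarrow> (P has_derivative P' x) (at x)"
    "\<And>x. x \<in> shadow \<Longrightarrow> 0 \<le> (\<Sum>b\<in>Basis. P' x b \<bullet> b)" by metis
  have flux: "grad_sum x \<bullet> P x = 0" if x: "x \<in> shadow" for x
  proof (rule boundary_null_field_orthogonal[OF open_shadow convex_shadow bounded_shadow \<phi>_der _ _ _ P'(1) _ P'(2) _ _ _ x, where C = "4 * R"])
    show "locally_lipschitz_on shadow \<phi>"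
    proof -
      have "locally_lipschitz_on shadow (\<lambda>x. - lower x - 2 * R)"
        using low.f_locally_lipschitz unfolding locally_lipschitz_on_def
        by (simp add: lipschitz_on_def dist_real_def abs_minus_commute)
      from locally_lipschitz_on_diff[OF up.f_locally_lipschitz this] show ?thesis 
        by (simp add: \<phi>_def diff_diff_eq2 ac_simps)
    qed
    show "0 \<le> \<phi> x" "\<phi> x \<le> 4 * R" if "x \<in> shadow" for x using bd[OF that] by (auto simp: \<phi>_def)
    show "locally_lipschitz_on shadow P"
      unfolding P_def by (intro locally_lipschitz_on_diff up.hnormal_locally_lipschitz low.hnormal_locally_lipschitz)
    show "0 \<le> grad_sum x \<bullet> P x" if "x \<in> shadow" for x
      unfolding P_def grad_sum_flux[OF that] using coeff_pos[OF that] by (intro mult_nonneg_nonneg) auto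
    show "continuous_on shadow (\<lambda>x. grad_sum x \<bullet> P x)"
      unfolding grad_sum_def P_def
      using up.vnormal_nonzero low.vnormal_nonzero
      by (intro continuous_intros up.hnormal_cont low.hnormal_cont up.vnormal_cont low.vnormal_cont) auto
    show "\<exists>K. compact K \<and> K \<subseteq> shadow \<and> (\<forall>x\<in>shadow - K. norm (P x) \<le> \<epsilon>)" if "\<epsilon> > 0" for \<epsilon>
      unfolding P_def by (rule normals_close_near_boundary[OF that])
  qed auto
  have "grad_sum x = 0" if x: "x \<in> shadow" for x
  proof -
    have "(up.hnormal x - low.hnormal x) \<bullet> (up.hnormal x - low.hnormal x) + (- up.vnormal x - low.vnormal x)\<^sup>2 = 0"
    proof -
      have "(1 / - up.vnormal x + 1 / low.vnormal x) / 2 \<noteq> 0"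
        using half_gt_zero[OF coeff_pos[OF x]] by (rule less_imp_neq[symmetric])
      then show ?thesis using flux[OF x] unfolding P_def grad_sum_flux[OF x] mult_eq_0_iff by blast
    qed
    then have "(up.hnormal x - low.hnormal x) \<bullet> (up.hnormal x - low.hnormal x) = 0" "(- up.vnormal x - low.vnormal x)\<^sup>2 = 0"
      by (simp_all add: add_nonneg_eq_0_iff)
    then have "up.hnormal x = low.hnormal x" "- up.vnormal x = low.vnormal x" by simp_all
    then show ?thesis by (simp add: grad_sum_def)
  qed
  then have "(\<phi> has_derivative (\<lambda>h. 0)) (at x within shadow)" if "x \<in> shadow" for x
    using \<phi>_der[OF that] that by (simp add: has_derivative_at_withinI)
  then obtain k where k: "\<And>x. x \<in> shadow \<Longrightarrow> \<phi> x = k"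
    using has_derivative_zero_constant[OF convex_shadow] by blast
  show thesis
  proof (rule that)
    show "upper x + lower x = 2 * ((k - 2 * R) / 2)" if "x \<in> shadow" for x
      using k[OF that] by (simp add: \<phi>_def)
  qed
qed

text \<open>The reflection is a continuous involution preserving \<open>G\<close>, hence it preserves the closure and the frontier.\<close>

lemma reflection_symmetric:
  assumes "\<And>x. x \<in> shadow \<Longrightarrow> upper x + lower x = 2 * c"
  shows "(\<lambda>(x, s). (x, 2 * c - s)) ` M = M"
proof -
  let ?\<rho> = "\<lambda>Y :: 'n point. (fst Y, 2 * c - snd Y)"
  have \<rho>G: "?\<rho> Y \<in> G \<longleftrightarrow> Y \<in> G" for Y
    using assms[of "fst Y"] G_eq[of "fst Y" "snd Y"] G_eq[of "fst Y" "2 * c - snd Y"] by auto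
  have "?\<rho> ` closure G \<subseteq> closure G"
  proof (rule image_closure_subset)
    show "?\<rho> ` G \<subseteq> closure G" using \<rho>G closure_subset by blast
  qed (intro continuous_intros closed_closure)+
  then have \<rho>M: "?\<rho> Y \<in> M" if "Y \<in> M" for Y
    using that \<rho>G frontier interior_open[OF G(1)] by (auto simp: frontier_def)
  have "?\<rho> ` M = M"
  proof
    show "?\<rho> ` M \<subseteq> M" using \<rho>M by blast
    show "M \<subseteq> ?\<rho> ` M" using \<rho>M by (force intro: image_eqI[of _ _ "?\<rho> _"])
  qed
  then show ?thesis by (simp add: case_prod_beta)
qed

end

theorem corollary1:
  fixes M G :: "'n::finite point set"
  assumes "CARD('n) \<ge> 2"
    and "smooth_hypersurface M" and "compact M" and "connected M" and "M \<noteq> {}"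
    and "open G" and "bounded G" and "convex G" and "frontier G = M"
    and "main_assumption M G"
    and "condition_T M G"
  shows "\<exists>c. (\<lambda>(x, s). (x, 2 * c - s)) ` M = M"
proof -
  have "G \<noteq> {}" using assms by auto
  then interpret convex_body_boundary M G
    by unfold_locales (use assms in auto)
  obtain c where "\<And>x. x \<in> shadow \<Longrightarrow> upper x + lower x = 2 * c"
    using upper_plus_lower_const[OF \<open>main_assumption M G\<close>] by blast
  from reflection_symmetric[OF this] show ?thesis by blast
qed

end
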